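(* For every complete ultrametric field $\mathbb{K}$, locally convex topological $\mathbb{K}$-vector space $E$, $n_1,\ldots,n_\ell\in\mathbb{N}$, $\alpha\in(\mathbb{N}_0\cup\{\infty\})^\ell$ and locally closed, locally cartesian subset $U\subseteq\mathbb{K}^{n_1}\times\cdots\times\mathbb{K}^{n_\ell}=\mathbb{K}^n$ with $n:=n_1+\cdots+n_\ell$, the space $\mathrm{LocPol}_{\le\alpha}(U,E)$ of $E$-valued locally polynomial functions of multidegree $\le\alpha$ is dense in $C^\alpha(U,E)$.
   Context: An ultrametric field is a field $\mathbb{K}$ with an absolute value satisfying the ultrametric inequality and defining a non-discrete topology; complete means complete for the metric $|x-y|$. All topological vector spaces are Hausdorff. A topological $\mathbb{K}$-vector space is locally convex if its open $\mathbb{O}$-submodules form a basis of $0$-neighbourhoods, $\mathbb{O}=\{z\in\mathbb{K}:|z|\le1\}$. $\mathbb{N}_0=\{0,1,\ldots\}$. A subset $Y$ of a topological space $X$ is locally closed if for each $x\in Y$ and each neighbourhood $W\subseteq Y$ of $x$ (in the induced topology) there is a neighbourhood $V\subseteq W$ of $x$ in $Y$ which is closed in $X$. A subset $U\subseteq\mathbb{K}^n$ is cartesian if $U=U_1\times\cdots\times U_n$ with subsets $U_i\subseteq\mathbb{K}$ without isolated points; it is locally cartesian if every point of $U$ has a relatively open neighbourhood in $U$ which is cartesian. Let $N_\alpha$ be the set of all $\eta=(\eta_1,\ldots,\eta_\ell)\in\mathbb{N}_0^{n_1}\times\cdots\times\mathbb{N}_0^{n_\ell}=\mathbb{N}_0^n$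 with $|\eta_j|\le\alpha_j$ for all $j$, where $|\eta_j|$ is the sum of the components of $\eta_j$. A function $p\colon V\to E$ on $V\subseteq\mathbb{K}^n$ is polynomial of multidegree $\le\alpha$ if $p(x)=\sum_{\eta\in N_\alpha}x^\eta a_\eta$ for all $x\in V$, with $a_\eta\in E$, all but finitely many zero, $x^\eta=x_1^{\eta^{(1)}}\cdots x_n^{\eta^{(n)}}$ where $\eta^{(1)},\ldots,\eta^{(n)}$ are the components of $\eta\in\mathbb{N}_0^n$. A function $f\colon U\to E$ is locally polynomial of multidegree $\le\alpha$ if each $x\in U$ has an open neighbourhood $V$ in $U$ such that $f|_V$ is polynomial of multidegree $\le\alpha$. Coordinatewise $C^\eta$-maps. Let $U=U_1\times\cdots\times U_n\subseteq\mathbb{K}^n$ be cartesian, $f\colon U\to E$ and $\gamma\in\mathbb{N}_0^n$. Put $U^{<\gamma>}:=U_1^{1+\gamma_1}\times\cdots\times U_n^{1+\gamma_n}$, with elements $x=(x^{(1)},\ldots,x^{(n)})$, $x^{(i)}=(x^{(i)}_0,\ldots,x^{(i)}_{\gamma_i})$, and let $U^{>\gamma<}$ be the (dense, open) set of $x\in U^{<\gamma>}$ with $x^{(i)}_j\ne x^{(i)}_k$ for all $i$ and $0\le j<k\le\gamma_i$. Define \[ f^{>\gamma<}(x)=\sum_{j_1=0}^{\gamma_1}\cdots\sum_{j_n=0}^{\gamma_n}\Big(\prod_{i=1}^n\ \prod_{k_i\in\{0,\ldots,\gamma_i\}\setminus\{j_i\}}\frac{1}{x^{(i)}_{j_i}-x^{(i)}_{k_i}}\Big)f(x^{(1)}_{j_1},\ldots,x^{(n)}_{j_n})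 \] for $x\in U^{>\gamma<}$ (empty products are $1$). For $\eta\in\mathbb{N}_0^n$, $f$ is $C^\eta$ if for every $\gamma\in\mathbb{N}_0^n$ with $\gamma\le\eta$ (componentwise) $f^{>\gamma<}$ has a (unique) continuous extension $f^{<\gamma>}\colon U^{<\gamma>}\to E$. If $U$ is only locally cartesian, $f$ is $C^\eta$ if $f|_V$ is $C^\eta$ for each cartesian relatively open $V\subseteq U$. $C^\eta(U,E)$ carries the initial topology with respect to the maps $f\mapsto(f|_V)^{<\gamma>}\in C(V^{<\gamma>},E)$ (compact-open topology on the target) for all $\gamma\le\eta$ in $\mathbb{N}_0^n$ and cartesian relatively open $V\subseteq U$. For $\alpha\in(\mathbb{N}_0\cup\{\infty\})^\ell$, $f\colon U\to E$ is $C^\alpha$ if it is $C^\eta$ for all $\eta\in N_\alpha$; $C^\alpha(U,E)=\bigcap_{\eta\in N_\alpha}C^\eta(U,E)$ carries the initial topology with respect to the inclusion maps $C^\alpha(U,E)\to C^\eta(U,E)$, $\eta\in N_\alpha$. *)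

theory Defs
  imports "HOL-Analysis.Analysis" "HOL-Library.Extended_Nat"
begin

section \<open>Ultrametric fields and locally convex spaces\<close>

text \<open>
  The absolute value is a parameter of its own since \<open>norm\<close> is confined to real normed spaces.
  That it is non-negative and vanishes only at \<open>0\<close> follows from \<open>dist_absval\<close>, \<open>dist\<close> being a metric.
\<close>

class ultrametric_field = field + metric_space +
  fixes absval :: "'a \<Rightarrow> real"
  assumes dist_absval: "dist x y = absval (x - y)"
    and absval_mult: "absval (x * y) = absval x * absval y"
    and absval_add: "absval (x + y) \<le> max (absval x) (absval y)"
    and not_discrete: "\<exists>S. \<not> open S"

definition O_submodule :: "('k::ultrametric_field \<Rightarrow> 'e::ab_group_add \<Rightarrow> 'e) \<Rightarrow> 'e set \<Rightarrow> bool" where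
  "O_submodule smul M \<longleftrightarrow>
     0 \<in> M \<and> (\<forall>x\<in>M. \<forall>y\<in>M. x + y \<in> M) \<and> (\<forall>c. \<forall>x\<in>M. absval c \<le> 1 \<longrightarrow> smul c x \<in> M)"

locale ultrametric_lcs = vector_space smul
  for smul :: "'k::ultrametric_field \<Rightarrow> 'e::{topological_ab_group_add, t2_space} \<Rightarrow> 'e" +
  assumes continuous_smul: "continuous_on UNIV (\<lambda>(c, x). smul c x)"
    and O_submodule_basis:
      "\<And>W. open W \<Longrightarrow> 0 \<in> W \<Longrightarrow> \<exists>M. open M \<and> O_submodule smul M \<and> M \<subseteq> W"


section \<open>Two constructions of topologies\<close>

text \<open>
  The set \<open>A\<close> itself is included in the subbasis so that the underlying set is \<open>A\<close> also when the
  family of maps is empty.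
\<close>

definition initial_topology ::
    "'a set \<Rightarrow> 'j set \<Rightarrow> ('j \<Rightarrow> 'b topology) \<Rightarrow> ('j \<Rightarrow> 'a \<Rightarrow> 'b) \<Rightarrow> 'a topology" where
  "initial_topology A J T \<phi> =
     topology_generated_by (insert A {A \<inter> \<phi> j -` W | j W. j \<in> J \<and> openin (T j) W})"

text \<open>
  Throughout, a function with domain \<open>X\<close> is an element of \<open>X \<rightarrow>\<^sub>E UNIV\<close>, i.e. it is
  \<^term>\<open>undefined\<close> outside \<open>X\<close>.
\<close>

definition cont_maps :: "'a::topological_space set \<Rightarrow> ('a \<Rightarrow> 'b::topological_space) set" where
  "cont_maps X = {g \<in> X \<rightarrow>\<^sub>E UNIV. continuous_on X g}"

definition compact_open_topology ::
    "'a::topological_space set \<Rightarrow> ('a \<Rightarrow> 'b::topological_space) topology" where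
  "compact_open_topology X =
     topology_generated_by {{g \<in> cont_maps X. g ` C \<subseteq> W} | C W. C \<subseteq> X \<and> compact C \<and> open W}"

lemma topspace_initial_topology [simp]: "topspace (initial_topology A J T \<phi>) = A"
  by (auto simp: initial_topology_def topology_generated_by_topspace)

lemma topspace_compact_open_topology [simp]:
  "topspace (compact_open_topology X :: ('a::topological_space \<Rightarrow> 'b::topological_space) topology)
     = cont_maps X"
proof -
  have "cont_maps X \<in> {{g \<in> cont_maps X. g ` C \<subseteq> W} | C W. C \<subseteq> X \<and> compact C \<and> open (W :: 'b set)}"
    by (rule CollectI, rule exI[of _ "{}"], rule exI[of _ UNIV]) auto
  then show ?thesis
    unfolding compact_open_topology_def topology_generated_by_topspace by auto
qed


section \<open>Coordinate spaces and cartesian sets\<close>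

text \<open>
  The coordinates of a point of the product of the \<open>l\<close> spaces \<open>K\<close> to the power \<open>n 0, \<dots>, n (l - 1)\<close>
  are indexed by the pairs \<open>(j, i)\<close>, with \<open>j\<close> the block and \<open>i\<close> the position in it. Most notions refer only to the set of all
  coordinate indices and are stated for an arbitrary index set \<open>I\<close>. Points of \<open>K\<^sup>I\<close> are the elements
  of \<open>I \<rightarrow>\<^sub>E UNIV\<close>, whose subspace topology in the function type is the product topology.
\<close>

definition block_indices :: "nat \<Rightarrow> (nat \<Rightarrow> nat) \<Rightarrow> (nat \<times> nat) set" where
  "block_indices l n = (SIGMA j:{..<l}. {..<n j})"

definition coord_space :: "'i set \<Rightarrow> ('i \<Rightarrow> 'k) set" where
  "coord_space I = (I \<rightarrow>\<^sub>E UNIV)"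

definition locally_closed_in :: "'a::topological_space set \<Rightarrow> 'a set \<Rightarrow> bool" where
  "locally_closed_in X Y \<longleftrightarrow>
     Y \<subseteq> X \<and> neighbourhood_base_of (closedin (top_of_set X)) (top_of_set Y)"

definition cartesian :: "'i set \<Rightarrow> ('i \<Rightarrow> 'k::topological_space) set \<Rightarrow> bool" where
  "cartesian I U \<longleftrightarrow>
     (\<exists>F. U = (\<Pi>\<^sub>E i\<in>I. F i) \<and> (\<forall>i\<in>I. \<forall>t\<in>F i. \<not> t isolated_in F i))"

definition locally_cartesian :: "'i set \<Rightarrow> ('i \<Rightarrow> 'k::topological_space) set \<Rightarrow> bool" where
  "locally_cartesian I U \<longleftrightarrow>
     U \<subseteq> coord_space I \<and>
     (\<forall>x\<in>U. \<exists>V. openin (top_of_set U) V \<and> x \<in> V \<and> cartesian I V)"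

text \<open>The \<open>i\<close>-th factor of a cartesian set, recovered as a projection.\<close>

definition factor :: "('i \<Rightarrow> 'k) set \<Rightarrow> 'i \<Rightarrow> 'k set" where
  "factor U i = (\<lambda>x. x i) ` U"


section \<open>Locally polynomial functions\<close>

definition multi_indices :: "'i set \<Rightarrow> ('i \<Rightarrow> nat) set" where
  "multi_indices I = (I \<rightarrow>\<^sub>E UNIV)"

text \<open>The set written \<open>N\<^sub>\<alpha>\<close> in the literature; \<open>\<alpha> j\<close> only matters for \<open>j < l\<close>.\<close>

definition multi_indices_le ::
    "nat \<Rightarrow> (nat \<Rightarrow> nat) \<Rightarrow> (nat \<Rightarrow> enat) \<Rightarrow> (nat \<times> nat \<Rightarrow> nat) set" where
  "multi_indices_le l n \<alpha> =
     {\<eta> \<in> multi_indices (block_indices l n). \<forall>j<l. enat (\<Sum>i<n j. \<eta> (j, i)) \<le> \<alpha> j}"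

definition polynomial_on ::
    "('k::comm_ring_1 \<Rightarrow> 'e::ab_group_add \<Rightarrow> 'e) \<Rightarrow> 'i set \<Rightarrow> ('i \<Rightarrow> nat) set \<Rightarrow>
     ('i \<Rightarrow> 'k) set \<Rightarrow> (('i \<Rightarrow> 'k) \<Rightarrow> 'e) \<Rightarrow> bool" where
  "polynomial_on smul I N V p \<longleftrightarrow>
     (\<exists>a. finite {\<eta> \<in> N. a \<eta> \<noteq> 0} \<and>
          (\<forall>x\<in>V. p x = (\<Sum>\<eta> | \<eta> \<in> N \<and> a \<eta> \<noteq> 0. smul (\<Prod>i\<in>I. x i ^ \<eta> i) (a \<eta>))))"

definition LocPol ::
    "('k::{comm_ring_1, topological_space} \<Rightarrow> 'e::ab_group_add \<Rightarrow> 'e) \<Rightarrow> 'i set \<Rightarrow>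
     ('i \<Rightarrow> nat) set \<Rightarrow> ('i \<Rightarrow> 'k) set \<Rightarrow> (('i \<Rightarrow> 'k) \<Rightarrow> 'e) set" where
  "LocPol smul I N U =
     {f \<in> U \<rightarrow>\<^sub>E UNIV. \<forall>x\<in>U. \<exists>V. openin (top_of_set U) V \<and> x \<in> V \<and> polynomial_on smul I N V f}"


section \<open>Coordinatewise differentiability\<close>

text \<open>
  \<open>mult_dom I U \<gamma>\<close> is \<open>U\<^sup><\<^sup>\<gamma>\<^sup>>\<close> and \<open>mult_dom_distinct I U \<gamma>\<close> is \<open>U\<^sup>>\<^sup>\<gamma>\<^sup><\<close>, for cartesian \<open>U\<close>;
  \<open>div_diff\<close> is \<open>f\<^sup>>\<^sup>\<gamma>\<^sup><\<close> and \<open>div_diff_ext\<close> is its extension \<open>f\<^sup><\<^sup>\<gamma>\<^sup>>\<close>.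
\<close>

definition mult_dom :: "'i set \<Rightarrow> ('i \<Rightarrow> 'k) set \<Rightarrow> ('i \<Rightarrow> nat) \<Rightarrow> ('i \<Rightarrow> nat \<Rightarrow> 'k) set" where
  "mult_dom I U \<gamma> = (\<Pi>\<^sub>E i\<in>I. \<Pi>\<^sub>E j\<in>{..\<gamma> i}. factor U i)"

definition mult_dom_distinct ::
    "'i set \<Rightarrow> ('i \<Rightarrow> 'k) set \<Rightarrow> ('i \<Rightarrow> nat) \<Rightarrow> ('i \<Rightarrow> nat \<Rightarrow> 'k) set" where
  "mult_dom_distinct I U \<gamma> =
     {x \<in> mult_dom I U \<gamma>. \<forall>i\<in>I. \<forall>j k. j < k \<and> k \<le> \<gamma> i \<longrightarrow> x i j \<noteq> x i k}"

definition div_diff ::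
    "('k::field \<Rightarrow> 'e::ab_group_add \<Rightarrow> 'e) \<Rightarrow> 'i set \<Rightarrow> (('i \<Rightarrow> 'k) \<Rightarrow> 'e) \<Rightarrow> ('i \<Rightarrow> nat) \<Rightarrow>
     ('i \<Rightarrow> nat \<Rightarrow> 'k) \<Rightarrow> 'e" where
  "div_diff smul I f \<gamma> x =
     (\<Sum>j \<in> (\<Pi>\<^sub>E i\<in>I. {..\<gamma> i}).
        smul (\<Prod>i\<in>I. \<Prod>k\<in>{..\<gamma> i} - {j i}. 1 / (x i (j i) - x i k))
              (f (\<lambda>i\<in>I. x i (j i))))"

definition is_div_diff_ext ::
    "('k::{field, topological_space} \<Rightarrow> 'e::{ab_group_add, topological_space} \<Rightarrow> 'e) \<Rightarrow> 'i set \<Rightarrow>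
     ('i \<Rightarrow> 'k) set \<Rightarrow> (('i \<Rightarrow> 'k) \<Rightarrow> 'e) \<Rightarrow> ('i \<Rightarrow> nat) \<Rightarrow> (('i \<Rightarrow> nat \<Rightarrow> 'k) \<Rightarrow> 'e) \<Rightarrow> bool" where
  "is_div_diff_ext smul I U f \<gamma> g \<longleftrightarrow>
     g \<in> cont_maps (mult_dom I U \<gamma>) \<and>
     (\<forall>x\<in>mult_dom_distinct I U \<gamma>. g x = div_diff smul I f \<gamma> x)"

definition div_diff_ext ::
    "('k::{field, topological_space} \<Rightarrow> 'e::{ab_group_add, topological_space} \<Rightarrow> 'e) \<Rightarrow> 'i set \<Rightarrow>
     ('i \<Rightarrow> 'k) set \<Rightarrow> (('i \<Rightarrow> 'k) \<Rightarrow> 'e) \<Rightarrow> ('i \<Rightarrow> nat) \<Rightarrow> ('i \<Rightarrow> nat \<Rightarrow> 'k) \<Rightarrow> 'e" where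
  "div_diff_ext smul I U f \<gamma> = (THE g. is_div_diff_ext smul I U f \<gamma> g)"

definition lower_multi_indices :: "'i set \<Rightarrow> ('i \<Rightarrow> nat) \<Rightarrow> ('i \<Rightarrow> nat) set" where
  "lower_multi_indices I \<eta> = {\<gamma> \<in> multi_indices I. \<forall>i\<in>I. \<gamma> i \<le> \<eta> i}"

definition C_eta_cartesian ::
    "('k::{field, topological_space} \<Rightarrow> 'e::{ab_group_add, topological_space} \<Rightarrow> 'e) \<Rightarrow> 'i set \<Rightarrow>
     ('i \<Rightarrow> nat) \<Rightarrow> ('i \<Rightarrow> 'k) set \<Rightarrow> (('i \<Rightarrow> 'k) \<Rightarrow> 'e) \<Rightarrow> bool" where
  "C_eta_cartesian smul I \<eta> U f \<longleftrightarrow>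
     (\<forall>\<gamma>\<in>lower_multi_indices I \<eta>. \<exists>g. is_div_diff_ext smul I U f \<gamma> g)"

definition cartesian_open_subsets ::
    "'i set \<Rightarrow> ('i \<Rightarrow> 'k::topological_space) set \<Rightarrow> ('i \<Rightarrow> 'k) set set" where
  "cartesian_open_subsets I U = {V. openin (top_of_set U) V \<and> cartesian I V}"

definition C_eta ::
    "('k::{field, topological_space} \<Rightarrow> 'e::{ab_group_add, topological_space} \<Rightarrow> 'e) \<Rightarrow> 'i set \<Rightarrow>
     ('i \<Rightarrow> nat) \<Rightarrow> ('i \<Rightarrow> 'k) set \<Rightarrow> (('i \<Rightarrow> 'k) \<Rightarrow> 'e) set" where
  "C_eta smul I \<eta> U =
     {f \<in> U \<rightarrow>\<^sub>E UNIV. \<forall>V\<in>cartesian_open_subsets I U. C_eta_cartesian smul I \<eta> V (restrict f V)}"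

definition C_eta_topology ::
    "('k::{field, topological_space} \<Rightarrow> 'e::{ab_group_add, topological_space} \<Rightarrow> 'e) \<Rightarrow> 'i set \<Rightarrow>
     ('i \<Rightarrow> nat) \<Rightarrow> ('i \<Rightarrow> 'k) set \<Rightarrow> (('i \<Rightarrow> 'k) \<Rightarrow> 'e) topology" where
  "C_eta_topology smul I \<eta> U =
     initial_topology (C_eta smul I \<eta> U)
       (lower_multi_indices I \<eta> \<times> cartesian_open_subsets I U)
       (\<lambda>(\<gamma>, V). compact_open_topology (mult_dom I V \<gamma>))
       (\<lambda>(\<gamma>, V) f. div_diff_ext smul I V (restrict f V) \<gamma>)"

text \<open>For \<open>N = N\<^sub>\<alpha>\<close> the following are the set \<open>C\<^sup>\<alpha>(U, E)\<close> and its topology.\<close>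

definition C_alpha ::
    "('k::{field, topological_space} \<Rightarrow> 'e::{ab_group_add, topological_space} \<Rightarrow> 'e) \<Rightarrow> 'i set \<Rightarrow>
     ('i \<Rightarrow> nat) set \<Rightarrow> ('i \<Rightarrow> 'k) set \<Rightarrow> (('i \<Rightarrow> 'k) \<Rightarrow> 'e) set" where
  "C_alpha smul I N U = {f \<in> U \<rightarrow>\<^sub>E UNIV. \<forall>\<eta>\<in>N. f \<in> C_eta smul I \<eta> U}"

definition C_alpha_topology ::
    "('k::{field, topological_space} \<Rightarrow> 'e::{ab_group_add, topological_space} \<Rightarrow> 'e) \<Rightarrow> 'i set \<Rightarrow>
     ('i \<Rightarrow> nat) set \<Rightarrow> ('i \<Rightarrow> 'k) set \<Rightarrow> (('i \<Rightarrow> 'k) \<Rightarrow> 'e) topology" where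
  "C_alpha_topology smul I N U =
     initial_topology (C_alpha smul I N U) N (\<lambda>\<eta>. C_eta_topology smul I \<eta> U) (\<lambda>\<eta> f. f)"

end

theory Submission
  imports Defs
begin

text \<open>
  At distinct nodes a divided difference depends only on the finite sets of nodes, one set per
  coordinate. Fix an open \<open>O\<close>-submodule \<open>M\<close> and an element \<open>p\<close> so small that divided differences of
  \<open>f\<close> change only by elements of \<open>M\<close> when nodes near a given compact set move by at most \<open>|p|\<close>. For
  one block of coordinates, replace \<open>f\<close> on each cell of radius \<open>|p|\<close> by its Newton interpolation of
  total degree at most \<open>m\<close>, with nodes chosen in that cell. If all nodes lie in one cell, exchanging
  nodes for centres, one at a time, shows that a divided difference of order \<open>k\<close> of the error lies in
  \<open>p\<^sup>m\<^sup>-\<^sup>k M\<close>: for \<open>k = m\<close> it is a difference of two divided differences of \<open>f\<close>, and each exchange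
  costs a factor of absolute value at most \<open>|p|\<close> and raises the order by one. Two nodes from different
  cells are more than \<open>|p|\<close> apart, so the recursion for divided differences carries the bound over to
  arbitrary nodes. In particular interpolation maps functions with small divided differences to such
  functions, hence the blocks can be treated one after the other with the same \<open>M\<close> and \<open>p\<close>.

  A locally cartesian set is cut into disjoint cartesian balls around a compact set, and the recursion
  is used once more to combine the balls.
\<close>


section \<open>Ultrametric fields as topological rings\<close>

text \<open>The bound concerns the total degree in each block, so interpolating coordinate by
  coordinate, which bounds partial degrees, has the wrong shape. The substitute is Newton's form
  truncated to indices of sum at most m. On nodes of one cell it has two properties: its divided
  differences of order m are divided differences of f at centres, and at initial segments of the
  centres it agrees with f in every order up to m. The first starts the exchange argument, the
  second stops it. Nodes in the other blocks are carried along as parameters, because the divided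
  differences to be controlled are mixed ones. All estimates are for distinct nodes. Coinciding
  nodes are reached only at the end, since open O-submodules are closed and tuples with distinct
  entries are dense. Combining balls loses powers of 1/p up to the total order m. The radius |p| of
  the balls is fixed before f is approximated on them, so the loss is compensated in advance by
  approximating modulo p^m M. Infinite entries of \<alpha> are harmless because a neighbourhood
  involves finitely many orders only.\<close>

lemma absval_zero [simp]: "absval (0::'k::ultrametric_field) = 0"
  using dist_absval[of 0 0] by (metis diff_self dist_self)

lemma absval_eq_dist: "absval x = dist x (0::'k::ultrametric_field)"
  by (simp add: dist_absval)

lemma absval_nonneg [simp]: "0 \<le> absval (x::'k::ultrametric_field)"
  by (simp only: absval_eq_dist zero_le_dist)

lemma absval_eq_0_iff [simp]: "absval x = 0 \<longleftrightarrow> x = (0::'k::ultrametric_field)"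
  by (simp only: absval_eq_dist dist_eq_0_iff)

lemma absval_pos_iff [simp]: "0 < absval x \<longleftrightarrow> x \<noteq> (0::'k::ultrametric_field)"
  by (simp add: order_less_le)

lemma absval_le_0_iff [simp]: "absval x \<le> 0 \<longleftrightarrow> x = (0::'k::ultrametric_field)"
  by (simp only: absval_eq_dist zero_less_dist_iff dist_le_zero_iff)

lemma absval_not_neg [simp]: "\<not> absval (x::'k::ultrametric_field) < 0"
  by (simp add: not_less)

lemma absval_one [simp]: "absval (1::'k::ultrametric_field) = 1"
  using absval_mult[of 1 "1::'k"] by simp

lemma absval_minus_commute: "absval (x - y) = absval (y - x :: 'k::ultrametric_field)"
  by (simp only: dist_absval[symmetric] dist_commute)

lemma absval_uminus [simp]: "absval (- x) = absval (x::'k::ultrametric_field)"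
  using absval_minus_commute[of 0 x] by simp

lemma absval_inverse: "absval (inverse x) = inverse (absval (x::'k::ultrametric_field))"
proof (cases "x = 0")
  case False
  then have "absval x * absval (inverse x) = 1"
    by (simp flip: absval_mult)
  then show ?thesis by (metis inverse_unique)
qed simp

lemma absval_divide: "absval (x / y) = absval x / absval (y::'k::ultrametric_field)"
  by (simp add: divide_inverse absval_mult absval_inverse)

lemma absval_power: "absval (x ^ k) = absval (x::'k::ultrametric_field) ^ k"
  by (induction k) (auto simp: absval_mult)

lemma absval_trans:
  "absval (x - y) \<le> r \<Longrightarrow> absval (y - z) \<le> r \<Longrightarrow> absval (x - z :: 'k::ultrametric_field) \<le> r"
  using absval_add[of "x - y" "y - z"] by simp

text \<open>If no q satisfied 0 < |q| < 1, open balls of radius 1 would be single points and every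
  set open, against \<open>not_discrete\<close>. Powers of one such q become arbitrarily
  small.\<close>

lemma absval_small:
  assumes "0 < \<epsilon>"
  obtains p :: "'k::ultrametric_field" where "p \<noteq> 0" "absval p \<le> \<epsilon>" "absval p \<le> 1"
proof -
  have "\<exists>q::'k. 0 < absval q \<and> absval q < 1"
  proof (rule ccontr)
    assume *: "\<not> ?thesis"
    have "open (S::'k set)" for S
      unfolding open_dist
    proof (intro ballI exI conjI allI impI)
      fix x y assume "x \<in> S" "dist y x < (1::real)"
      then have "y - x = 0" using * by (metis absval_pos_iff dist_absval)
      then show "y \<in> S" using \<open>x \<in> S\<close> by simp
    qed simp
    then show False using not_discrete by blast
  qed
  then obtain q :: 'k where q: "0 < absval q" "absval q < 1" by blast
  then obtain m where "absval q ^ m < \<epsilon>"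
    using real_arch_pow_inv assms by blast
  then show thesis
    using q by (intro that[of "q ^ m"]) (auto simp: absval_power power_le_one)
qed

instance ultrametric_field \<subseteq> topological_ab_group_add
proof
  fix a b :: 'a
  show "((\<lambda>x. fst x + snd x) \<longlongrightarrow> a + b) (nhds a \<times>\<^sub>F nhds b)"
  proof (rule tendstoI)
    fix e :: real assume e: "0 < e"
    have "\<forall>\<^sub>F x in nhds a \<times>\<^sub>F nhds b. dist (fst x) a < e \<and> dist (snd x) b < e"
      using e by (intro eventually_conj eventually_compose_filterlim[OF _ filterlim_fst]
          eventually_compose_filterlim[OF _ filterlim_snd]) (auto simp: eventually_nhds_metric)
    then show "\<forall>\<^sub>F x in nhds a \<times>\<^sub>F nhds b. dist (fst x + snd x) (a + b) < e"
    proof (rule eventually_mono)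
      fix x assume "dist (fst x) a < e \<and> dist (snd x) b < e"
      moreover have "dist (fst x + snd x) (a + b) \<le> max (dist (fst x) a) (dist (snd x) b)"
        using absval_add[of "fst x - a" "snd x - b"] by (simp add: dist_absval add_diff_add)
      ultimately show "dist (fst x + snd x) (a + b) < e" by linarith
    qed
  qed
  show "(uminus \<longlongrightarrow> - a) (nhds a)"
  proof (rule tendstoI)
    fix e :: real assume "0 < e"
    moreover have "dist (- x) (- a) = dist x a" for x
      using absval_minus_commute[of x a] by (simp add: dist_absval)
    ultimately show "\<forall>\<^sub>F x in nhds a. dist (- x) (- a) < e"
      by (auto simp: eventually_nhds_metric)
  qed
qed

instance ultrametric_field \<subseteq> topological_comm_monoid_mult
proof
  fix a b :: 'a
  show "((\<lambda>x. fst x * snd x) \<longlongrightarrow> a * b) (nhds a \<times>\<^sub>F nhds b)"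
  proof (rule tendstoI)
    fix e :: real assume e: "0 < e"
    \<comment> \<open>The bound 1 keeps the second factor y below |b| + 1; the quotients then
      control the two summands of x y - a b = (x - a) y + a (y - b). Adding 1 avoids division by
      zero.\<close>
    define d where "d = min 1 (min (e / (absval b + 1)) (e / (absval a + 1)))"
    have pos: "0 < absval b + 1" "0 < absval a + 1" by (auto intro: add_nonneg_pos)
    then have "0 < d" "d \<le> 1" "d \<le> e / (absval b + 1)" "d \<le> e / (absval a + 1)"
      using e by (auto simp: d_def)
    then have d: "0 < d" "d \<le> 1" "d * (absval b + 1) \<le> e" "d * (absval a + 1) \<le> e"
      using pos by (simp_all add: pos_le_divide_eq)
    have "\<forall>\<^sub>F x in nhds a \<times>\<^sub>F nhds b. dist (fst x) a < d \<and> dist (snd x) b < d"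
      using d by (intro eventually_conj eventually_compose_filterlim[OF _ filterlim_fst]
          eventually_compose_filterlim[OF _ filterlim_snd]) (auto simp: eventually_nhds_metric)
    then show "\<forall>\<^sub>F x in nhds a \<times>\<^sub>F nhds b. dist (fst x * snd x) (a * b) < e"
    proof (rule eventually_mono)
      fix x assume x: "dist (fst x) a < d \<and> dist (snd x) b < d"
      have "fst x * snd x - a * b = (fst x - a) * snd x + a * (snd x - b)"
        by (simp add: algebra_simps)
      then have *: "dist (fst x * snd x) (a * b) \<le>
          max (absval (fst x - a) * absval (snd x)) (absval a * absval (snd x - b))"
        by (metis dist_absval absval_add absval_mult)
      have "absval (snd x) \<le> max (absval (snd x - b)) (absval b)"
        using absval_add[of "snd x - b" b] by simp
      also have "\<dots> \<le> absval b + 1"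
        using x d absval_nonneg[of b] unfolding dist_absval by linarith
      finally have "absval (fst x - a) * absval (snd x) \<le> absval (fst x - a) * (absval b + 1)"
        by (intro mult_left_mono) auto
      also have "\<dots> < d * (absval b + 1)"
        using x pos by (intro mult_strict_right_mono) (auto simp: dist_absval)
      finally have 1: "absval (fst x - a) * absval (snd x) < e" using d by simp
      have "absval a * absval (snd x - b) \<le> absval a * d"
        using x by (intro mult_left_mono) (auto simp: dist_absval)
      also have "\<dots> < d * (absval a + 1)" using d by (simp add: algebra_simps)
      finally have 2: "absval a * absval (snd x - b) < e" using d by simp
      show "dist (fst x * snd x) (a * b) < e" using * 1 2 by simp
    qed
  qed
qed

lemma tendsto_inverse_ultrametric:
  fixes a :: "'k::ultrametric_field"
  assumes "a \<noteq> 0"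
  shows "(inverse \<longlongrightarrow> inverse a) (nhds a)"
proof (rule tendstoI)
  fix e :: real assume e: "0 < e"
  \<comment> \<open>The first bound forces |x| \<ge> |a| by the ultrametric inequality, so |1/x -
    1/a| is at most |x - a| / |a|^2, which the second bound makes small.\<close>
  define d where "d = min (absval a) (e * absval a * absval a)"
  have d: "0 < d" "d \<le> absval a" "d \<le> e * absval a * absval a" using e assms by (auto simp: d_def)
  have "\<forall>\<^sub>F x in nhds a. dist x a < d"
    using d(1) by (auto simp: eventually_nhds_metric)
  then show "\<forall>\<^sub>F x in nhds a. dist (inverse x) (inverse a) < e"
  proof (rule eventually_mono)
    fix x assume x: "dist x a < d"
    then have *: "absval (x - a) < absval a" using d by (simp add: dist_absval)
    have "absval a \<le> max (absval (a - x)) (absval x)"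
      using absval_add[of "a - x" x] by simp
    then have ge: "absval a \<le> absval x" using * by (simp add: absval_minus_commute max_def split: if_splits)
    then have x0: "x \<noteq> 0" using assms absval_pos_iff[of a] by (metis absval_zero not_le)
    have "inverse x - inverse a = (a - x) / (x * a)"
      using x0 assms by (simp add: field_simps)
    then have "dist (inverse x) (inverse a) = absval (x - a) / (absval x * absval a)"
      by (metis dist_absval absval_divide absval_mult absval_minus_commute)
    also have "\<dots> \<le> absval (x - a) / (absval a * absval a)"
      using ge x0 assms by (intro divide_left_mono mult_right_mono mult_pos_pos) auto
    also have "\<dots> < e"
      using x d assms by (simp add: dist_absval field_simps)
    finally show "dist (inverse x) (inverse a) < e" .
  qed
qed

lemma continuous_on_inverse_ultrametric:
  fixes f :: "'a::topological_space \<Rightarrow> 'k::ultrametric_field"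
  assumes "continuous_on S f" "\<And>x. x \<in> S \<Longrightarrow> f x \<noteq> 0"
  shows "continuous_on S (\<lambda>x. inverse (f x))"
  unfolding continuous_on_def
proof
  fix x assume "x \<in> S"
  then have "(f \<longlongrightarrow> f x) (at x within S)" using assms(1) by (auto simp: continuous_on_def)
  then show "((\<lambda>x. inverse (f x)) \<longlongrightarrow> inverse (f x)) (at x within S)"
    using filterlim_compose[OF tendsto_inverse_ultrametric] assms(2) \<open>x \<in> S\<close> by blast
qed

section \<open>Divided differences over finite sets of nodes\<close>

text \<open>The coefficient of \<open>p a\<close> in the divided difference of p with nodes A. The
  value 0 off A lets sums with different node sets be taken over a common larger set.\<close>

definition node_weight :: "'k::field set \<Rightarrow> 'k \<Rightarrow> 'k" where
  "node_weight A a = (if a \<in> A then \<Prod>t\<in>A - {a}. 1 / (a - t) else 0)"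

definition scalar_dd :: "('k::field \<Rightarrow> 'k) \<Rightarrow> 'k set \<Rightarrow> 'k" where
  "scalar_dd p A = (\<Sum>t\<in>A. node_weight A t * p t)"

text \<open>Tensor product of one-variable divided differences, of order
  \<open>card (X i) - 1\<close> in coordinate i. Sets build in the symmetry in the nodes and turn
  the recursion into deletion of points.\<close>

definition set_dd ::
    "('k::field \<Rightarrow> 'e::ab_group_add \<Rightarrow> 'e) \<Rightarrow> 'i set \<Rightarrow> (('i \<Rightarrow> 'k) \<Rightarrow> 'e) \<Rightarrow> ('i \<Rightarrow> 'k set) \<Rightarrow> 'e" where
  "set_dd smul I f X = (\<Sum>y\<in>PiE I X. smul (\<Prod>i\<in>I. node_weight (X i) (y i)) (f y))"

definition newton :: "(nat \<Rightarrow> 'k::comm_ring_1) \<Rightarrow> nat \<Rightarrow> 'k \<Rightarrow> 'k" where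
  "newton c k t = (\<Prod>l<k. t - c l)"

section \<open>Divided differences in one variable and Newton polynomials\<close>

lemma node_weight_remove:
  assumes "finite A" "y \<in> A" "b \<in> A" "y \<noteq> b"
  shows "node_weight A y = node_weight (A - {b}) y / (y - b)"
proof -
  have "(\<Prod>t\<in>A - {y}. 1 / (y - t)) = 1 / (y - b) * (\<Prod>t\<in>A - {y} - {b}. 1 / (y - t))"
    using assms by (intro prod.remove) auto
  moreover have "A - {y} - {b} = A - {b} - {y}" by auto
  ultimately show ?thesis using assms by (simp add: node_weight_def)
qed

lemma node_weight_singleton [simp]: "node_weight {a} a = 1"
  by (simp add: node_weight_def)

text \<open>The recursion for divided differences, coefficient by coefficient. At y = a or y = b one
  weight on the right is 0 by the default value.\<close>

lemma node_weight_diff: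
  assumes "finite A" "a \<in> A" "b \<in> A" "a \<noteq> b"
  shows "(a - b) * node_weight A y = node_weight (A - {b}) y - node_weight (A - {a}) y"
proof -
  consider "y = a" | "y = b" | "y \<noteq> a" "y \<noteq> b" "y \<in> A" | "y \<notin> A" by auto
  then show ?thesis
  proof cases
    case 1
    then show ?thesis using node_weight_remove[of A a b] assms
      by (simp add: node_weight_def)
  next
    case 2
    have "node_weight (A - {b}) b = 0" by (simp add: node_weight_def)
    moreover have "node_weight A b = node_weight (A - {a}) b / (b - a)"
      using node_weight_remove[of A b a] assms by simp
    ultimately show ?thesis using 2 assms(4) by (simp add: field_simps)
  next
    case 3
    have "node_weight (A - {b}) y = (y - b) * node_weight A y"
      using node_weight_remove[of A y b] assms 3 by simp
    moreover have "node_weight (A - {a}) y = (y - a) * node_weight A y"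
      using node_weight_remove[of A y a] assms 3 by simp
    ultimately show ?thesis by (simp add: algebra_simps)
  next
    case 4
    then show ?thesis by (simp add: node_weight_def)
  qed
qed

lemma scalar_dd_superset:
  assumes "finite B" "A \<subseteq> B"
  shows "scalar_dd p A = (\<Sum>t\<in>B. node_weight A t * p t)"
  unfolding scalar_dd_def using assms
  by (intro sum.mono_neutral_left) (auto simp: node_weight_def)

lemma scalar_dd_diff:
  assumes "finite A" "a \<in> A" "b \<in> A" "a \<noteq> b"
  shows "(a - b) * scalar_dd p A = scalar_dd p (A - {b}) - scalar_dd p (A - {a})"
proof -
  have "(a - b) * scalar_dd p A = (\<Sum>t\<in>A. ((a - b) * node_weight A t) * p t)"
    by (simp only: scalar_dd_def sum_distrib_left mult.assoc)
  also have "\<dots> = (\<Sum>t\<in>A. node_weight (A - {b}) t * p t) - (\<Sum>t\<in>A. node_weight (A - {a}) t * p t)"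
    by (simp only: node_weight_diff[OF assms]) (simp only: left_diff_distrib sum_subtractf)
  also have "\<dots> = scalar_dd p (A - {b}) - scalar_dd p (A - {a})"
    using assms(1) by (simp add: scalar_dd_superset[of A "A - {a}"] scalar_dd_superset[of A "A - {b}"] Diff_subset)
  finally show ?thesis .
qed

lemma scalar_dd_singleton [simp]: "scalar_dd p {a} = p a"
  by (simp add: scalar_dd_def)

text \<open>Write t - c = (a - c) + (t - a): multiplying the weight at t by t - a cancels the node
  a. This Leibniz rule for a linear factor drives the inductions for Newton polynomials and for
  powers.\<close>

lemma scalar_dd_mult_linear:
  assumes "finite A" "a \<in> A" "A \<noteq> {a}"
  shows "scalar_dd (\<lambda>t. (t - c) * p t) A = (a - c) * scalar_dd p A + scalar_dd p (A - {a})"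
proof -
  have "scalar_dd p (A - {a}) = (\<Sum>t\<in>A. node_weight (A - {a}) t * p t)"
    using assms(1) by (intro scalar_dd_superset) auto
  also have "\<dots> = (\<Sum>t\<in>A. (t - a) * node_weight A t * p t)"
  proof (intro sum.cong refl)
    fix t assume t: "t \<in> A"
    show "node_weight (A - {a}) t * p t = (t - a) * node_weight A t * p t"
      using node_weight_remove[of A t a] assms t by (cases "t = a") (auto simp: node_weight_def)
  qed
  finally show ?thesis
    by (simp add: scalar_dd_def sum_distrib_left algebra_simps flip: sum.distrib)
qed

lemma scalar_dd_const:
  assumes "finite A" "card A \<ge> 2"
  shows "scalar_dd (\<lambda>_. c) A = 0"
  using assms
proof (induction "card A" arbitrary: A rule: less_induct)
  case less
  obtain a b where ab: "a \<in> A" "b \<in> A" "a \<noteq> b"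
    using less.prems by (metis card_le_Suc0_iff_eq not_less_eq_eq numeral_2_eq_2)
  \<comment> \<open>With two nodes in A both sides are the value c; with more, both vanish by
    induction.\<close>
  have *: "scalar_dd (\<lambda>_. c) (A - {a}) = scalar_dd (\<lambda>_. c) (A - {b})"
  proof (cases "card A = 2")
    case True
    then have "card (A - {a}) = 1" "card (A - {b}) = 1" using ab less.prems by auto
    then show ?thesis by (auto simp: card_1_singleton_iff)
  next
    case False
    then have "card (A - {a}) \<ge> 2" "card (A - {b}) \<ge> 2" using ab less.prems by auto
    moreover have "card (A - {a}) < card A" "card (A - {b}) < card A"
      using ab less.prems(1) by (simp_all only: card_Diff1_less)
    ultimately show ?thesis using less.hyps less.prems(1) by simp
  qed
  then show ?case
    using scalar_dd_diff[OF less.prems(1) ab, of "\<lambda>_. c"] ab by simp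
qed

lemma newton_0 [simp]: "newton c 0 = (\<lambda>_. 1)"
  by (simp add: newton_def fun_eq_iff)

lemma newton_Suc: "newton c (Suc k) = (\<lambda>t. (t - c k) * newton c k t)"
  by (simp add: newton_def fun_eq_iff mult.commute)

text \<open>The Newton polynomial is monic of degree k; peeling off a linear factor by the Leibniz
  rule lowers order and degree together until a constant is left.\<close>

lemma scalar_dd_newton_top:
  assumes "finite A" "card A \<ge> Suc k"
  shows "scalar_dd (newton c k) A = (if card A = Suc k then 1 else 0)"
  using assms
proof (induction k arbitrary: A)
  case 0
  show ?case
  proof (cases "card A = 1")
    case True
    then show ?thesis by (auto simp: card_1_singleton_iff)
  qed (use 0 in \<open>auto simp: scalar_dd_const\<close>)
next
  case (Suc k)
  then obtain a where a: "a \<in> A" by fastforce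
  have "A \<noteq> {a}" using Suc.prems by auto
  moreover have "card (A - {a}) = card A - 1" using Suc.prems a by simp
  ultimately show ?case
    using Suc.IH[of A] Suc.IH[of "A - {a}"] Suc.prems a
    by (auto simp: newton_Suc scalar_dd_mult_linear)
qed

text \<open>Biorthogonality of Newton polynomials and initial segments of centres: for l < k all
  nodes are zeros of the polynomial, and for l \<ge> k its being monic of degree k decides.\<close>

lemma scalar_dd_newton_centres:
  assumes "inj c"
  shows "scalar_dd (newton c k) (c ` {..l}) = (if k = l then 1 else 0)"
proof (cases "l < k")
  case True
  have "newton c k t = 0" if "t \<in> c ` {..l}" for t
    using that True by (auto simp: newton_def intro!: bexI[of _ "_ :: nat"])
  then show ?thesis using True by (simp add: scalar_dd_def)
next
  case False
  have "card (c ` {..l}) = Suc l"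
    using assms by (subst card_image) (auto intro: inj_on_subset)
  then show ?thesis using False by (subst scalar_dd_newton_top) auto
qed

section \<open>Mixed divided differences\<close>

lemma set_dd_cong:
  assumes "\<And>i. i \<in> I \<Longrightarrow> X i = Y i" "\<And>x. x \<in> PiE I Y \<Longrightarrow> f x = g x"
  shows "set_dd smul I f X = set_dd smul I g Y"
proof -
  have "PiE I X = PiE I Y" using assms(1) by (rule PiE_cong)
  then show ?thesis
    unfolding set_dd_def using assms by (intro sum.cong arg_cong2[of _ _ _ _ smul] prod.cong) auto
qed

context vector_space
begin

lemma set_dd_superset:
  assumes "finite I" "\<And>i. i \<in> I \<Longrightarrow> finite (Z i)" "\<And>i. i \<in> I \<Longrightarrow> X i \<subseteq> Z i"
  shows "set_dd scale I f X = (\<Sum>y\<in>PiE I Z. scale (\<Prod>i\<in>I. node_weight (X i) (y i)) (f y))"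
  unfolding set_dd_def
proof (intro sum.mono_neutral_left ballI)
  show "finite (PiE I Z)" "PiE I X \<subseteq> PiE I Z"
    using assms by (auto intro!: finite_PiE PiE_mono)
  fix y assume "y \<in> PiE I Z - PiE I X"
  then obtain i where "i \<in> I" "y i \<notin> X i" by (auto simp: PiE_iff)
  then have "(\<Prod>i\<in>I. node_weight (X i) (y i)) = 0"
    using assms(1) by (intro prod_zero) (auto simp: node_weight_def)
  then show "scale (\<Prod>i\<in>I. node_weight (X i) (y i)) (f y) = 0" by simp
qed

lemma set_dd_diff:
  assumes "finite I" "\<And>i. i \<in> I \<Longrightarrow> finite (X i)" "i \<in> I" "a \<in> X i" "b \<in> X i" "a \<noteq> b"
  shows "scale (a - b) (set_dd scale I f X) =
    set_dd scale I f (X(i := X i - {b})) - set_dd scale I f (X(i := X i - {a}))"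
proof -
  define r where "r y = (\<Prod>j\<in>I - {i}. node_weight (X j) (y j))" for y
  have split: "set_dd scale I f (X(i := B)) =
      (\<Sum>y\<in>PiE I X. scale (node_weight B (y i) * r y) (f y))" if "B \<subseteq> X i" for B
  proof -
    have "set_dd scale I f (X(i := B)) =
      (\<Sum>y\<in>PiE I X. scale (\<Prod>j\<in>I. node_weight ((X(i := B)) j) (y j)) (f y))"
      using that assms by (intro set_dd_superset) auto
    also have "\<dots> = (\<Sum>y\<in>PiE I X. scale (node_weight B (y i) * r y) (f y))"
      using assms(1,3) by (intro sum.cong refl) (simp add: prod.remove[of I i] r_def)
    finally show ?thesis .
  qed
  have "scale (a - b) (set_dd scale I f X) =
      (\<Sum>y\<in>PiE I X. scale (((a - b) * node_weight (X i) (y i)) * r y) (f y))"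
    using split[of "X i"] by (simp add: scale_sum_right mult.assoc del: fun_upd_same)
  also have "\<dots> = set_dd scale I f (X(i := X i - {b})) - set_dd scale I f (X(i := X i - {a}))"
    unfolding split[OF Diff_subset] node_weight_diff[OF assms(2)[OF assms(3)] assms(4-6)]
    by (simp only: left_diff_distrib scale_left_diff_distrib sum_subtractf)
  finally show ?thesis .
qed

text \<open>The recursion for \<open>X i\<close> enlarged by c, with c deleted on one side and y on
  the other. Replacing a node thus costs y - c times a divided difference of one order
  higher.\<close>

lemma set_dd_exchange:
  assumes "finite I" "\<And>i. i \<in> I \<Longrightarrow> finite (X i)" "i \<in> I" "y \<in> X i" "c \<notin> X i"
  shows "set_dd scale I f X = set_dd scale I f (X(i := insert c (X i - {y}))) +
    scale (y - c) (set_dd scale I f (X(i := insert c (X i))))"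
proof -
  let ?Z = "X(i := insert c (X i))"
  have "scale (y - c) (set_dd scale I f ?Z) =
    set_dd scale I f (?Z(i := ?Z i - {c})) - set_dd scale I f (?Z(i := ?Z i - {y}))"
    using assms by (intro set_dd_diff) auto
  moreover have "?Z(i := ?Z i - {c}) = X" "?Z(i := ?Z i - {y}) = X(i := insert c (X i - {y}))"
    using assms by (auto simp: insert_Diff_if)
  ultimately show ?thesis by simp
qed

lemma set_dd_singletons: "set_dd scale I f (\<lambda>i. {x i}) = f (restrict x I)"
proof -
  have "PiE I (\<lambda>i. {x i}) = {restrict x I}"
    by (auto simp: PiE_iff extensional_def fun_eq_iff)
  then show ?thesis by (simp add: set_dd_def)
qed

lemma set_dd_add:
  "set_dd scale I (\<lambda>x. f x + g x) X = set_dd scale I f X + set_dd scale I g X"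
  by (simp add: set_dd_def scale_right_distrib sum.distrib)

lemma set_dd_minus:
  "set_dd scale I (\<lambda>x. f x - g x) X = set_dd scale I f X - set_dd scale I g X"
  by (simp add: set_dd_def scale_right_diff_distrib sum_subtractf)

lemma set_dd_sum:
  "set_dd scale I (\<lambda>x. \<Sum>s\<in>S. f s x) X = (\<Sum>s\<in>S. set_dd scale I (f s) X)"
  unfolding set_dd_def scale_sum_right by (rule sum.swap)

text \<open>Divided differences in different coordinates act independently. In J, f is read at the
  fixed nodes \<open>A i\<close>, so the operator hits the \<open>p i\<close>; outside J, f is read
  at x itself and receives the nodes \<open>X i\<close>.\<close>

lemma set_dd_tensor:
  assumes "finite I" "J \<subseteq> I" "\<And>i. i \<in> I \<Longrightarrow> finite (X i)" "\<And>i. i \<in> J \<Longrightarrow> finite (A i)"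
  shows "set_dd scale I
      (\<lambda>x. scale (\<Prod>i\<in>J. p i (x i)) (set_dd scale I f (\<lambda>i. if i \<in> J then A i else {x i}))) X =
    scale (\<Prod>i\<in>J. scalar_dd (p i) (X i)) (set_dd scale I f (\<lambda>i. if i \<in> J then A i else X i))"
proof -
  define Z where "Z i = (if i \<in> J then A i else X i)" for i
  \<comment> \<open>The kernel of the double sum in coordinate i: t is the outer node, s the node at
    which f is read. Outside J the weight of {t} at s is a Kronecker delta, which collapses the sum
    over t.\<close>
  define q where "q i t s = (if i \<in> J then node_weight (X i) t * p i t * node_weight (A i) s
    else node_weight (X i) t * node_weight {t} s)" for i t s
  have finZ: "finite (Z i)" if "i \<in> I" for i
    using assms that by (auto simp: Z_def)
  have prodJ: "(\<Prod>i\<in>I. if i \<in> J then g i else 1) = (\<Prod>i\<in>J. g i)" for g :: "'c \<Rightarrow> 'a"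
    using assms(1,2) by (subst prod.If_cases) (auto intro!: prod.cong simp: Int_absorb1)
  have "set_dd scale I
      (\<lambda>x. scale (\<Prod>i\<in>J. p i (x i)) (set_dd scale I f (\<lambda>i. if i \<in> J then A i else {x i}))) X =
    (\<Sum>x\<in>PiE I X. \<Sum>y\<in>PiE I Z. scale (\<Prod>i\<in>I. q i (x i) (y i)) (f y))"
    unfolding set_dd_def[of scale I _ X]
  proof (intro sum.cong refl)
    fix x assume x: "x \<in> PiE I X"
    have "set_dd scale I f (\<lambda>i. if i \<in> J then A i else {x i}) =
      (\<Sum>y\<in>PiE I Z. scale (\<Prod>i\<in>I. node_weight (if i \<in> J then A i else {x i}) (y i)) (f y))"
      using assms x finZ by (intro set_dd_superset) (auto simp: Z_def PiE_iff)
    moreover have "(\<Prod>i\<in>I. node_weight (X i) (x i)) * ((\<Prod>i\<in>J. p i (x i)) *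
        (\<Prod>i\<in>I. node_weight (if i \<in> J then A i else {x i}) (y i))) = (\<Prod>i\<in>I. q i (x i) (y i))" for y
      unfolding prodJ[symmetric] prod.distrib[symmetric] by (intro prod.cong) (auto simp: q_def)
    ultimately show "scale (\<Prod>i\<in>I. node_weight (X i) (x i)) (scale (\<Prod>i\<in>J. p i (x i))
        (set_dd scale I f (\<lambda>i. if i \<in> J then A i else {x i}))) =
      (\<Sum>y\<in>PiE I Z. scale (\<Prod>i\<in>I. q i (x i) (y i)) (f y))"
      by (simp add: scale_sum_right mult.assoc)
  qed
  also have "\<dots> = (\<Sum>y\<in>PiE I Z. scale (\<Prod>i\<in>I. \<Sum>t\<in>X i. q i t (y i)) (f y))"
    by (subst sum.swap) (use assms in \<open>simp add: prod_sum_PiE scale_sum_left\<close>)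
  also have "\<dots> = (\<Sum>y\<in>PiE I Z. scale ((\<Prod>i\<in>J. scalar_dd (p i) (X i)) *
      (\<Prod>i\<in>I. node_weight (Z i) (y i))) (f y))"
  proof (intro sum.cong refl arg_cong2[of _ _ _ _ scale])
    fix y assume y: "y \<in> PiE I Z"
    have "(\<Sum>t\<in>X i. q i t (y i)) =
      (if i \<in> J then scalar_dd (p i) (X i) else 1) * node_weight (Z i) (y i)" if i: "i \<in> I" for i
    proof (cases "i \<in> J")
      case True
      then show ?thesis by (simp add: q_def Z_def scalar_dd_def sum_distrib_right)
    next
      case False
      then have yi: "y i \<in> X i" using y i by (auto simp: Z_def PiE_iff)
      have "(\<Sum>t\<in>X i. q i t (y i)) = (\<Sum>t\<in>X i. if t = y i then node_weight (X i) (y i) else 0)"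
        using False by (intro sum.cong) (auto simp: q_def node_weight_def)
      then show ?thesis using False yi assms(3)[OF i] by (simp add: Z_def)
    qed
    then show "(\<Prod>i\<in>I. \<Sum>t\<in>X i. q i t (y i)) =
      (\<Prod>i\<in>J. scalar_dd (p i) (X i)) * (\<Prod>i\<in>I. node_weight (Z i) (y i))"
      by (simp add: prod.distrib flip: prodJ)
  qed
  also have "\<dots> = scale (\<Prod>i\<in>J. scalar_dd (p i) (X i)) (set_dd scale I f Z)"
    by (simp add: set_dd_def scale_sum_right)
  finally show ?thesis by (simp only: Z_def[abs_def])
qed

end

section \<open>Interpolation within one block of coordinates\<close>

definition node_degree :: "'i set \<Rightarrow> ('i \<Rightarrow> 'k set) \<Rightarrow> nat" where
  "node_degree J X = (\<Sum>i\<in>J. card (X i) - 1)"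

text \<open>Distance at most |p| is an equivalence relation, so \<open>clustered p A A\<close> puts
  A into one cell. The second argument serves to compare a node set with its replacement.\<close>

definition clustered :: "'k::ultrametric_field \<Rightarrow> 'k set \<Rightarrow> 'k set \<Rightarrow> bool" where
  "clustered p A B \<longleftrightarrow> (\<forall>a\<in>A. \<forall>b\<in>B. absval (a - b) \<le> absval p)"

text \<open>The last clause makes the sequence of centres depend on the cell only; this is what
  makes interpolants polynomial on cells.\<close>

definition centre_system ::
    "'k::ultrametric_field \<Rightarrow> 'i set \<Rightarrow> ('i \<Rightarrow> 'k set) \<Rightarrow> ('i \<Rightarrow> 'k \<Rightarrow> nat \<Rightarrow> 'k) \<Rightarrow> bool" where
  "centre_system p J G c \<longleftrightarrow>
     (\<forall>i\<in>J. \<forall>t\<in>G i. inj (c i t) \<and> (\<forall>l. c i t l \<in> G i \<and> absval (c i t l - t) \<le> absval p) \<and>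
        (\<forall>s\<in>G i. absval (s - t) \<le> absval p \<longrightarrow> c i s = c i t))"

text \<open>Newton interpolation in the coordinates J, the others being left free. The coefficient
  of index \<eta> uses the first \<eta> i + 1 centres of the cell of \<open>x i\<close>; as the
  centres follow x, the result is piecewise.\<close>

definition interpolate ::
    "('k::field \<Rightarrow> 'e::ab_group_add \<Rightarrow> 'e) \<Rightarrow> 'i set \<Rightarrow> 'i set \<Rightarrow> ('i \<Rightarrow> nat) set \<Rightarrow>
     ('i \<Rightarrow> 'k \<Rightarrow> nat \<Rightarrow> 'k) \<Rightarrow> (('i \<Rightarrow> 'k) \<Rightarrow> 'e) \<Rightarrow> ('i \<Rightarrow> 'k) \<Rightarrow> 'e" where
  "interpolate smul I J S c f x =
     (\<Sum>\<eta>\<in>S. smul (\<Prod>i\<in>J. newton (c i (x i)) (\<eta> i) (x i))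
        (set_dd smul I f (\<lambda>i. if i \<in> J then c i (x i) ` {..\<eta> i} else {x i})))"

definition simplex_idx :: "'i set \<Rightarrow> nat \<Rightarrow> ('i \<Rightarrow> nat) set" where
  "simplex_idx J m = {\<eta> \<in> J \<rightarrow>\<^sub>E UNIV. sum \<eta> J \<le> m}"

lemma centre_systemD:
  assumes "centre_system p J G c" "i \<in> J" "t \<in> G i"
  shows "inj (c i t)" "c i t l \<in> G i" "absval (c i t l - t) \<le> absval p"
    "s \<in> G i \<Longrightarrow> absval (s - t) \<le> absval p \<Longrightarrow> c i s = c i t"
  using assms unfolding centre_system_def by blast+

lemma finite_simplex_idx:
  assumes "finite J"
  shows "finite (simplex_idx J m)"
proof (rule finite_subset)
  show "simplex_idx J m \<subseteq> (\<Pi>\<^sub>E i\<in>J. {..m})"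
  proof
    fix \<eta> assume \<eta>: "\<eta> \<in> simplex_idx J m"
    have "\<eta> i \<le> m" if "i \<in> J" for i
      using \<eta> member_le_sum[OF that, of \<eta>] assms by (auto simp: simplex_idx_def)
    then show "\<eta> \<in> (\<Pi>\<^sub>E i\<in>J. {..m})" using \<eta> by (auto simp: simplex_idx_def PiE_iff)
  qed
qed (use assms in \<open>auto intro: finite_PiE\<close>)

lemma node_degree_remove:
  assumes "finite J" "i \<in> J" "finite (X i)" "b \<in> X i" "X i \<noteq> {b}"
  shows "node_degree J X = Suc (node_degree J (X(i := X i - {b})))"
proof -
  have "card (X i) \<ge> 2"
  proof -
    obtain t where "t \<in> X i" "t \<noteq> b" using assms(4,5) by blast
    then show ?thesis using card_mono[of "X i" "{t, b}"] assms(3,4) by simp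
  qed
  moreover have "(\<Sum>j\<in>J - {i}. card (X j) - 1) = (\<Sum>j\<in>J - {i}. card ((X(i := X i - {b})) j) - 1)"
    by (intro sum.cong) auto
  ultimately show ?thesis
    using assms by (simp add: node_degree_def sum.remove[of J i])
qed

lemma node_degree_cong: "(\<And>i. i \<in> J \<Longrightarrow> card (X i) = card (Y i)) \<Longrightarrow> node_degree J X = node_degree J Y"
  by (simp add: node_degree_def)

context vector_space
begin

text \<open>When all nodes in J share the centres \<open>ct\<close>, every summand is a product of
  the kind treated in \<open>set_dd_tensor\<close>, and the Newton factors absorb the nodes in
  J.\<close>

lemma set_dd_interpolate:
  assumes "finite I" "J \<subseteq> I" "\<And>i. i \<in> I \<Longrightarrow> finite (X i)"
    and c: "\<And>i t. i \<in> J \<Longrightarrow> t \<in> X i \<Longrightarrow> c i t = ct i"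
  shows "set_dd scale I (interpolate scale I J S c f) X =
    (\<Sum>\<eta>\<in>S. scale (\<Prod>i\<in>J. scalar_dd (newton (ct i) (\<eta> i)) (X i))
       (set_dd scale I f (\<lambda>i. if i \<in> J then ct i ` {..\<eta> i} else X i)))"
proof -
  let ?p = "\<lambda>x. \<Sum>\<eta>\<in>S. scale (\<Prod>i\<in>J. newton (ct i) (\<eta> i) (x i))
        (set_dd scale I f (\<lambda>i. if i \<in> J then ct i ` {..\<eta> i} else {x i}))"
  have "set_dd scale I (interpolate scale I J S c f) X = set_dd scale I ?p X"
  proof (intro set_dd_cong refl)
    fix x assume x: "x \<in> PiE I X"
    then have "c i (x i) = ct i" if "i \<in> J" for i
      using c that assms(2) by (auto simp: PiE_iff)
    then show "interpolate scale I J S c f x = ?p x"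
      unfolding interpolate_def
      by (intro sum.cong refl arg_cong2[of _ _ _ _ scale] prod.cong set_dd_cong) auto
  qed
  also have "\<dots> = (\<Sum>\<eta>\<in>S. scale (\<Prod>i\<in>J. scalar_dd (newton (ct i) (\<eta> i)) (X i))
       (set_dd scale I f (\<lambda>i. if i \<in> J then ct i ` {..\<eta> i} else X i)))"
    unfolding set_dd_sum using assms(1-3) by (intro sum.cong refl set_dd_tensor) auto
  finally show ?thesis .
qed

lemma interpolate_diff:
  "interpolate scale I J S c (\<lambda>x. f x - g x) =
    (\<lambda>x. interpolate scale I J S c f x - interpolate scale I J S c g x)"
  by (simp add: fun_eq_iff interpolate_def set_dd_minus scale_right_diff_distrib sum_subtractf)

text \<open>At total order m only the index \<eta> i = \<open>card (X i) - 1\<close> survives. Any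
  other index of the simplex has a component below the order in that coordinate, where the divided
  difference of the Newton polynomial is 0.\<close>

lemma set_dd_interpolate_top:
  assumes "finite I" "J \<subseteq> I" "\<And>i. i \<in> I \<Longrightarrow> finite (X i)" "\<And>i. i \<in> J \<Longrightarrow> X i \<noteq> {}"
    and c: "\<And>i t. i \<in> J \<Longrightarrow> t \<in> X i \<Longrightarrow> c i t = ct i"
    and deg: "node_degree J X = m"
  shows "set_dd scale I (interpolate scale I J (simplex_idx J m) c f) X =
    set_dd scale I f (\<lambda>i. if i \<in> J then ct i ` {..card (X i) - 1} else X i)"
proof -
  have finJ: "finite J" using assms(1,2) by (rule finite_subset[rotated])
  define \<gamma> where "\<gamma> = restrict (\<lambda>i. card (X i) - 1) J"
  have \<gamma>: "\<gamma> \<in> simplex_idx J m"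
    using deg by (auto simp: \<gamma>_def simplex_idx_def node_degree_def)
  have card: "card (X i) = Suc (\<gamma> i)" if "i \<in> J" for i
    using assms(2,3,4) that by (auto simp: \<gamma>_def Suc_diff_1 card_gt_0_iff subset_iff)
  have 1: "(\<Prod>i\<in>J. scalar_dd (newton (ct i) (\<gamma> i)) (X i)) = 1"
    using assms(2,3) card by (intro prod.neutral) (auto simp: scalar_dd_newton_top subset_iff)
  have 0: "(\<Prod>i\<in>J. scalar_dd (newton (ct i) (\<eta> i)) (X i)) = 0"
    if \<eta>: "\<eta> \<in> simplex_idx J m" "\<eta> \<noteq> \<gamma>" for \<eta>
  proof -
    \<comment> \<open>Otherwise \<gamma> \<le> \<eta> componentwise; as \<gamma> already has the
      maximal sum m, the two agree on J.\<close>
    have "\<exists>i\<in>J. \<eta> i < \<gamma> i"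
    proof (rule ccontr)
      assume "\<not> ?thesis"
      then have le: "\<And>i. i \<in> J \<Longrightarrow> \<gamma> i \<le> \<eta> i" by force
      have "sum \<gamma> J = m" using deg by (simp add: \<gamma>_def node_degree_def)
      then have "sum \<gamma> J = sum \<eta> J"
        using \<eta>(1) sum_mono[of J \<gamma> \<eta>, OF le] by (auto simp: simplex_idx_def)
      then have "\<gamma> i = \<eta> i" if "i \<in> J" for i
        using sum_mono_inv[of \<gamma> J \<eta> i] le that finJ by auto
      then have "\<eta> = \<gamma>"
        using \<eta>(1) \<gamma> by (intro PiE_ext[of _ J "\<lambda>_. UNIV"]) (auto simp: simplex_idx_def)
      then show False using \<eta> by simp
    qed
    then obtain i where i: "i \<in> J" "\<eta> i < \<gamma> i" by blast
    then have "scalar_dd (newton (ct i) (\<eta> i)) (X i) = 0"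
      using card[of i] assms(2,3) by (subst scalar_dd_newton_top) auto
    then show ?thesis using i finJ by (intro prod_zero) auto
  qed
  have "set_dd scale I (interpolate scale I J (simplex_idx J m) c f) X =
    (\<Sum>\<eta>\<in>simplex_idx J m. if \<eta> = \<gamma> then
      set_dd scale I f (\<lambda>i. if i \<in> J then ct i ` {..\<gamma> i} else X i) else 0)"
    by (subst set_dd_interpolate[where ct = ct]) (use assms 0 1 in \<open>auto intro!: sum.cong\<close>)
  also have "\<dots> = set_dd scale I f (\<lambda>i. if i \<in> J then ct i ` {..\<gamma> i} else X i)"
    using \<gamma> finite_simplex_idx[OF finJ] by simp
  also have "\<dots> = set_dd scale I f (\<lambda>i. if i \<in> J then ct i ` {..card (X i) - 1} else X i)"
    by (intro set_dd_cong) (auto simp: \<gamma>_def)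
  finally show ?thesis .
qed

text \<open>By biorthogonality only the matching index contributes, with factor 1. The order may be
  anything up to m: this is the case of error 0, in which the exchange of nodes stops.\<close>

lemma set_dd_interpolate_centres:
  assumes "finite I" "J \<subseteq> I" "\<And>i. i \<in> I \<Longrightarrow> finite (X i)" "\<And>i. i \<in> J \<Longrightarrow> X i \<noteq> {}"
    and c: "\<And>i t. i \<in> J \<Longrightarrow> t \<in> X i \<Longrightarrow> c i t = ct i"
    and inj: "\<And>i. i \<in> J \<Longrightarrow> inj (ct i :: nat \<Rightarrow> 'a)"
    and deg: "node_degree J X \<le> m"
    and X: "\<And>i. i \<in> J \<Longrightarrow> X i = ct i ` {..card (X i) - 1}"
  shows "set_dd scale I (interpolate scale I J (simplex_idx J m) c f) X = set_dd scale I f X"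
proof -
  have finJ: "finite J" using assms(1,2) by (rule finite_subset[rotated])
  define \<gamma> where "\<gamma> = restrict (\<lambda>i. card (X i) - 1) J"
  have \<gamma>: "\<gamma> \<in> simplex_idx J m"
    using deg by (auto simp: \<gamma>_def simplex_idx_def node_degree_def)
  have dd: "scalar_dd (newton (ct i) (\<eta> i)) (X i) = (if \<eta> i = \<gamma> i then 1 else 0)"
    if "i \<in> J" for i and \<eta> :: "'c \<Rightarrow> nat"
    using scalar_dd_newton_centres[OF inj[OF that], of "\<eta> i" "\<gamma> i"] X[OF that] that
    by (simp add: \<gamma>_def)
  have 1: "(\<Prod>i\<in>J. scalar_dd (newton (ct i) (\<eta> i)) (X i)) = (if \<eta> = \<gamma> then 1 else 0)"
    if \<eta>: "\<eta> \<in> simplex_idx J m" for \<eta>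
  proof (cases "\<eta> = \<gamma>")
    case False
    then obtain i where "i \<in> J" "\<eta> i \<noteq> \<gamma> i"
      using PiE_ext[of \<eta> J "\<lambda>_. UNIV" \<gamma>] \<eta> \<gamma> by (auto simp: simplex_idx_def)
    then show ?thesis using finJ dd[of i \<eta>] False by (auto intro!: prod_zero)
  qed (simp add: dd)
  have "set_dd scale I (interpolate scale I J (simplex_idx J m) c f) X =
    (\<Sum>\<eta>\<in>simplex_idx J m. if \<eta> = \<gamma> then
      set_dd scale I f (\<lambda>i. if i \<in> J then ct i ` {..\<gamma> i} else X i) else 0)"
    by (subst set_dd_interpolate[where ct = ct]) (use assms 1 in \<open>auto intro!: sum.cong\<close>)
  also have "\<dots> = set_dd scale I f (\<lambda>i. if i \<in> J then ct i ` {..\<gamma> i} else X i)"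
    using \<gamma> finite_simplex_idx[OF finJ] by simp
  also have "\<dots> = set_dd scale I f X"
    using X by (intro set_dd_cong) (auto simp: \<gamma>_def)
  finally show ?thesis .
qed

end

context ultrametric_lcs
begin

lemma submodule_zero: "O_submodule smul M \<Longrightarrow> 0 \<in> M"
  and submodule_add: "O_submodule smul M \<Longrightarrow> x \<in> M \<Longrightarrow> y \<in> M \<Longrightarrow> x + y \<in> M"
  and submodule_scale: "O_submodule smul M \<Longrightarrow> x \<in> M \<Longrightarrow> absval c \<le> 1 \<Longrightarrow> smul c x \<in> M"
  by (auto simp: O_submodule_def)

lemma submodule_uminus: "O_submodule smul M \<Longrightarrow> x \<in> M \<Longrightarrow> - x \<in> M"
  using submodule_scale[of M x "-1"] by simp

lemma submodule_diff: "O_submodule smul M \<Longrightarrow> x \<in> M \<Longrightarrow> y \<in> M \<Longrightarrow> x - y \<in> M"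
  using submodule_add[of M x "-y"] submodule_uminus[of M y] by simp

text \<open>
  Splitting off a node costs a factor \<open>1 / (a - b)\<close> with \<open>\<bar>a - b\<bar> > \<bar>p\<bar>\<close> and lowers the order by one; the
  weight \<open>inverse p ^ (m - order)\<close> balances the two.
\<close>

lemma cluster_reduction:
  assumes "finite I" "J \<subseteq> I" "O_submodule smul M" "p \<noteq> 0"
    and "\<And>i. i \<in> I \<Longrightarrow> finite (X i)" "\<And>i. i \<in> I \<Longrightarrow> X i \<noteq> {}" "node_degree J X \<le> m"
    and "\<And>Y. (\<And>i. i \<in> I \<Longrightarrow> Y i \<subseteq> X i) \<Longrightarrow> (\<And>i. i \<in> I \<Longrightarrow> Y i \<noteq> {}) \<Longrightarrow> (\<And>i. i \<notin> J \<Longrightarrow> Y i = X i) \<Longrightarrow>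
      (\<And>i. i \<in> J \<Longrightarrow> clustered p (Y i) (Y i)) \<Longrightarrow> node_degree J Y \<le> m \<Longrightarrow>
      smul (inverse p ^ (m - node_degree J Y)) (set_dd smul I h Y) \<in> M"
  shows "smul (inverse p ^ (m - node_degree J X)) (set_dd smul I h X) \<in> M"
  using assms(5-)
proof (induction "node_degree J X" arbitrary: X rule: less_induct)
  case less
  show ?case
  proof (cases "\<forall>i\<in>J. clustered p (X i) (X i)")
    case True
    then show ?thesis using less.prems by blast
  next
    case False
    then obtain i a b where i: "i \<in> J" "a \<in> X i" "b \<in> X i" and ab: "absval p < absval (a - b)"
      by (force simp: clustered_def)
    then have iI: "i \<in> I" and ne: "a \<noteq> b" using assms(2) absval_nonneg[of p] by auto
    have finJ: "finite J" using assms(1,2) by (rule finite_subset[rotated])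
    have step: "node_degree J X = Suc (node_degree J (X(i := X i - {t})))"
      "smul (inverse p ^ (m - node_degree J (X(i := X i - {t}))))
        (set_dd smul I h (X(i := X i - {t}))) \<in> M" if t: "t \<in> {a, b}" for t
    proof -
      show deg: "node_degree J X = Suc (node_degree J (X(i := X i - {t})))"
        using i ne t less.prems(1)[OF iI] finJ by (intro node_degree_remove) auto
      let ?X = "X(i := X i - {t})"
      show "smul (inverse p ^ (m - node_degree J ?X)) (set_dd smul I h ?X) \<in> M"
      proof (rule less.hyps)
        show "node_degree J ?X < node_degree J X" "node_degree J ?X \<le> m"
          using deg less.prems(3) by auto
        show "finite (?X j)" "?X j \<noteq> {}" if "j \<in> I" for j
          using less.prems(1,2)[OF that] t i ne by auto
        fix Y assume Y: "\<And>j. j \<in> I \<Longrightarrow> Y j \<subseteq> ?X j" "\<And>j. j \<in> I \<Longrightarrow> Y j \<noteq> {}" "\<And>j. j \<notin> J \<Longrightarrow> Y j = ?X j"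
          "\<And>j. j \<in> J \<Longrightarrow> clustered p (Y j) (Y j)" "node_degree J Y \<le> m"
        show "smul (inverse p ^ (m - node_degree J Y)) (set_dd smul I h Y) \<in> M"
        proof (rule less.prems(4))
          show "Y j \<subseteq> X j" if "j \<in> I" for j using Y(1)[OF that] by (auto split: if_splits)
          show "Y j = X j" if "j \<notin> J" for j using Y(3)[OF that] that i(1) by auto
        qed (use Y in auto)
      qed
    qed
    define k where "k = m - node_degree J X"
    have k: "m - node_degree J (X(i := X i - {t})) = Suc k" if "t \<in> {a, b}" for t
      using step(1)[OF that] less.prems(3) by (simp add: k_def)
    let ?D = "set_dd smul I h (X(i := X i - {b})) - set_dd smul I h (X(i := X i - {a}))"
    have D: "smul (inverse p ^ Suc k) ?D \<in> M"
      using step(2)[of a] step(2)[of b] k[of a] k[of b]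
      by (simp add: scale_right_diff_distrib submodule_diff[OF assms(3)])
    have D_eq: "smul (a - b) (set_dd smul I h X) = ?D"
      using i iI ne assms(1) less.prems(1) by (intro set_dd_diff) auto
    then have "smul (p * inverse (a - b)) (smul (inverse p ^ Suc k) ?D) =
        smul (p * inverse (a - b) * inverse p ^ Suc k * (a - b)) (set_dd smul I h X)"
      by (simp only: D_eq[symmetric] scale_scale mult.assoc)
    also have "p * inverse (a - b) * inverse p ^ Suc k * (a - b) = inverse p ^ k"
      using ne assms(4) by (simp add: field_simps)
    finally have "smul (inverse p ^ k) (set_dd smul I h X) =
      smul (p * inverse (a - b)) (smul (inverse p ^ Suc k) ?D)" ..
    moreover have "absval (p * inverse (a - b)) \<le> 1"
      using ab ne by (simp add: absval_mult absval_inverse absval_divide divide_simps)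
    ultimately show ?thesis
      unfolding k_def[symmetric] using submodule_scale[OF assms(3) D] by simp
  qed
qed

text \<open>Two nested inductions. The outer one descends from order m, where \<open>top\<close>
  compares f at families of equal sizes; the inner one counts the nodes outside the target centres.
  \<open>R\<close> holds the nodes outside J, which never move.\<close>

lemma interpolation_error_clustered:
  assumes I: "finite I" "J \<subseteq> I" and M: "O_submodule smul M" and p: "p \<noteq> 0" "absval p \<le> 1"
    and D: "\<And>i. i \<in> J \<Longrightarrow> clustered p (D i) (D i)"
      "\<And>i l. i \<in> J \<Longrightarrow> ct i l \<in> D i" "\<And>i. i \<in> J \<Longrightarrow> inj (ct i)" "\<And>i t. i \<in> J \<Longrightarrow> t \<in> D i \<Longrightarrow> c i t = ct i"
    and top: "\<And>Y Y'. (\<And>i. i \<in> J \<Longrightarrow> Y i \<subseteq> D i \<and> Y' i \<subseteq> D i \<and> finite (Y i) \<and> finite (Y' i) \<and>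
          Y i \<noteq> {} \<and> Y' i \<noteq> {} \<and> card (Y i) = card (Y' i)) \<Longrightarrow>
        (\<And>i. i \<notin> J \<Longrightarrow> Y i = R i \<and> Y' i = R i) \<Longrightarrow> node_degree J Y = m \<Longrightarrow>
        set_dd smul I f Y - set_dd smul I f Y' \<in> M"
    and Z: "\<And>i. i \<in> J \<Longrightarrow> Z i \<subseteq> D i" "\<And>i. i \<in> J \<Longrightarrow> Z i \<noteq> {}" "\<And>i. i \<in> I \<Longrightarrow> finite (Z i)"
      "\<And>i. i \<notin> J \<Longrightarrow> Z i = R i" "node_degree J Z \<le> m"
  shows "smul (inverse p ^ (m - node_degree J Z))
    (set_dd smul I (\<lambda>x. f x - interpolate smul I J (simplex_idx J m) c f x) Z) \<in> M"
proof -
  define h where "h x = f x - interpolate smul I J (simplex_idx J m) c f x" for x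
  \<comment> \<open>The target of the exchanges: as many initial centres as \<open>Z i\<close> has
    points.\<close>
  define C where "C Z i = ct i ` {..card (Z i :: 'k set) - 1}" for Z i
  have finJ: "finite J" using I by (rule finite_subset[rotated])
  have cardC: "card (C Z i) = card (Z i)" if "i \<in> J" "finite (Z i)" "Z i \<noteq> {}" for Z i
  proof -
    have "card (C Z i) = card {..card (Z i) - 1}"
      unfolding C_def using D(3)[OF that(1)] by (intro card_image) (auto intro: inj_on_subset)
    then show ?thesis using that by (simp add: card_gt_0_iff)
  qed
  have dd_h: "set_dd smul I h Z =
      set_dd smul I f Z - set_dd smul I (interpolate smul I J (simplex_idx J m) c f) Z" for Z
    unfolding h_def by (rule set_dd_minus)
  have "smul (inverse p ^ k) (set_dd smul I h Z) \<in> M" if "m - node_degree J Z = k" for k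
    using Z that
  proof (induction k arbitrary: Z)
    case 0
    have ctZ: "c i t = ct i" if "i \<in> J" "t \<in> Z i" for i t
      using that D(4) 0(1) by blast
    have "set_dd smul I h Z = set_dd smul I f Z -
        set_dd smul I f (\<lambda>i. if i \<in> J then ct i ` {..card (Z i) - 1} else Z i)"
      unfolding dd_h using I 0 ctZ by (subst set_dd_interpolate_top[where ct = ct]) auto
    moreover have "\<dots> \<in> M"
    proof (rule top)
      fix i assume i: "i \<in> J"
      let ?Y' = "\<lambda>i. if i \<in> J then ct i ` {..card (Z i) - 1} else Z i"
      show "Z i \<subseteq> D i \<and> ?Y' i \<subseteq> D i \<and> finite (Z i) \<and> finite (?Y' i) \<and>
          Z i \<noteq> {} \<and> ?Y' i \<noteq> {} \<and> card (Z i) = card (?Y' i)"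
        using i 0 I(2) D(2) cardC[OF i, of Z] by (auto simp: C_def)
    qed (use 0 in auto)
    ultimately show ?case by simp
  next
    case (Suc k)
    show ?case using Suc.prems
    proof (induction "\<Sum>i\<in>J. card (Z i - C Z i)" arbitrary: Z rule: less_induct)
      case less
      note Z = less.prems
      show ?case
      proof (cases "\<forall>i\<in>J. Z i = C Z i")
        case True
        moreover have ctZ: "c i t = ct i" if "i \<in> J" "t \<in> Z i" for i t
          using that D(4) Z(1) by blast
        ultimately have "set_dd smul I h Z = 0"
          unfolding dd_h using I Z D(3)
          by (subst set_dd_interpolate_centres[where ct = ct]) (auto simp: C_def)
        then show ?thesis using submodule_zero[OF M] by simp
      next
        case False
        then obtain i where i: "i \<in> J" "Z i \<noteq> C Z i" by blast
        then have iI: "i \<in> I" and fin: "finite (Z i)" using I Z by auto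
        have finC: "finite (C Z i)" by (simp add: C_def)
        have card: "card (C Z i) = card (Z i)" using cardC[of i Z, OF i(1) fin Z(2)[OF i(1)]] .
        \<comment> \<open>\<open>Z i\<close> and \<open>C Z i\<close> are different finite sets of
          equal size, so each has a point missing from the other.\<close>
        then obtain y where y: "y \<in> Z i" "y \<notin> C Z i"
          using card_subset_eq[OF finC, of "Z i"] i by auto
        obtain t where t: "t \<in> C Z i" "t \<notin> Z i"
          using card_subset_eq[OF fin, of "C Z i"] i card by auto
        let ?Y = "Z(i := insert t (Z i - {y}))" and ?X = "Z(i := insert t (Z i))"
        have tD: "t \<in> D i" using t D(2) i by (auto simp: C_def)
        have cardY: "card (?Y j) = card (Z j)" for j
          using card_Suc_Diff1[OF fin y(1)] y t fin by auto
        \<comment> \<open>The exchange keeps all cardinalities; hence the targets do not move and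
          the inner measure really drops.\<close>
        then have degY: "node_degree J ?Y = node_degree J Z" and CY: "C ?Y = C Z"
          by (auto intro: node_degree_cong simp: C_def fun_eq_iff)
        have Y: "smul (inverse p ^ Suc k) (set_dd smul I h ?Y) \<in> M"
        proof (rule less.hyps)
          have "(\<Sum>j\<in>J. card (?Y j - C Z j)) < (\<Sum>j\<in>J. card (Z j - C Z j))"
          proof (rule sum_strict_mono_ex1[OF finJ])
            show "\<forall>j\<in>J. card (?Y j - C Z j) \<le> card (Z j - C Z j)"
              using I Z(3) t by (auto intro!: card_mono)
            have "?Y i - C Z i \<subset> Z i - C Z i" using y t by auto
            then show "\<exists>j\<in>J. card (?Y j - C Z j) < card (Z j - C Z j)"
              using fin i by (auto intro!: bexI[of _ i] psubset_card_mono)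
          qed
          then show "(\<Sum>j\<in>J. card (?Y j - C ?Y j)) < (\<Sum>j\<in>J. card (Z j - C Z j))"
            by (simp only: CY)
          show "?Y j \<subseteq> D j" "?Y j \<noteq> {}" if "j \<in> J" for j using Z(1,2)[OF that] tD by auto
          show "finite (?Y j)" if "j \<in> I" for j using Z(3)[OF that] fin by auto
          show "?Y j = R j" if "j \<notin> J" for j using Z(4)[OF that] that i(1) by auto
          show "node_degree J ?Y \<le> m" "m - node_degree J ?Y = Suc k" unfolding degY by (fact Z)+
        qed
        have degX: "node_degree J ?X = Suc (node_degree J Z)"
          using node_degree_remove[OF finJ i(1), of ?X t] fin t y by auto
        have X: "smul (inverse p ^ k) (set_dd smul I h ?X) \<in> M"
        proof (rule Suc.IH)
          show "?X j \<subseteq> D j" "?X j \<noteq> {}" if "j \<in> J" for j using Z(1,2)[OF that] tD by auto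
          show "finite (?X j)" if "j \<in> I" for j using Z(3)[OF that] fin by auto
          show "?X j = R j" if "j \<notin> J" for j using Z(4)[OF that] that i(1) by auto
          show "node_degree J ?X \<le> m" "m - node_degree J ?X = k"
            unfolding degX using Z(5,6) by linarith+
        qed
        \<comment> \<open>The first summand has fewer nodes left to exchange, the second is of one
          order more. As |y - t| \<le> |p|, the factor \<open>inverse p * (y - t)\<close> is in O;
          it uses up the power of \<open>inverse p\<close> by which the weights differ.\<close>
        have "set_dd smul I h Z = set_dd smul I h ?Y + smul (y - t) (set_dd smul I h ?X)"
          using I(1) Z(3) iI y(1) t(2) by (rule set_dd_exchange)
        then have "smul (inverse p ^ Suc k) (set_dd smul I h Z) =
            smul (inverse p ^ Suc k) (set_dd smul I h ?Y) +
            smul (inverse p * (y - t)) (smul (inverse p ^ k) (set_dd smul I h ?X))"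
          by (simp add: scale_right_distrib mult_ac)
        moreover have "absval (inverse p * (y - t)) \<le> 1"
          using D(1)[OF i(1)] Z(1)[OF i(1)] y tD p
          by (auto simp: clustered_def absval_mult absval_inverse absval_divide divide_simps)
        ultimately show ?thesis
          using submodule_add[OF M Y submodule_scale[OF M X]] by simp
      qed
    qed
  qed
  then show ?thesis by (simp add: h_def[abs_def])
qed

text \<open>\<open>cluster_reduction\<close> leaves families with one cell per coordinate, and the
  previous lemma applies in the cell around any chosen node. Multiplying by a power of p, an element
  of O, finally removes the weight.\<close>

lemma interpolation_error:
  assumes I: "finite I" "J \<subseteq> I" and M: "O_submodule smul M" and p: "p \<noteq> 0" "absval p \<le> 1"
    and c: "centre_system p J G c"
    and X: "\<And>i. i \<in> I \<Longrightarrow> finite (X i)" "\<And>i. i \<in> I \<Longrightarrow> X i \<noteq> {}" "\<And>i. i \<in> J \<Longrightarrow> X i \<subseteq> G i"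
      "node_degree J X \<le> m"
    and top: "\<And>Y Y'. (\<And>i. i \<in> J \<Longrightarrow> Y i \<subseteq> G i \<and> Y' i \<subseteq> G i \<and> finite (Y i) \<and> finite (Y' i) \<and>
          Y i \<noteq> {} \<and> Y' i \<noteq> {} \<and> card (Y i) = card (Y' i) \<and> clustered p (Y i) (Y' i)) \<Longrightarrow>
        (\<And>i. i \<notin> J \<Longrightarrow> Y i = X i \<and> Y' i = X i) \<Longrightarrow> node_degree J Y = m \<Longrightarrow>
        set_dd smul I f Y - set_dd smul I f Y' \<in> M"
  shows "set_dd smul I (\<lambda>x. f x - interpolate smul I J (simplex_idx J m) c f x) X \<in> M"
proof -
  let ?h = "\<lambda>x. f x - interpolate smul I J (simplex_idx J m) c f x"
  have "smul (inverse p ^ (m - node_degree J X)) (set_dd smul I ?h X) \<in> M"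
  proof (rule cluster_reduction[OF I M p(1)])
    fix Z assume Z: "\<And>i. i \<in> I \<Longrightarrow> Z i \<subseteq> X i" "\<And>i. i \<in> I \<Longrightarrow> Z i \<noteq> {}" "\<And>i. i \<notin> J \<Longrightarrow> Z i = X i"
      "\<And>i. i \<in> J \<Longrightarrow> clustered p (Z i) (Z i)" "node_degree J Z \<le> m"
    have "\<forall>i\<in>J. \<exists>t. t \<in> Z i" using Z(2) I(2) by blast
    then obtain t where t: "\<And>i. i \<in> J \<Longrightarrow> t i \<in> Z i"
      unfolding bchoice_iff by blast
    have tG: "t i \<in> G i" if "i \<in> J" for i
      using t[OF that] Z(1)[of i] X(3)[OF that] I(2) that by auto
    define D where "D i = {s \<in> G i. absval (s - t i) \<le> absval p}" for i
    have clD: "clustered p (D i) (D i)" for i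
      unfolding clustered_def
    proof (intro ballI)
      fix a b assume "a \<in> D i" "b \<in> D i"
      then show "absval (a - b) \<le> absval p"
        using absval_trans[of a "t i" "absval p" b] absval_minus_commute[of b "t i"]
        by (simp add: D_def)
    qed
    show "smul (inverse p ^ (m - node_degree J Z)) (set_dd smul I ?h Z) \<in> M"
    proof (rule interpolation_error_clustered[where ct = "\<lambda>i. c i (t i)" and R = X and D = D, OF I M p])
      fix i assume i: "i \<in> J"
      show "clustered p (D i) (D i)" by (rule clD)
      show "c i (t i) l \<in> D i" for l using centre_systemD(2,3)[OF c i tG[OF i]] by (simp add: D_def)
      show "inj (c i (t i))" using centre_systemD(1)[OF c i tG[OF i]] .
      show "c i s = c i (t i)" if "s \<in> D i" for s
        by (rule centre_systemD(4)[OF c i tG[OF i]]) (use that in \<open>auto simp: D_def\<close>)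
      show "Z i \<subseteq> D i"
        using subset_trans[OF Z(1) X(3)] Z(4)[OF i] t[OF i] I(2) i
        unfolding D_def clustered_def by blast
      show "Z i \<noteq> {}" using Z(2) I(2) i by auto
    next
      fix Y Y'
      assume *: "\<And>i. i \<in> J \<Longrightarrow> Y i \<subseteq> D i \<and> Y' i \<subseteq> D i \<and> finite (Y i) \<and> finite (Y' i) \<and>
          Y i \<noteq> {} \<and> Y' i \<noteq> {} \<and> card (Y i) = card (Y' i)"
        "\<And>i. i \<notin> J \<Longrightarrow> Y i = X i \<and> Y' i = X i" "node_degree J Y = m"
      show "set_dd smul I f Y - set_dd smul I f Y' \<in> M"
      proof (rule top)
        fix i assume i: "i \<in> J"
        have "clustered p (Y i) (Y' i)"
          using *(1)[OF i] clD[of i] by (auto simp: clustered_def)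
        then show "Y i \<subseteq> G i \<and> Y' i \<subseteq> G i \<and> finite (Y i) \<and> finite (Y' i) \<and>
          Y i \<noteq> {} \<and> Y' i \<noteq> {} \<and> card (Y i) = card (Y' i) \<and> clustered p (Y i) (Y' i)"
          using *(1)[OF i] by (auto simp: D_def)
      qed (use * in auto)
    next
      show "finite (Z i)" if "i \<in> I" for i
        using Z(1)[OF that] X(1)[OF that] by (rule finite_subset)
    qed (use Z in auto)
  qed (use X in auto)
  then have "smul (p ^ (m - node_degree J X))
      (smul (inverse p ^ (m - node_degree J X)) (set_dd smul I ?h X)) \<in> M"
    by (rule submodule_scale[OF M]) (use p in \<open>simp add: absval_power power_le_one\<close>)
  then show ?thesis using p(1) by (simp flip: power_mult_distrib)
qed

end

section \<open>Interpolation in all blocks\<close>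

text \<open>Pairs from S and S' encoded as single functions on the union, so that a composition of
  two interpolations has an index set of the same kind.\<close>

definition merge_indices ::
    "'i set \<Rightarrow> 'i set \<Rightarrow> ('i \<Rightarrow> nat) set \<Rightarrow> ('i \<Rightarrow> nat) set \<Rightarrow> ('i \<Rightarrow> nat) set" where
  "merge_indices J L S S' = {\<eta> \<in> J \<union> L \<rightarrow>\<^sub>E UNIV. restrict \<eta> J \<in> S \<and> restrict \<eta> L \<in> S'}"

lemma sum_merge_indices:
  assumes "J \<inter> L = {}" "S \<subseteq> J \<rightarrow>\<^sub>E UNIV" "S' \<subseteq> L \<rightarrow>\<^sub>E UNIV"
  shows "(\<Sum>\<eta>\<in>S. \<Sum>\<eta>'\<in>S'. g \<eta> \<eta>') = (\<Sum>\<zeta>\<in>merge_indices J L S S'. g (restrict \<zeta> J) (restrict \<zeta> L))"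
proof -
  define m where "m p i = (if i \<in> J then fst p i else snd p i)" for p :: "('a \<Rightarrow> nat) \<times> ('a \<Rightarrow> nat)" and i
  have r: "restrict (m (\<eta>, \<eta>')) J = \<eta>" "restrict (m (\<eta>, \<eta>')) L = \<eta>'" "m (\<eta>, \<eta>') \<in> J \<union> L \<rightarrow>\<^sub>E UNIV"
    if "\<eta> \<in> S" "\<eta>' \<in> S'" for \<eta> \<eta>'
  proof -
    have "\<eta> i = undefined" if "i \<notin> J" for i using \<open>\<eta> \<in> S\<close> assms(2) that by (auto simp: PiE_def extensional_def)
    moreover have "\<eta>' i = undefined" if "i \<notin> L" for i using \<open>\<eta>' \<in> S'\<close> assms(3) that by (auto simp: PiE_def extensional_def)
    ultimately show "restrict (m (\<eta>, \<eta>')) J = \<eta>" "restrict (m (\<eta>, \<eta>')) L = \<eta>'"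
        "m (\<eta>, \<eta>') \<in> J \<union> L \<rightarrow>\<^sub>E UNIV"
      using assms(1) by (auto simp: m_def fun_eq_iff PiE_def extensional_def)
  qed
  have m: "m (restrict \<zeta> J, restrict \<zeta> L) = \<zeta>" if "\<zeta> \<in> J \<union> L \<rightarrow>\<^sub>E UNIV" for \<zeta> :: "'a \<Rightarrow> nat"
    using that by (auto simp: m_def fun_eq_iff PiE_def extensional_def)
  have outside: "x \<in> J" if "\<eta> \<in> S" "\<eta>' \<in> S'" "m (\<eta>, \<eta>') x \<noteq> undefined" "x \<notin> L" for \<eta> \<eta>' x
    using r(3)[OF that(1,2)] that(3,4) by (auto simp: PiE_def extensional_def)
  show ?thesis
    unfolding sum.cartesian_product
    by (rule sum.reindex_bij_witness[where i = "\<lambda>\<zeta>. (restrict \<zeta> J, restrict \<zeta> L)" and j = m])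
      (auto simp: merge_indices_def r m intro: outside)
qed

text \<open>The families for which f is controlled. Unlike clustered ones, they may spread over many
  cells.\<close>

definition good_nodes ::
    "'i set \<Rightarrow> nat \<Rightarrow> (nat \<Rightarrow> 'i set) \<Rightarrow> (nat \<Rightarrow> nat) \<Rightarrow> ('i \<Rightarrow> 'k set) \<Rightarrow> ('i \<Rightarrow> 'k set) \<Rightarrow> bool" where
  "good_nodes I l J \<beta> G X \<longleftrightarrow>
     (\<forall>i\<in>I. finite (X i) \<and> X i \<noteq> {} \<and> X i \<subseteq> G i) \<and> (\<forall>j<l. node_degree (J j) X \<le> \<beta> j)"

text \<open>N_\<alpha> for finite bounds and abstract blocks. Over finite blocks it is a finite set,
  which allows one radius for all orders.\<close>

definition block_le :: "(nat \<Rightarrow> 'i set) \<Rightarrow> (nat \<Rightarrow> nat) \<Rightarrow> nat \<Rightarrow> ('i \<Rightarrow> nat) set" where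
  "block_le J \<beta> l = {\<eta> \<in> (\<Union>j<l. J j) \<rightarrow>\<^sub>E UNIV. \<forall>j<l. sum \<eta> (J j) \<le> \<beta> j}"

lemma block_le_Suc:
  assumes "\<And>j. j < l \<Longrightarrow> J j \<inter> J l = {}"
  shows "block_le J \<beta> (Suc l) =
    merge_indices (J l) (\<Union>j<l. J j) (simplex_idx (J l) (\<beta> l)) (block_le J \<beta> l)"
proof -
  have 1: "sum (restrict \<eta> (J l)) (J l) = sum \<eta> (J l)" for \<eta> :: "'a \<Rightarrow> nat"
    by (intro sum.cong) auto
  have 2: "sum (restrict \<eta> (\<Union>j<l. J j)) (J j) = sum \<eta> (J j)" if "j < l" for j and \<eta> :: "'a \<Rightarrow> nat"
    using that by (intro sum.cong) auto
  show ?thesis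
    by (auto simp: block_le_def merge_indices_def simplex_idx_def 1 2 less_Suc_eq
        lessThan_Suc simp del: restrict_apply restrict_apply')
qed

lemma newton_expansion: "\<exists>q. \<forall>t. newton c k t = (\<Sum>a\<le>k. q a * t ^ a)"
proof (induction k)
  case 0
  then show ?case by (auto intro!: exI[of _ "\<lambda>_. 1"])
next
  case (Suc k)
  then obtain q where q: "\<And>t. newton c k t = (\<Sum>a\<le>k. q a * t ^ a)" by blast
  \<comment> \<open>Coefficients of (t - c k) times the previous polynomial: the shifted ones minus
    c k times the old ones.\<close>
  define q' where "q' a = (case a of 0 \<Rightarrow> 0 | Suc b \<Rightarrow> q b) - (if a \<le> k then c k * q a else 0)" for a
  have "newton c (Suc k) t = (\<Sum>a\<le>Suc k. q' a * t ^ a)" for t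
  proof -
    have "(\<Sum>a\<le>Suc k. (case a of 0 \<Rightarrow> 0 | Suc b \<Rightarrow> q b) * t ^ a) = t * (\<Sum>a\<le>k. q a * t ^ a)"
      by (subst sum.atMost_Suc_shift) (simp add: sum_distrib_left mult_ac)
    moreover have "(\<Sum>a\<le>Suc k. (if a \<le> k then c k * q a else 0) * t ^ a) = c k * (\<Sum>a\<le>k. q a * t ^ a)"
      by (simp add: sum_distrib_left mult_ac)
    ultimately show ?thesis
      by (simp only: newton_Suc q q'_def left_diff_distrib sum_subtractf)
  qed
  then show ?case by blast
qed

context vector_space
begin

text \<open>The outer interpolation reads the inner one only at families with single points in L.
  There the centres trivially agree, so \<open>set_dd_interpolate\<close> computes the inner divided
  differences, with the Newton factors evaluated at x.\<close>

lemma interpolate_interpolate: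
  assumes "finite I" "J \<subseteq> I" "L \<subseteq> I" "J \<inter> L = {}" "S \<subseteq> J \<rightarrow>\<^sub>E UNIV" "S' \<subseteq> L \<rightarrow>\<^sub>E UNIV"
  shows "interpolate scale I J S c (interpolate scale I L S' c f) =
    interpolate scale I (J \<union> L) (merge_indices J L S S') c f"
proof
  fix x
  have fin: "finite J" "finite L" using assms by (auto intro: finite_subset)
  define A where "A \<eta> \<eta>' i = (if i \<in> J then c i (x i) ` {..\<eta> i} else
      if i \<in> L then c i (x i) ` {..\<eta>' i} else {x i})" for \<eta> \<eta>' i
  have "interpolate scale I J S c (interpolate scale I L S' c f) x =
    (\<Sum>\<eta>\<in>S. \<Sum>\<eta>'\<in>S'. scale ((\<Prod>i\<in>J. newton (c i (x i)) (\<eta> i) (x i)) *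
      (\<Prod>i\<in>L. newton (c i (x i)) (\<eta>' i) (x i))) (set_dd scale I f (A \<eta> \<eta>')))"
    unfolding interpolate_def[of scale I J]
  proof (intro sum.cong refl)
    fix \<eta>
    let ?X = "\<lambda>i. if i \<in> J then c i (x i) ` {..\<eta> i} else {x i}"
    have "set_dd scale I (interpolate scale I L S' c f) ?X =
      (\<Sum>\<eta>'\<in>S'. scale (\<Prod>i\<in>L. scalar_dd (newton (c i (x i)) (\<eta>' i)) (?X i))
       (set_dd scale I f (\<lambda>i. if i \<in> L then c i (x i) ` {..\<eta>' i} else ?X i)))"
      using assms by (intro set_dd_interpolate) (auto split: if_splits)
    also have "\<dots> = (\<Sum>\<eta>'\<in>S'. scale (\<Prod>i\<in>L. newton (c i (x i)) (\<eta>' i) (x i))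
       (set_dd scale I f (A \<eta> \<eta>')))"
      using assms(4) by (intro sum.cong refl arg_cong2[of _ _ _ _ scale] prod.cong set_dd_cong)
        (auto simp: A_def)
    finally show "scale (\<Prod>i\<in>J. newton (c i (x i)) (\<eta> i) (x i))
        (set_dd scale I (interpolate scale I L S' c f) ?X) =
      (\<Sum>\<eta>'\<in>S'. scale ((\<Prod>i\<in>J. newton (c i (x i)) (\<eta> i) (x i)) *
        (\<Prod>i\<in>L. newton (c i (x i)) (\<eta>' i) (x i))) (set_dd scale I f (A \<eta> \<eta>')))"
      by (simp add: scale_sum_right)
  qed
  also have "\<dots> = (\<Sum>\<zeta>\<in>merge_indices J L S S'.
      scale ((\<Prod>i\<in>J. newton (c i (x i)) (restrict \<zeta> J i) (x i)) *
        (\<Prod>i\<in>L. newton (c i (x i)) (restrict \<zeta> L i) (x i)))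
       (set_dd scale I f (A (restrict \<zeta> J) (restrict \<zeta> L))))"
    by (rule sum_merge_indices[OF assms(4-6)])
  also have "\<dots> = interpolate scale I (J \<union> L) (merge_indices J L S S') c f x"
    unfolding interpolate_def
  proof (intro sum.cong refl arg_cong2[of _ _ _ _ scale] set_dd_cong)
    fix \<zeta> i
    show "(\<Prod>i\<in>J. newton (c i (x i)) (restrict \<zeta> J i) (x i)) *
        (\<Prod>i\<in>L. newton (c i (x i)) (restrict \<zeta> L i) (x i)) =
      (\<Prod>i\<in>J \<union> L. newton (c i (x i)) (\<zeta> i) (x i))"
      using fin assms(4) by (simp add: prod.union_disjoint)
    show "A (restrict \<zeta> J) (restrict \<zeta> L) i = (if i \<in> J \<union> L then c i (x i) ` {..\<zeta> i} else {x i})"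
      by (auto simp: A_def)
  qed
  finally show "interpolate scale I J S c (interpolate scale I L S' c f) x =
    interpolate scale I (J \<union> L) (merge_indices J L S S') c f x" .
qed

lemma interpolate_empty:
  "interpolate scale I {} {\<lambda>_. undefined} c f x = f (restrict x I)"
  by (simp add: interpolate_def set_dd_singletons)

text \<open>\<open>polynomial_on\<close> sums over nonvanishing coefficients only; here coefficients
  that happen to be 0 are allowed.\<close>

lemma polynomial_on_sum:
  assumes "finite F" "F \<subseteq> N" "\<And>x. x \<in> V \<Longrightarrow> p x = (\<Sum>\<eta>\<in>F. scale (\<Prod>i\<in>I. x i ^ \<eta> i) (b \<eta>))"
  shows "polynomial_on scale I N V p"
  unfolding polynomial_on_def
proof (intro exI[of _ "\<lambda>\<eta>. if \<eta> \<in> F then b \<eta> else 0"] conjI ballI)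
  let ?a = "\<lambda>\<eta>. if \<eta> \<in> F then b \<eta> else 0"
  have eq: "{\<eta> \<in> N. ?a \<eta> \<noteq> 0} = {\<eta> \<in> F. b \<eta> \<noteq> 0}" using assms(2) by auto
  then show "finite {\<eta> \<in> N. ?a \<eta> \<noteq> 0}" using assms(1) by simp
  fix x assume "x \<in> V"
  have "(\<Sum>\<eta>\<in>F. scale (\<Prod>i\<in>I. x i ^ \<eta> i) (b \<eta>)) =
    (\<Sum>\<eta> | \<eta> \<in> N \<and> ?a \<eta> \<noteq> 0. scale (\<Prod>i\<in>I. x i ^ \<eta> i) (?a \<eta>))"
    unfolding eq using assms(1) by (intro sum.mono_neutral_cong_right) auto
  then show "p x = (\<Sum>\<eta> | \<eta> \<in> N \<and> ?a \<eta> \<noteq> 0. scale (\<Prod>i\<in>I. x i ^ \<eta> i) (?a \<eta>))"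
    using assms(3)[OF \<open>x \<in> V\<close>] by simp
qed

text \<open>Every Newton factor is expanded into powers. Exponents only go down, so the monomials
  stay in N once N contains all indices below those in S.\<close>

lemma polynomial_on_newton:
  assumes "finite I" "finite S" "\<And>\<eta>. \<eta> \<in> S \<Longrightarrow> (\<Pi>\<^sub>E i\<in>I. {..\<eta> i}) \<subseteq> N"
    "\<And>x. x \<in> V \<Longrightarrow> p x = (\<Sum>\<eta>\<in>S. scale (\<Prod>i\<in>I. newton (c i) (\<eta> i) (x i)) (e \<eta>))"
  shows "polynomial_on scale I N V p"
proof -
  obtain q where q: "\<And>i k t. newton (c i) k t = (\<Sum>a\<le>k. q i k a * t ^ a)"
    using newton_expansion[of "c _"] by metis
  define F where "F = (\<Union>\<eta>\<in>S. \<Pi>\<^sub>E i\<in>I. {..\<eta> i})"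
  have finF: "finite F" using assms(1,2) by (auto simp: F_def intro!: finite_PiE)
  define b where "b \<kappa> = (\<Sum>\<eta>\<in>S. if \<kappa> \<in> (\<Pi>\<^sub>E i\<in>I. {..\<eta> i})
    then scale (\<Prod>i\<in>I. q i (\<eta> i) (\<kappa> i)) (e \<eta>) else 0)" for \<kappa>
  show ?thesis
  proof (rule polynomial_on_sum[OF finF])
    show "F \<subseteq> N" using assms(3) by (auto simp: F_def)
    fix x assume "x \<in> V"
    have "p x = (\<Sum>\<eta>\<in>S. \<Sum>\<kappa>\<in>(\<Pi>\<^sub>E i\<in>I. {..\<eta> i}).
        scale (\<Prod>i\<in>I. x i ^ \<kappa> i) (scale (\<Prod>i\<in>I. q i (\<eta> i) (\<kappa> i)) (e \<eta>)))"
      using assms(1) by (simp add: assms(4)[OF \<open>x \<in> V\<close>] q prod_sum_PiE prod.distrib scale_sum_left mult.commute)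
    also have "\<dots> = (\<Sum>\<eta>\<in>S. \<Sum>\<kappa>\<in>F. if \<kappa> \<in> (\<Pi>\<^sub>E i\<in>I. {..\<eta> i}) then
        scale (\<Prod>i\<in>I. x i ^ \<kappa> i) (scale (\<Prod>i\<in>I. q i (\<eta> i) (\<kappa> i)) (e \<eta>)) else 0)"
      using finF by (intro sum.cong sum.mono_neutral_cong_left) (auto simp: F_def)
    also have "\<dots> = (\<Sum>\<kappa>\<in>F. scale (\<Prod>i\<in>I. x i ^ \<kappa> i) (b \<kappa>))"
      unfolding b_def scale_sum_right
      by (subst sum.swap) (intro sum.cong refl, auto)
    finally show "p x = (\<Sum>\<kappa>\<in>F. scale (\<Prod>i\<in>I. x i ^ \<kappa> i) (b \<kappa>))" .
  qed
qed

end

context ultrametric_lcs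
begin

lemma block_interpolation_error:
  assumes I: "finite I" "I = (\<Union>j<l. J j)" and disj: "\<And>j k. j < k \<Longrightarrow> k < l \<Longrightarrow> J j \<inter> J k = {}"
    and M: "O_submodule smul M" and p: "p \<noteq> 0" "absval p \<le> 1" and c: "centre_system p I G c"
    and f: "\<And>Y Y'. good_nodes I l J \<beta> G Y \<Longrightarrow> good_nodes I l J \<beta> G Y' \<Longrightarrow>
        (\<And>i. i \<in> I \<Longrightarrow> Y i = Y' i \<or> card (Y i) = card (Y' i) \<and> clustered p (Y i) (Y' i)) \<Longrightarrow>
        set_dd smul I f Y - set_dd smul I f Y' \<in> M"
    and X: "good_nodes I l J \<beta> G X"
  shows "set_dd smul I (\<lambda>x. f x - interpolate smul I I (block_le J \<beta> l) c f x) X \<in> M"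
proof -
  \<comment> \<open>Stated for arbitrary u, since it is applied both to f and to the error left by
    the earlier blocks.\<close>
  have one_block: "set_dd smul I (\<lambda>x. u x - interpolate smul I (J k) (simplex_idx (J k) (\<beta> k)) c u x) X \<in> M"
    if k: "k < l" and X: "good_nodes I l J \<beta> G X" and
      u: "\<And>Y Y'. good_nodes I l J \<beta> G Y \<Longrightarrow> good_nodes I l J \<beta> G Y' \<Longrightarrow>
        (\<And>i. i \<in> I \<Longrightarrow> Y i = Y' i \<or> card (Y i) = card (Y' i) \<and> clustered p (Y i) (Y' i)) \<Longrightarrow>
        set_dd smul I u Y - set_dd smul I u Y' \<in> M" for k u X
  proof (rule interpolation_error[OF I(1) _ M p, where G = G])
    show JI: "J k \<subseteq> I" using I k by auto
    show "centre_system p (J k) G c" using c JI unfolding centre_system_def by blast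
    fix Y Y'
    assume Y: "\<And>i. i \<in> J k \<Longrightarrow> Y i \<subseteq> G i \<and> Y' i \<subseteq> G i \<and> finite (Y i) \<and> finite (Y' i) \<and>
          Y i \<noteq> {} \<and> Y' i \<noteq> {} \<and> card (Y i) = card (Y' i) \<and> clustered p (Y i) (Y' i)"
        "\<And>i. i \<notin> J k \<Longrightarrow> Y i = X i \<and> Y' i = X i" "node_degree (J k) Y = \<beta> k"
    have deg: "node_degree (J j) Y \<le> \<beta> j" "node_degree (J j) Y' \<le> \<beta> j" if j: "j < l" for j
    proof -
      \<comment> \<open>Only nodes in block k differ from X. There the order is
        \<open>\<beta> k\<close>; elsewhere the bound is inherited from X by disjointness.\<close>
      consider "j = k" | "J j \<inter> J k = {}"
        using disj[of j k] disj[of k j] j k by (metis inf_commute linorder_neqE_nat)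
      then have "node_degree (J j) Y \<le> \<beta> j \<and> node_degree (J j) Y' \<le> \<beta> j"
      proof cases
        case 1
        have "node_degree (J k) Y = node_degree (J k) Y'" using Y(1) by (intro node_degree_cong) auto
        then show ?thesis using Y(3) 1 by simp
      next
        case 2
        then have "node_degree (J j) Y = node_degree (J j) X" "node_degree (J j) Y' = node_degree (J j) X"
          using Y(2) by (intro node_degree_cong arg_cong[of _ _ card]; blast)+
        then show ?thesis using X j by (auto simp: good_nodes_def)
      qed
      then show "node_degree (J j) Y \<le> \<beta> j" "node_degree (J j) Y' \<le> \<beta> j" by auto
    qed
    have nodes: "finite (Y i) \<and> Y i \<noteq> {} \<and> Y i \<subseteq> G i" "finite (Y' i) \<and> Y' i \<noteq> {} \<and> Y' i \<subseteq> G i"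
      if "i \<in> I" for i
    proof -
      have "finite (X i) \<and> X i \<noteq> {} \<and> X i \<subseteq> G i" using X that by (simp add: good_nodes_def)
      then show "finite (Y i) \<and> Y i \<noteq> {} \<and> Y i \<subseteq> G i" "finite (Y' i) \<and> Y' i \<noteq> {} \<and> Y' i \<subseteq> G i"
        using Y(1)[of i] Y(2)[of i] by (cases "i \<in> J k"; simp)+
    qed
    show "set_dd smul I u Y - set_dd smul I u Y' \<in> M"
    proof (rule u)
      show "good_nodes I l J \<beta> G Y" "good_nodes I l J \<beta> G Y'"
        using deg nodes unfolding good_nodes_def by blast+
      show "Y i = Y' i \<or> card (Y i) = card (Y' i) \<and> clustered p (Y i) (Y' i)" for i
        using Y(1)[of i] Y(2)[of i] by (cases "i \<in> J k") auto
    qed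
  qed (use X k I in \<open>auto simp: good_nodes_def\<close>)
  have "set_dd smul I (\<lambda>x. f x - interpolate smul I (\<Union>j<k. J j) (block_le J \<beta> k) c f x) X \<in> M"
    if "k \<le> l" "good_nodes I l J \<beta> G X" for k X
    using that
  proof (induction k arbitrary: X)
    case 0
    have "block_le J \<beta> 0 = {\<lambda>_. undefined}" by (auto simp: block_le_def)
    then have "set_dd smul I (\<lambda>x. f x - interpolate smul I (\<Union>j<0. J j) (block_le J \<beta> 0) c f x) X
      = set_dd smul I (\<lambda>x. 0) X"
      by (intro set_dd_cong refl) (simp add: interpolate_empty)
    then show ?case using submodule_zero[OF M] by (simp add: set_dd_def)
  next
    case (Suc k)
    \<comment> \<open>With \<open>T\<close> the interpolation in block \<open>k\<close> and \<open>g\<close> the one in the earlier blocks: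
      \<open>f - T g = (f - T f) + T (f - g)\<close>.\<close>
    let ?L = "\<Union>j<k. J j" and ?S = "simplex_idx (J k) (\<beta> k)"
    define g where "g = interpolate smul I ?L (block_le J \<beta> k) c f"
    let ?u = "\<lambda>x. f x - g x"
    have "block_le J \<beta> (Suc k) = merge_indices (J k) ?L ?S (block_le J \<beta> k)"
      using disj Suc.prems by (intro block_le_Suc) auto
    moreover have "interpolate smul I (J k) ?S c g =
        interpolate smul I (J k \<union> ?L) (merge_indices (J k) ?L ?S (block_le J \<beta> k)) c f"
      unfolding g_def
    proof (rule interpolate_interpolate[OF I(1)])
      show "J k \<subseteq> I" "?L \<subseteq> I" using I(2) Suc.prems by (auto intro: less_trans)
      show "J k \<inter> ?L = {}" using disj[of _ k] Suc.prems by (fastforce simp: Suc_le_eq)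
    qed (auto simp: simplex_idx_def block_le_def)
    ultimately have g: "interpolate smul I (\<Union>j<Suc k. J j) (block_le J \<beta> (Suc k)) c f =
        interpolate smul I (J k) ?S c g"
      by (simp add: lessThan_Suc)
    have u: "set_dd smul I ?u Y \<in> M" if "good_nodes I l J \<beta> G Y" for Y
      using Suc.IH[OF _ that] Suc.prems by (simp add: g_def)
    \<comment> \<open>For u = f - g the stability hypothesis is automatic: both divided differences
      lie in M, hence so does their difference.\<close>
    have "set_dd smul I (\<lambda>x. ?u x - interpolate smul I (J k) ?S c ?u x) X \<in> M"
      using Suc.prems u by (intro one_block submodule_diff[OF M]) auto
    \<comment> \<open>T u = u - (u - T u), and both terms have divided differences in M.\<close>
    from submodule_diff[OF M u[OF Suc.prems(2)] this]
    have "set_dd smul I (interpolate smul I (J k) ?S c ?u) X \<in> M"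
      by (simp only: set_dd_minus[of I ?u "interpolate _ _ _ _ _ _"] diff_diff_eq2 add_diff_cancel_left')
    moreover have "set_dd smul I (\<lambda>x. f x - interpolate smul I (J k) ?S c f x) X \<in> M"
      using Suc.prems f by (intro one_block) auto
    ultimately have "set_dd smul I (\<lambda>x. (f x - interpolate smul I (J k) ?S c f x) +
        interpolate smul I (J k) ?S c ?u x) X \<in> M"
      unfolding set_dd_add by (intro submodule_add[OF M])
    then show ?case unfolding g by (simp add: interpolate_diff)
  qed
  from this[OF order.refl X] show ?thesis by (simp add: I(2))
qed

end

section \<open>Boxes and tuples of nodes\<close>

text \<open>A non-strict bound with a fixed radius: for d \<ge> 0 this is an equivalence relation,
  so balls of one radius are equal or disjoint.\<close>

definition near :: "'i set \<Rightarrow> real \<Rightarrow> ('i \<Rightarrow> 'k::ultrametric_field) \<Rightarrow> ('i \<Rightarrow> 'k) \<Rightarrow> bool" where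
  "near I d x y \<longleftrightarrow> (\<forall>i\<in>I. absval (y i - x i) \<le> d)"

definition near_tuples ::
    "'i set \<Rightarrow> ('i \<Rightarrow> nat) \<Rightarrow> real \<Rightarrow> ('i \<Rightarrow> nat \<Rightarrow> 'k::ultrametric_field) \<Rightarrow> ('i \<Rightarrow> nat \<Rightarrow> 'k) \<Rightarrow> bool" where
  "near_tuples I \<gamma> d x y \<longleftrightarrow> (\<forall>i\<in>I. near {..\<gamma> i} d (x i) (y i))"

lemma near_refl [simp]: "0 \<le> d \<Longrightarrow> near I d x x"
  by (simp add: near_def)

lemma near_sym: "near I d x y \<Longrightarrow> near I d y x"
  unfolding near_def using absval_minus_commute by metis

lemma near_trans: "near I d x y \<Longrightarrow> near I d y z \<Longrightarrow> near I d x z"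
  unfolding near_def using absval_trans by blast

lemma near_mono: "near I d x y \<Longrightarrow> d \<le> e \<Longrightarrow> near I e x y"
  unfolding near_def by fastforce

lemma near_tuples_refl [simp]: "0 \<le> d \<Longrightarrow> near_tuples I \<gamma> d x x"
  by (simp add: near_tuples_def)

lemma near_tuples_trans: "near_tuples I \<gamma> d x y \<Longrightarrow> near_tuples I \<gamma> d y z \<Longrightarrow> near_tuples I \<gamma> d x z"
  unfolding near_tuples_def using near_trans by blast

lemma near_tuples_mono: "near_tuples I \<gamma> d x y \<Longrightarrow> d \<le> e \<Longrightarrow> near_tuples I \<gamma> e x y"
  unfolding near_tuples_def using near_mono by blast

section \<open>Topology of coordinate spaces and spaces of tuples\<close>

lemma open_absval_ball: "0 < d \<Longrightarrow> open {t. absval (t - a :: 'k::ultrametric_field) \<le> d}"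
  unfolding open_dist
proof (intro ballI exI[of _ d] conjI allI impI)
  fix s t :: 'k assume "0 < d" "s \<in> {t. absval (t - a) \<le> d}" "dist t s < d"
  then show "t \<in> {t. absval (t - a) \<le> d}"
    using absval_trans[of t s d a] by (simp add: dist_absval)
qed

lemma open_near:
  assumes "finite I" "0 < d"
  shows "open {y. near I d x y}"
proof -
  have "{y. near I d x y} = (\<Inter>i\<in>I. (\<lambda>y. y i) -` {t. absval (t - x i) \<le> d})"
    by (auto simp: near_def)
  moreover have "open ((\<lambda>y. y i) -` {t. absval (t - x i) \<le> d})" for i
    by (rule open_vimage[OF open_absval_ball[OF assms(2)]]) simp
  ultimately show ?thesis using assms(1) by (auto simp only: intro!: open_INT)
qed

lemma open_near_tuples:
  assumes "finite I" "0 < d"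
  shows "open {y. near_tuples I \<gamma> d x y}"
proof -
  have "{y. near_tuples I \<gamma> d x y} = (\<Inter>i\<in>I. (\<lambda>y. y i) -` {t. near {..\<gamma> i} d (x i) t})"
    by (auto simp: near_tuples_def)
  moreover have "open ((\<lambda>y. y i) -` {t. near {..\<gamma> i} d (x i) t})" for i
    by (rule open_vimage[OF open_near[OF _ assms(2)]]) auto
  ultimately show ?thesis using assms(1) by (auto simp only: intro!: open_INT)
qed

text \<open>Open sets of the function type may restrict coordinates outside I too, but points of
  \<open>extensional I\<close> all have the value \<open>undefined\<close> there.\<close>

lemma open_contains_coordinate_box:
  fixes W :: "('i \<Rightarrow> 'a::topological_space) set"
  assumes "open W" "x \<in> W" "x \<in> extensional I"
  obtains A where "\<And>i. open (A i)" "\<And>i. x i \<in> A i" "PiE I A \<subseteq> W"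
proof -
  obtain X where X: "x \<in> (\<Pi>\<^sub>E i\<in>UNIV. X i)" "\<And>i. open (X i)" "(\<Pi>\<^sub>E i\<in>UNIV. X i) \<subseteq> W"
    using product_topology_open_contains_basis[of "\<lambda>_. euclidean" UNIV W x] assms(1,2)
    by (auto simp: euclidean_product_topology)
  show thesis
  proof (rule that[of X])
    show "PiE I X \<subseteq> W"
    proof
      fix y assume y: "y \<in> PiE I X"
      have "y i \<in> X i" for i
        using y X(1) assms(3) by (cases "i \<in> I") (auto simp: PiE_def extensional_def Pi_iff, metis)
      then show "y \<in> W" using X(3) by auto
    qed
  qed (use X in auto)
qed

text \<open>\<open>P\<close> is not assumed monotone in the radius; hence the conclusion keeps a
  possibly larger radius e at which \<open>P i\<close> is known.\<close>

lemma finite_min_radius: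
  assumes "finite I" "\<And>i. i \<in> I \<Longrightarrow> \<exists>d>0::real. P i d"
  obtains d where "0 < d" "\<And>i. i \<in> I \<Longrightarrow> \<exists>e\<ge>d. P i e"
proof -
  obtain r where r: "\<And>i. i \<in> I \<Longrightarrow> 0 < r i \<and> P i (r i)"
    using assms(2) by metis
  have "0 < Min (insert 1 (r ` I))"
    using assms(1) r by auto
  moreover have "Min (insert 1 (r ` I)) \<le> r i" if "i \<in> I" for i
    using assms(1) that by (intro Min_le) auto
  ultimately show thesis using r that by blast
qed

lemma open_contains_near:
  fixes W :: "('i \<Rightarrow> 'k::ultrametric_field) set"
  assumes "finite I" "open W" "x \<in> W" "x \<in> extensional I"
  obtains d where "0 < d" "\<And>y. y \<in> extensional I \<Longrightarrow> near I d x y \<Longrightarrow> y \<in> W"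
proof -
  obtain A where A: "\<And>i. open (A i)" "\<And>i. x i \<in> A i" "PiE I A \<subseteq> W"
    using open_contains_coordinate_box[OF assms(2-4)] by blast
  have "\<exists>d>0. \<forall>t. absval (t - x i) \<le> d \<longrightarrow> t \<in> A i" for i
  proof -
    obtain e where "0 < e" "\<And>t. dist t (x i) < e \<Longrightarrow> t \<in> A i"
      using A(1,2) unfolding open_dist by metis
    then show ?thesis by (intro exI[of _ "e / 2"]) (auto simp: dist_absval)
  qed
  then obtain d where d: "0 < d" "\<And>i. i \<in> I \<Longrightarrow> \<exists>e\<ge>d. \<forall>t. absval (t - x i) \<le> e \<longrightarrow> t \<in> A i"
    using finite_min_radius[OF assms(1), of "\<lambda>i d. \<forall>t. absval (t - x i) \<le> d \<longrightarrow> t \<in> A i"] by blast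
  have "y \<in> W" if "y \<in> extensional I" "near I d x y" for y
  proof -
    have "y i \<in> A i" if i: "i \<in> I" for i
      using d(2)[OF i] \<open>near I d x y\<close> i unfolding near_def by (meson order_trans)
    then show ?thesis using A(3) that(1) by (auto simp: PiE_def)
  qed
  then show thesis using d(1) that by blast
qed

lemma open_contains_near_tuples:
  fixes W :: "('i \<Rightarrow> nat \<Rightarrow> 'k::ultrametric_field) set"
  assumes "finite I" "open W" "x \<in> W" "x \<in> mult_dom I V \<gamma>"
  obtains d where "0 < d" "\<And>y. y \<in> mult_dom I V \<gamma> \<Longrightarrow> near_tuples I \<gamma> d x y \<Longrightarrow> y \<in> W"
proof -
  have "x \<in> extensional I" using assms(4) by (auto simp: mult_dom_def PiE_def)
  then obtain A where A: "\<And>i. open (A i)" "\<And>i. x i \<in> A i" "PiE I A \<subseteq> W"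
    using open_contains_coordinate_box[OF assms(2,3)] by blast
  have "\<exists>d>0. \<forall>t\<in>extensional {..\<gamma> i}. near {..\<gamma> i} d (x i) t \<longrightarrow> t \<in> A i" if i: "i \<in> I" for i
  proof -
    have "x i \<in> extensional {..\<gamma> i}" using assms(4) i by (auto simp: mult_dom_def PiE_iff)
    from open_contains_near[OF _ A(1) A(2) this] show ?thesis by (metis finite_atMost)
  qed
  then obtain d where d: "0 < d"
      "\<And>i. i \<in> I \<Longrightarrow> \<exists>e\<ge>d. \<forall>t\<in>extensional {..\<gamma> i}. near {..\<gamma> i} e (x i) t \<longrightarrow> t \<in> A i"
    using finite_min_radius[OF assms(1),
        of "\<lambda>i d. \<forall>t\<in>extensional {..\<gamma> i}. near {..\<gamma> i} d (x i) t \<longrightarrow> t \<in> A i"] by blast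
  have "y \<in> W" if y: "y \<in> mult_dom I V \<gamma>" "near_tuples I \<gamma> d x y" for y
  proof -
    have "y i \<in> A i" if i: "i \<in> I" for i
    proof -
      have "y i \<in> extensional {..\<gamma> i}" using y(1) i by (auto simp: mult_dom_def PiE_iff)
      then show ?thesis using d(2)[OF i] y(2) i near_mono unfolding near_tuples_def by blast
    qed
    moreover have "y \<in> extensional I" using y(1) by (auto simp: mult_dom_def PiE_def)
    ultimately show ?thesis using A(3) by (auto simp: PiE_def)
  qed
  then show thesis using d(1) that by blast
qed

text \<open>Tychonoff's theorem over all indices, with the compact singleton of
  \<open>undefined\<close> as factor outside I.\<close>

lemma compact_PiE_euclidean:
  fixes K :: "'i \<Rightarrow> 'a::topological_space set"
  assumes "\<And>i. i \<in> I \<Longrightarrow> compact (K i)"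
  shows "compact (PiE I K)"
proof -
  have "PiE I K = PiE UNIV (\<lambda>i. if i \<in> I then K i else {undefined})"
  proof (rule set_eqI)
    fix y
    show "y \<in> PiE I K \<longleftrightarrow> y \<in> PiE UNIV (\<lambda>i. if i \<in> I then K i else {undefined})"
      by (simp add: PiE_iff extensional_def) (metis empty_iff insert_iff)
  qed
  moreover have "compactin (product_topology (\<lambda>_. euclidean) UNIV)
      (PiE UNIV (\<lambda>i. if i \<in> I then K i else {undefined}))"
    unfolding compactin_PiE using assms by auto
  ultimately show ?thesis by (simp add: euclidean_product_topology)
qed

text \<open>A Lebesgue number. \<open>B\<close> is abstract so as to serve \<open>near\<close> and
  \<open>near_tuples\<close> alike; for these, transitivity puts the ball of radius d around z into
  the ball of radius e around the sample point s.\<close>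

lemma compact_uniform_radius:
  fixes C :: "'a::topological_space set"
  assumes "compact C" "\<And>z d. z \<in> C \<Longrightarrow> 0 < d \<Longrightarrow> open {y. B d z y} \<and> B d z z"
    and "\<And>z. z \<in> C \<Longrightarrow> \<exists>d>0::real. \<Phi> z d"
  shows "\<exists>d>0. \<forall>z\<in>C. \<exists>s\<in>C. \<exists>e\<ge>d. \<Phi> s e \<and> B e s z"
proof -
  obtain r where r: "\<And>z. z \<in> C \<Longrightarrow> 0 < r z \<and> \<Phi> z (r z)" using assms(3) by metis
  obtain Z where Z: "Z \<subseteq> C" "finite Z" "C \<subseteq> (\<Union>z\<in>Z. {y. B (r z) z y})"
    by (rule compactE_image[OF assms(1), of C "\<lambda>z. {y. B (r z) z y}"]) (use assms(2) r in auto)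
  have "\<exists>d>0. d = r z" if "z \<in> Z" for z using r Z(1) that by auto
  then obtain d where d: "0 < d" "\<And>z. z \<in> Z \<Longrightarrow> \<exists>e\<ge>d. e = r z"
    using finite_min_radius[OF Z(2), of "\<lambda>z d. d = r z"] by blast
  have "\<exists>s\<in>C. \<exists>e\<ge>d. \<Phi> s e \<and> B e s z" if "z \<in> C" for z
  proof -
    obtain s where s: "s \<in> Z" "B (r s) s z" using Z(3) \<open>z \<in> C\<close> by auto
    then have "d \<le> r s" "s \<in> C" "\<Phi> s (r s)" using d(2) Z(1) r by auto
    then show ?thesis using s(2) by blast
  qed
  then show ?thesis using d(1) by blast
qed

lemma infinite_near_non_isolated:
  fixes t :: "'k::ultrametric_field"
  assumes "t \<in> F" "\<not> t isolated_in F" "0 < d"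
  shows "infinite {s \<in> F. absval (s - t) \<le> d}"
proof -
  have "t islimpt F" using assms by (simp add: isolated_in_islimpt_iff)
  then have "infinite (F \<inter> ball t d)" using assms(3) by (simp add: islimpt_eq_infinite_ball)
  moreover have "F \<inter> ball t d \<subseteq> {s \<in> F. absval (s - t) \<le> d}"
    by (auto simp: dist_absval absval_minus_commute[of _ t])
  ultimately show ?thesis by (rule infinite_super[rotated])
qed

lemma distinct_choice:
  assumes "\<And>k. k \<le> n \<Longrightarrow> infinite (A k)"
  shows "\<exists>y. inj_on y {..n} \<and> (\<forall>k\<le>n::nat. y k \<in> A k)"
  using assms
proof (induction n)
  case 0
  then obtain a where "a \<in> A 0" using infinite_imp_nonempty by blast
  then show ?case by (intro exI[of _ "\<lambda>_. a"]) auto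
next
  case (Suc n)
  then obtain y where y: "inj_on y {..n}" "\<forall>k\<le>n. y k \<in> A k" by auto
  have "infinite (A (Suc n) - y ` {..n})" using Suc.prems by simp
  then obtain a where "a \<in> A (Suc n)" "a \<notin> y ` {..n}" using infinite_imp_nonempty by blast
  then have "inj_on (y(Suc n := a)) {..Suc n}" "\<forall>k\<le>Suc n. (y(Suc n := a)) k \<in> A k"
    using y by (auto simp: atMost_Suc inj_on_def le_Suc_eq)
  then show ?case by blast
qed

text \<open>For nonempty V the factors are the projections. An empty V may be a product with some
  nonempty factors, but all its projections are empty, and so is their product.\<close>

lemma cartesian_eq_PiE_factor:
  assumes "I \<noteq> {}" "cartesian I V"
  shows "V = PiE I (factor V)" "\<And>i t. i \<in> I \<Longrightarrow> t \<in> factor V i \<Longrightarrow> \<not> t isolated_in factor V i"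
proof -
  obtain F where F: "V = PiE I F" "\<And>i t. i \<in> I \<Longrightarrow> t \<in> F i \<Longrightarrow> \<not> t isolated_in F i"
    using assms(2) by (auto simp: cartesian_def)
  have "V = PiE I (factor V) \<and> (\<forall>i\<in>I. \<forall>t\<in>factor V i. \<not> t isolated_in factor V i)"
  proof (cases "V = {}")
    case True
    have "PiE I (\<lambda>i. {} :: 'b set) = {}" using assms(1) by (auto simp: PiE_eq_empty_iff)
    then show ?thesis using True by (simp add: factor_def[abs_def])
  next
    case False
    have "factor V i = F i" if i: "i \<in> I" for i
    proof
      show "factor V i \<subseteq> F i" using i by (auto simp: factor_def F(1))
      obtain v where v: "v \<in> V" using False by blast
      show "F i \<subseteq> factor V i"
      proof
        fix t assume "t \<in> F i"
        then have "v(i := t) \<in> V" using v i by (auto simp: F(1) PiE_iff extensional_def)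
        then show "t \<in> factor V i" unfolding factor_def by (metis fun_upd_same image_eqI)
      qed
    qed
    then show ?thesis using F by (auto cong: PiE_cong)
  qed
  then show "V = PiE I (factor V)" "\<And>i t. i \<in> I \<Longrightarrow> t \<in> factor V i \<Longrightarrow> \<not> t isolated_in factor V i"
    by blast+
qed

text \<open>Every ball around a point of a factor contains infinitely many points of that factor, so
  the entries can be made distinct one after the other.\<close>

lemma mult_dom_distinct_dense:
  fixes V :: "('i \<Rightarrow> 'k::ultrametric_field) set"
  assumes "\<And>i t. i \<in> I \<Longrightarrow> t \<in> factor V i \<Longrightarrow> \<not> t isolated_in factor V i"
    and "x \<in> mult_dom I V \<gamma>" "0 < d"
  obtains y where "y \<in> mult_dom_distinct I V \<gamma>" "near_tuples I \<gamma> d x y"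
proof -
  have "\<exists>y. inj_on y {..\<gamma> i} \<and> (\<forall>k\<le>\<gamma> i. y k \<in> {s \<in> factor V i. absval (s - x i k) \<le> d})"
    if i: "i \<in> I" for i
    using assms i by (intro distinct_choice infinite_near_non_isolated) (auto simp: mult_dom_def PiE_iff)
  then obtain y where y: "\<And>i. i \<in> I \<Longrightarrow>
      inj_on (y i) {..\<gamma> i} \<and> (\<forall>k\<le>\<gamma> i. y i k \<in> {s \<in> factor V i. absval (s - x i k) \<le> d})"
    by metis
  let ?y = "\<lambda>i\<in>I. restrict (y i) {..\<gamma> i}"
  have "?y \<in> mult_dom_distinct I V \<gamma>"
    using y by (fastforce simp: mult_dom_distinct_def mult_dom_def inj_on_def)
  moreover have "near_tuples I \<gamma> d x ?y"
    using y by (auto simp: near_tuples_def near_def)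
  ultimately show thesis by (rule that)
qed

text \<open>Serves to pass from tuples with distinct entries to all tuples, for the closed sets M
  and {0}.\<close>

lemma continuous_on_closed_limit:
  assumes "continuous_on S h" "closed M" "x \<in> S" "\<And>W. open W \<Longrightarrow> x \<in> W \<Longrightarrow> \<exists>y\<in>W \<inter> S. h y \<in> M"
  shows "h x \<in> M"
proof (rule ccontr)
  assume "h x \<notin> M"
  moreover have "open (- M)" using assms(2) by (simp add: open_Compl)
  ultimately obtain W where "open W" "x \<in> W" "\<forall>y\<in>S. y \<in> W \<longrightarrow> h y \<in> - M"
    using assms(1,3) unfolding continuous_on_topological by (metis ComplI)
  then show False using assms(4)[of W] by auto
qed

text \<open>For distinct entries, index tuples j correspond bijectively to grid points, and products
  over indices become products over nodes.\<close>

lemma div_diff_eq_set_dd: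
  assumes "finite I" "y \<in> mult_dom_distinct I V \<gamma>"
  shows "div_diff smul I f \<gamma> y = set_dd smul I f (\<lambda>i. y i ` {..\<gamma> i})"
proof -
  have inj: "inj_on (y i) {..\<gamma> i}" if "i \<in> I" for i
  proof (rule inj_onI)
    fix j k assume "j \<in> {..\<gamma> i}" "k \<in> {..\<gamma> i}" "y i j = y i k"
    moreover have "\<And>j k. j < k \<Longrightarrow> k \<le> \<gamma> i \<Longrightarrow> y i j \<noteq> y i k"
      using assms(2) that unfolding mult_dom_distinct_def by blast
    ultimately show "j = k"
      by (metis atMost_iff linorder_neqE_nat)
  qed
  let ?b = "\<lambda>j. \<lambda>i\<in>I. y i (j i)"
  have "bij_betw ?b (PiE I (\<lambda>i. {..\<gamma> i})) (PiE I (\<lambda>i. y i ` {..\<gamma> i}))"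
  proof (intro bij_betw_imageI inj_onI equalityI subsetI)
    fix j j' assume jj: "j \<in> (\<Pi>\<^sub>E i\<in>I. {..\<gamma> i})" "j' \<in> (\<Pi>\<^sub>E i\<in>I. {..\<gamma> i})" "?b j = ?b j'"
    show "j = j'"
    proof (rule PiE_ext[OF jj(1,2)])
      fix i assume i: "i \<in> I"
      then have "y i (j i) = y i (j' i)" using fun_cong[OF jj(3), of i] by simp
      then show "j i = j' i" using inj[OF i] jj(1,2) i by (auto simp: inj_on_def PiE_iff)
    qed
  next
    fix z assume z: "z \<in> (\<Pi>\<^sub>E i\<in>I. y i ` {..\<gamma> i})"
    let ?j = "\<lambda>i\<in>I. the_inv_into {..\<gamma> i} (y i) (z i)"
    have "?j \<in> (\<Pi>\<^sub>E i\<in>I. {..\<gamma> i})"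
      using z inj the_inv_into_into[OF inj _ subset_refl] by (auto simp: PiE_iff)
    moreover have "z = ?b ?j"
      using z f_the_inv_into_f[OF inj] by (auto simp: PiE_def extensional_def fun_eq_iff Pi_iff)
    ultimately show "z \<in> ?b ` (\<Pi>\<^sub>E i\<in>I. {..\<gamma> i})" by blast
  qed (auto simp: PiE_iff)
  then have "set_dd smul I f (\<lambda>i. y i ` {..\<gamma> i}) = (\<Sum>j\<in>PiE I (\<lambda>i. {..\<gamma> i}).
      smul (\<Prod>i\<in>I. node_weight (y i ` {..\<gamma> i}) (?b j i)) (f (?b j)))"
    unfolding set_dd_def by (rule sum.reindex_bij_betw[symmetric])
  also have "\<dots> = div_diff smul I f \<gamma> y"
    unfolding div_diff_def
  proof (intro sum.cong refl arg_cong2[of _ _ _ _ smul] prod.cong)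
    fix j i assume j: "j \<in> (\<Pi>\<^sub>E i\<in>I. {..\<gamma> i})" and i: "i \<in> I"
    then have ji: "j i \<in> {..\<gamma> i}" by (auto simp: PiE_iff)
    have img: "y i ` {..\<gamma> i} - {y i (j i)} = y i ` ({..\<gamma> i} - {j i})"
      using inj[OF i] ji by (auto simp: inj_on_def)
    have "(\<Prod>t\<in>y i ` ({..\<gamma> i} - {j i}). 1 / (y i (j i) - t)) =
      (\<Prod>k\<in>{..\<gamma> i} - {j i}. 1 / (y i (j i) - y i k))"
      using inj[OF i] by (subst prod.reindex) (auto intro: inj_on_subset)
    then show "node_weight (y i ` {..\<gamma> i}) (?b j i) = (\<Prod>k\<in>{..\<gamma> i} - {j i}. 1 / (y i (j i) - y i k))"
      using i ji by (simp add: node_weight_def img)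
  qed
  finally show ?thesis ..
qed

lemma centre_system_exists:
  fixes p :: "'k::ultrametric_field"
  assumes "\<And>i t. i \<in> I \<Longrightarrow> t \<in> G i \<Longrightarrow> infinite {s \<in> G i. absval (s - t) \<le> absval p}"
  obtains c where "centre_system p I G c"
proof -
  define B where "B i t = {s \<in> G i. absval (s - t) \<le> absval p}" for i t
  \<comment> \<open>The choice is made from the set \<open>B i t\<close>, which is the same for all
    points of a cell; hence so is the chosen sequence.\<close>
  define c where "c i t = (SOME h. inj (h :: nat \<Rightarrow> 'k) \<and> range h \<subseteq> B i t)" for i t
  have c: "inj (c i t) \<and> range (c i t) \<subseteq> B i t" if "i \<in> I" "t \<in> G i" for i t
    using someI_ex[OF infinite_countable_subset[OF assms[OF that]]] unfolding c_def B_def .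
  have B_sub: "B i s \<subseteq> B i t" if "absval (s - t) \<le> absval p" for i s t
  proof
    fix r assume "r \<in> B i s"
    then show "r \<in> B i t" using absval_trans[of r s "absval p" t] that by (simp add: B_def)
  qed
  have B: "B i s = B i t" if "absval (s - t) \<le> absval p" for i s t
    using B_sub[OF that] B_sub[of t s i] that absval_minus_commute[of s t] by auto
  have "centre_system p I G c"
    unfolding centre_system_def
  proof (intro ballI conjI allI impI)
    fix i s t assume "i \<in> I" "t \<in> G i" "s \<in> G i" "absval (s - t) \<le> absval p"
    then show "c i s = c i t" unfolding c_def by (simp only: B)
  next
    fix i t l assume "i \<in> I" "t \<in> G i"
    then have *: "inj (c i t)" "range (c i t) \<subseteq> B i t" using c by blast+
    show "inj (c i t)" by (fact *)
    show "c i t l \<in> G i" "absval (c i t l - t) \<le> absval p" using *(2) by (auto simp: B_def)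
  qed
  then show thesis by (rule that)
qed

section \<open>Approximation on cartesian sets\<close>

lemma finite_block_le:
  assumes "finite I" "I = (\<Union>j<l. J j)"
  shows "finite (block_le J \<beta> l)"
proof (rule finite_subset)
  show "block_le J \<beta> l \<subseteq> (\<Pi>\<^sub>E i\<in>I. {..\<Sum>j<l. \<beta> j})"
  proof
    fix \<eta> assume \<eta>: "\<eta> \<in> block_le J \<beta> l"
    have "\<eta> i \<le> (\<Sum>j<l. \<beta> j)" if i: "i \<in> I" for i
    proof -
      obtain j where j: "j < l" "i \<in> J j" using i assms(2) by auto
      then have "finite (J j)" using assms by (auto intro: finite_subset[of _ I])
      then have "\<eta> i \<le> sum \<eta> (J j)" using j by (intro member_le_sum) auto
      also have "\<dots> \<le> \<beta> j" using \<eta> j by (auto simp: block_le_def)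
      also have "\<dots> \<le> (\<Sum>j<l. \<beta> j)" using j by (intro member_le_sum) auto
      finally show ?thesis .
    qed
    then show "\<eta> \<in> (\<Pi>\<^sub>E i\<in>I. {..\<Sum>j<l. \<beta> j})"
      using \<eta> assms(2) by (auto simp: block_le_def PiE_iff)
  qed
qed (use assms(1) in \<open>auto intro: finite_PiE\<close>)

lemma block_le_downward:
  assumes "\<eta> \<in> block_le J \<beta> l" "I = (\<Union>j<l. J j)"
  shows "(\<Pi>\<^sub>E i\<in>I. {..\<eta> i}) \<subseteq> block_le J \<beta> l"
proof
  fix \<kappa> assume \<kappa>: "\<kappa> \<in> (\<Pi>\<^sub>E i\<in>I. {..\<eta> i})"
  have "sum \<kappa> (J j) \<le> \<beta> j" if "j < l" for j
  proof -
    have "sum \<kappa> (J j) \<le> sum \<eta> (J j)" using \<kappa> assms(2) that by (intro sum_mono) (auto simp: PiE_iff)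
    then show ?thesis using assms(1) that by (force simp: block_le_def)
  qed
  then show "\<kappa> \<in> block_le J \<beta> l"
    using \<kappa> assms(2) by (auto simp: block_le_def PiE_iff)
qed

context ultrametric_lcs
begin

lemma open_translated_submodule:
  fixes M :: "'e set"
  assumes "open M"
  shows "open {y. y - a \<in> M}"
proof -
  have "open ((\<lambda>y. y - a) -` M)"
    using assms by (intro open_vimage) (auto intro: continuous_intros)
  then show ?thesis by (simp add: vimage_def)
qed

text \<open>An open subgroup is closed, its complement being a union of open cosets.\<close>

lemma closed_open_submodule:
  fixes M :: "'e set"
  assumes "O_submodule smul M" "open M"
  shows "closed M"
proof -
  have "- M = (\<Union>a\<in>- M. {y. y - a \<in> M})"
  proof (intro equalityI subsetI)
    fix y assume "y \<in> (\<Union>a\<in>- M. {y. y - a \<in> M})"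
    then obtain a where a: "a \<notin> M" "y - a \<in> M" by auto
    show "y \<in> - M"
    proof
      assume "y \<in> M"
      from submodule_diff[OF assms(1) this a(2)] show False using a(1) by simp
    qed
  next
    fix y assume "y \<in> - M"
    then show "y \<in> (\<Union>a\<in>- M. {y. y - a \<in> M})"
      using submodule_zero[OF assms(1)] by (intro UN_I[of y]) auto
  qed
  then show ?thesis
    unfolding closed_def using open_translated_submodule[OF assms(2)] by (metis (no_types, lifting) open_UN)
qed

text \<open>K need not have compact neighbourhoods, so uniformity is obtained near K only: d bounds
  both the distance of the entries of y from K and that of y' from y. Both tuples are compared with
  one sample tuple over K.\<close>

lemma uniformly_continuous_tuples:
  assumes "finite I" "\<And>i. i \<in> I \<Longrightarrow> compact (K i)" "\<And>i. i \<in> I \<Longrightarrow> K i \<subseteq> factor V i"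
    and F: "continuous_on (mult_dom I V \<gamma>) F" and M: "O_submodule smul M" "open M"
  shows "\<exists>d>0. \<forall>y\<in>mult_dom I V \<gamma>. \<forall>y'\<in>mult_dom I V \<gamma>.
      (\<forall>i\<in>I. \<forall>k\<le>\<gamma> i. \<exists>z\<in>K i. absval (y i k - z) \<le> d) \<longrightarrow>
      near_tuples I \<gamma> d y y' \<longrightarrow> F y - F y' \<in> M"
proof -
  define C where "C = (\<Pi>\<^sub>E i\<in>I. \<Pi>\<^sub>E k\<in>{..\<gamma> i}. K i)"
  define \<Phi> where "\<Phi> z d \<longleftrightarrow> (\<forall>y\<in>mult_dom I V \<gamma>. near_tuples I \<gamma> d z y \<longrightarrow> F y - F z \<in> M)" for z d
  have C: "compact C" unfolding C_def using assms(2) by (intro compact_PiE_euclidean)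
  have C_sub: "C \<subseteq> mult_dom I V \<gamma>"
    unfolding C_def mult_dom_def using assms(3) by (intro PiE_mono) auto
  have "\<exists>d>0. \<Phi> z d" if z: "z \<in> C" for z
  proof -
    have zD: "z \<in> mult_dom I V \<gamma>" using z C_sub by auto
    have "open {v. v - F z \<in> M}" "F z \<in> {v. v - F z \<in> M}"
      using open_translated_submodule[OF M(2)] submodule_zero[OF M(1)] by auto
    from F[unfolded continuous_on_topological, rule_format, OF zD this]
    obtain A where A: "open A" "z \<in> A" "\<forall>y\<in>mult_dom I V \<gamma>. y \<in> A \<longrightarrow> F y - F z \<in> M"
      by auto
    obtain d where d: "0 < d" "\<And>y. y \<in> mult_dom I V \<gamma> \<Longrightarrow> near_tuples I \<gamma> d z y \<Longrightarrow> y \<in> A"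
      using open_contains_near_tuples[OF assms(1) A(1,2) zD] by blast
    then show ?thesis using A(3) unfolding \<Phi>_def by blast
  qed
  note radius = this
  have opn: "open {y. near_tuples I \<gamma> d z y} \<and> near_tuples I \<gamma> d z z" if "z \<in> C" "0 < d" for z d
    using that open_near_tuples[OF assms(1) that(2)] by simp
  obtain d where d: "0 < d" "\<forall>z\<in>C. \<exists>s\<in>C. \<exists>e\<ge>d. \<Phi> s e \<and> near_tuples I \<gamma> e s z"
    using compact_uniform_radius[where B = "near_tuples I \<gamma>" and \<Phi> = \<Phi>, OF C opn radius] by blast
  show ?thesis
  proof (intro exI[of _ d] conjI ballI impI, rule d(1))
    fix y y'
    assume y: "y \<in> mult_dom I V \<gamma>" "y' \<in> mult_dom I V \<gamma>"
      "\<forall>i\<in>I. \<forall>k\<le>\<gamma> i. \<exists>z\<in>K i. absval (y i k - z) \<le> d" "near_tuples I \<gamma> d y y'"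
    then obtain z where z: "\<And>i k. i \<in> I \<Longrightarrow> k \<le> \<gamma> i \<Longrightarrow> z i k \<in> K i \<and> absval (y i k - z i k) \<le> d"
      by metis
    define z' where "z' = (\<lambda>i\<in>I. \<lambda>k\<in>{..\<gamma> i}. z i k)"
    have "z' \<in> C" using z by (auto simp: C_def z'_def)
    then obtain s e where s: "s \<in> C" "d \<le> e" "\<Phi> s e" "near_tuples I \<gamma> e s z'" using d(2) by blast
    have "near_tuples I \<gamma> d z' y" using z by (auto simp: near_tuples_def near_def z'_def)
    then have "near_tuples I \<gamma> e s y" "near_tuples I \<gamma> e s y'"
      using s(2,4) y(4) near_tuples_trans near_tuples_mono by blast+
    then have "F y - F s \<in> M" "F y' - F s \<in> M" using s(3) y(1,2) by (auto simp: \<Phi>_def)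
    then have "(F y - F s) - (F y' - F s) \<in> M" by (rule submodule_diff[OF M(1)])
    then show "F y - F y' \<in> M" by simp
  qed
qed

text \<open>Supplies the stability hypothesis of \<open>block_interpolation_error\<close>. To use
  continuity in tuples, the node sets are enumerated: for sets in a common cell any enumerations are
  close, for equal sets the same one must be taken.\<close>

lemma set_dd_uniformly_continuous:
  fixes V :: "('i \<Rightarrow> 'k) set"
  assumes "finite I" "I = (\<Union>j<l. J j)" "\<And>i. i \<in> I \<Longrightarrow> compact (K i)" "\<And>i. i \<in> I \<Longrightarrow> K i \<subseteq> factor V i"
    and f: "\<And>\<gamma>. \<gamma> \<in> block_le J \<beta> l \<Longrightarrow> \<exists>g. is_div_diff_ext smul I V f \<gamma> g"
    and M: "O_submodule smul M" "open M"
  shows "\<exists>d>0. \<forall>p Y Y'. absval p \<le> d \<longrightarrow>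
      good_nodes I l J \<beta> (\<lambda>i. {t \<in> factor V i. \<exists>z\<in>K i. absval (t - z) \<le> d}) Y \<longrightarrow>
      good_nodes I l J \<beta> (\<lambda>i. {t \<in> factor V i. \<exists>z\<in>K i. absval (t - z) \<le> d}) Y' \<longrightarrow>
      (\<forall>i\<in>I. Y i = Y' i \<or> card (Y i) = card (Y' i) \<and> clustered p (Y i) (Y' i)) \<longrightarrow>
      set_dd smul I f Y - set_dd smul I f Y' \<in> M"
proof -
  define \<Phi> where "\<Phi> \<gamma> d \<longleftrightarrow> (\<forall>y\<in>mult_dom_distinct I V \<gamma>. \<forall>y'\<in>mult_dom_distinct I V \<gamma>.
      (\<forall>i\<in>I. \<forall>k\<le>\<gamma> i. \<exists>z\<in>K i. absval (y i k - z) \<le> d) \<longrightarrow> near_tuples I \<gamma> d y y' \<longrightarrow>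
      div_diff smul I f \<gamma> y - div_diff smul I f \<gamma> y' \<in> M)" for \<gamma> and d :: real
  have "\<exists>d>0. \<Phi> \<gamma> d" if \<gamma>: "\<gamma> \<in> block_le J \<beta> l" for \<gamma>
  proof -
    obtain g where g: "continuous_on (mult_dom I V \<gamma>) g"
        "\<forall>x\<in>mult_dom_distinct I V \<gamma>. g x = div_diff smul I f \<gamma> x"
      using f[OF \<gamma>] by (auto simp: is_div_diff_ext_def cont_maps_def)
    let ?unif = "\<lambda>d. \<forall>y\<in>mult_dom I V \<gamma>. \<forall>y'\<in>mult_dom I V \<gamma>.
      (\<forall>i\<in>I. \<forall>k\<le>\<gamma> i. \<exists>z\<in>K i. absval (y i k - z) \<le> d) \<longrightarrow>
      near_tuples I \<gamma> d y y' \<longrightarrow> g y - g y' \<in> M"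
    have "\<exists>d>0. ?unif d"
      using assms(1,3,4) g(1) M by (rule uniformly_continuous_tuples)
    then obtain d where d: "0 < d" "?unif d" by blast
    have "\<Phi> \<gamma> d"
      unfolding \<Phi>_def
    proof (intro ballI impI)
      fix y y' assume y: "y \<in> mult_dom_distinct I V \<gamma>" "y' \<in> mult_dom_distinct I V \<gamma>"
        "\<forall>i\<in>I. \<forall>k\<le>\<gamma> i. \<exists>z\<in>K i. absval (y i k - z) \<le> d" "near_tuples I \<gamma> d y y'"
      moreover have "y \<in> mult_dom I V \<gamma>" "y' \<in> mult_dom I V \<gamma>"
        using y(1,2) by (auto simp: mult_dom_distinct_def)
      ultimately have "g y - g y' \<in> M" using d(2)[rule_format, of y y'] by blast
      then show "div_diff smul I f \<gamma> y - div_diff smul I f \<gamma> y' \<in> M" using g(2) y(1,2) by simp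
    qed
    then show ?thesis using d(1) by blast
  qed
  \<comment> \<open>Only finitely many orders occur, so one radius serves them all.\<close>
  from finite_min_radius[where P = \<Phi>, OF finite_block_le[OF assms(1,2)] this]
  obtain d where d: "0 < d" "\<And>\<gamma>. \<gamma> \<in> block_le J \<beta> l \<Longrightarrow> \<exists>e\<ge>d. \<Phi> \<gamma> e"
    by metis
  show ?thesis
  proof (intro exI[of _ d] conjI allI impI, rule d(1))
    fix p Y Y'
    let ?G = "\<lambda>i. {t \<in> factor V i. \<exists>z\<in>K i. absval (t - z) \<le> d}"
    assume p: "absval p \<le> d" and Y: "good_nodes I l J \<beta> ?G Y" "good_nodes I l J \<beta> ?G Y'"
      and "\<forall>i\<in>I. Y i = Y' i \<or> card (Y i) = card (Y' i) \<and> clustered p (Y i) (Y' i)"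
    then have YY: "Y i = Y' i \<or> card (Y i) = card (Y' i) \<and> clustered p (Y i) (Y' i)" if "i \<in> I" for i
      using that by blast
    define \<gamma> where "\<gamma> = (\<lambda>i\<in>I. card (Y i) - 1)"
    have "sum \<gamma> (J j) = node_degree (J j) Y" if "j < l" for j
      unfolding node_degree_def using that assms(2) by (intro sum.cong) (auto simp: \<gamma>_def)
    then have "\<gamma> \<in> block_le J \<beta> l"
      using Y(1) assms(2) by (auto simp: block_le_def good_nodes_def \<gamma>_def simp del: restrict_apply)
    then obtain e where e: "d \<le> e" "\<Phi> \<gamma> e" using d(2) by blast
    \<comment> \<open>A function of the set alone, so \<open>Y i = Y' i\<close> yields identical
      tuples in coordinate i even if the set spreads over several cells.\<close>
    define enum where "enum A = (SOME h. bij_betw h {..<card A} A)" for A :: "'k set"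
    have enum: "bij_betw (enum A) {..<card A} A" if "finite A" for A
      using someI_ex[OF ex_bij_betw_nat_finite[OF that]] unfolding enum_def atLeast0LessThan .
    define tup where "tup Z = (\<lambda>i\<in>I. \<lambda>k\<in>{..\<gamma> i}. enum (Z i) k)" for Z :: "'i \<Rightarrow> 'k set"
    have tup: "tup Z \<in> mult_dom_distinct I V \<gamma>" "\<And>i. i \<in> I \<Longrightarrow> tup Z i ` {..\<gamma> i} = Z i"
      "div_diff smul I f \<gamma> (tup Z) = set_dd smul I f Z"
      if Z: "good_nodes I l J \<beta> ?G Z" "\<And>i. i \<in> I \<Longrightarrow> card (Z i) = card (Y i)" for Z
    proof -
      have Zi: "finite (Z i)" "Z i \<noteq> {}" "Z i \<subseteq> factor V i" if "i \<in> I" for i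
        using Z(1) that by (auto simp: good_nodes_def)
      have lt: "{..<card (Z i)} = {..\<gamma> i}" if "i \<in> I" for i
      proof -
        have "0 < card (Z i)" using Zi(1,2)[OF that] by (simp add: card_gt_0_iff)
        then have "card (Z i) = Suc (\<gamma> i)" using Z(2)[OF that] that by (simp add: \<gamma>_def)
        then show ?thesis by (simp add: lessThan_Suc_atMost)
      qed
      have b: "bij_betw (tup Z i) {..\<gamma> i} (Z i)" if i: "i \<in> I" for i
      proof -
        have "bij_betw (enum (Z i)) {..\<gamma> i} (Z i)" using enum[OF Zi(1)[OF i]] lt[OF i] by simp
        moreover have "tup Z i k = enum (Z i) k" if "k \<in> {..\<gamma> i}" for k
          using i that by (simp add: tup_def)
        ultimately show ?thesis by (subst bij_betw_cong)
      qed
      show img: "tup Z i ` {..\<gamma> i} = Z i" if "i \<in> I" for i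
        using b[OF that] by (rule bij_betw_imp_surj_on)
      have "tup Z \<in> mult_dom I V \<gamma>"
        unfolding mult_dom_def
      proof (intro PiE_I)
        fix i k assume "i \<in> I" "k \<in> {..\<gamma> i}"
        then show "tup Z i k \<in> factor V i" using img Zi(3) by blast
      qed (auto simp: tup_def)
      moreover have "tup Z i j \<noteq> tup Z i k" if "i \<in> I" "j < k" "k \<le> \<gamma> i" for i j k
        using b[OF that(1)] that by (auto simp: bij_betw_def dest!: inj_onD)
      ultimately show D: "tup Z \<in> mult_dom_distinct I V \<gamma>" by (auto simp: mult_dom_distinct_def)
      show "div_diff smul I f \<gamma> (tup Z) = set_dd smul I f Z"
        unfolding div_diff_eq_set_dd[OF assms(1) D] by (intro set_dd_cong) (auto simp: img)
    qed
    have cardY': "\<And>i. i \<in> I \<Longrightarrow> card (Y' i) = card (Y i)" using YY by metis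
    note T = tup(1)[OF Y(1) refl] tup(2)[OF Y(1) refl] tup(3)[OF Y(1) refl]
      tup(1)[OF Y(2) cardY', simplified] tup(2)[OF Y(2) cardY', simplified]
      tup(3)[OF Y(2) cardY', simplified]
    have "\<exists>z\<in>K i. absval (tup Y i k - z) \<le> e" if "i \<in> I" "k \<le> \<gamma> i" for i k
    proof -
      have "tup Y i k \<in> Y i" using T(2)[OF that(1)] that(2) by auto
      then show ?thesis using Y(1) that(1) e(1) by (force simp: good_nodes_def)
    qed
    moreover have "near_tuples I \<gamma> e (tup Y) (tup Y')"
      unfolding near_tuples_def near_def
    proof (intro ballI)
      fix i k assume i: "i \<in> I" and k: "k \<in> {..\<gamma> i}"
      show "absval (tup Y' i k - tup Y i k) \<le> e"
      proof (cases "Y i = Y' i")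
        case True
        then show ?thesis using i k d(1) e(1) by (simp add: tup_def)
      next
        case False
        then have "clustered p (Y i) (Y' i)" using YY[OF i] by auto
        moreover have "tup Y i k \<in> Y i" "tup Y' i k \<in> Y' i" using T(2,5)[OF i] k by auto
        ultimately have "absval (tup Y i k - tup Y' i k) \<le> absval p" by (auto simp: clustered_def)
        then show ?thesis using p e(1) absval_minus_commute[of "tup Y i k"] by simp
      qed
    qed
    ultimately have "div_diff smul I f \<gamma> (tup Y) - div_diff smul I f \<gamma> (tup Y') \<in> M"
      using e(2) T(1,4) unfolding \<Phi>_def by blast
    then show "set_dd smul I f Y - set_dd smul I f Y' \<in> M" by (simp only: T)
  qed
qed

text \<open>Since |p| \<le> d, the set \<open>G i\<close> of points within d of \<open>K i\<close>
  is a union of cells of the factor. Therefore extending the interpolant by 0 outside the box over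
  \<open>G\<close> keeps it locally polynomial.\<close>

lemma cartesian_approximation:
  fixes V :: "('i \<Rightarrow> 'k) set"
  assumes I: "finite I" "I \<noteq> {}" "I = (\<Union>j<l. J j)" and disj: "\<And>j k. j < k \<Longrightarrow> k < l \<Longrightarrow> J j \<inter> J k = {}"
    and V: "cartesian I V"
    and K: "\<And>i. i \<in> I \<Longrightarrow> compact (K i)" "\<And>i. i \<in> I \<Longrightarrow> K i \<subseteq> factor V i"
    and f: "\<And>\<gamma>. \<gamma> \<in> block_le J \<beta> l \<Longrightarrow> \<exists>g. is_div_diff_ext smul I V f \<gamma> g"
    and M: "O_submodule smul M" "open M"
  shows "\<exists>d g. 0 < d \<and>
    (\<forall>z\<in>V. \<exists>e>0. polynomial_on smul I (block_le J \<beta> l) {y \<in> V. near I e z y} g) \<and>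
    (\<forall>X. good_nodes I l J \<beta> (\<lambda>i. {t \<in> factor V i. \<exists>z\<in>K i. absval (t - z) \<le> d}) X \<longrightarrow>
      set_dd smul I (\<lambda>x. f x - g x) X \<in> M)"
proof -
  let ?unif = "\<lambda>d. \<forall>p Y Y'. absval p \<le> d \<longrightarrow>
      good_nodes I l J \<beta> (\<lambda>i. {t \<in> factor V i. \<exists>z\<in>K i. absval (t - z) \<le> d}) Y \<longrightarrow>
      good_nodes I l J \<beta> (\<lambda>i. {t \<in> factor V i. \<exists>z\<in>K i. absval (t - z) \<le> d}) Y' \<longrightarrow>
      (\<forall>i\<in>I. Y i = Y' i \<or> card (Y i) = card (Y' i) \<and> clustered p (Y i) (Y' i)) \<longrightarrow>
      set_dd smul I f Y - set_dd smul I f Y' \<in> M"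
  have "\<exists>d>0. ?unif d"
    using I(1,3) K f M by (rule set_dd_uniformly_continuous)
  then obtain d where d: "0 < d" "?unif d" by blast
  define G where "G i = {t \<in> factor V i. \<exists>z\<in>K i. absval (t - z) \<le> d}" for i
  obtain p :: 'k where p: "p \<noteq> 0" "absval p \<le> d" "absval p \<le> 1" using absval_small[OF d(1)] by blast
  have G_cell: "s \<in> G i" if "t \<in> G i" "s \<in> factor V i" "absval (s - t) \<le> absval p" for s t i
    using that p(2) absval_trans[of s t d] unfolding G_def by fastforce
  \<comment> \<open>As the factors have no isolated points, every cell has room for an injective
    sequence of centres.\<close>
  have "infinite {s \<in> G i. absval (s - t) \<le> absval p}" if "i \<in> I" "t \<in> G i" for i t
  proof -
    have "infinite {s \<in> factor V i. absval (s - t) \<le> absval p}"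
      using that cartesian_eq_PiE_factor(2)[OF I(2) V, of i t] p(1)
      by (intro infinite_near_non_isolated) (auto simp: G_def)
    moreover have "{s \<in> factor V i. absval (s - t) \<le> absval p} \<subseteq> {s \<in> G i. absval (s - t) \<le> absval p}"
      using G_cell[OF that(2)] by auto
    ultimately show ?thesis by (rule infinite_super[rotated])
  qed
  then obtain c where c: "centre_system p I G c" using centre_system_exists by blast
  let ?S = "block_le J \<beta> l"
  define g where "g x = (if x \<in> PiE I G then interpolate smul I I ?S c f x else 0)" for x
  have VG: "near I (absval p) z y \<Longrightarrow> y \<in> V \<Longrightarrow> z \<in> PiE I G \<Longrightarrow> y \<in> PiE I G" for y z
  proof -
    assume *: "near I (absval p) z y" "y \<in> V" "z \<in> PiE I G"
    have yV: "y \<in> PiE I (factor V)" using *(2) cartesian_eq_PiE_factor(1)[OF I(2) V] by simp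
    have "y i \<in> G i" if "i \<in> I" for i
      using G_cell[of "z i" i "y i"] * yV that by (auto simp: near_def PiE_iff)
    then show "y \<in> PiE I G" using yV by (auto simp: PiE_iff)
  qed
  show ?thesis
  proof (rule exI[of _ d], rule exI[of _ g], intro conjI ballI allI impI, rule d(1))
    fix z assume z: "z \<in> V"
    have "polynomial_on smul I ?S {y \<in> V. near I (absval p) z y} g"
    proof (cases "z \<in> PiE I G")
      case True
      show ?thesis
      proof (rule polynomial_on_newton[OF I(1) finite_block_le[OF I(1,3)]])
        show "(\<Pi>\<^sub>E i\<in>I. {..\<eta> i}) \<subseteq> ?S" if "\<eta> \<in> ?S" for \<eta>
          using block_le_downward[OF that I(3)] .
        fix y assume "y \<in> {y \<in> V. near I (absval p) z y}"
        then have y: "y \<in> PiE I G" "near I (absval p) z y" using VG True by blast+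
        have cy: "c i (y i) = c i (z i)" if "i \<in> I" for i
          using centre_systemD(4)[OF c that, of "z i" "y i"] y True that
          by (auto simp: near_def PiE_iff)
        have "g y = interpolate smul I I ?S c f y" using y(1) by (simp add: g_def)
        also have "\<dots> = (\<Sum>\<eta>\<in>?S. smul (\<Prod>i\<in>I. newton (c i (z i)) (\<eta> i) (y i))
            (set_dd smul I f (\<lambda>i. c i (z i) ` {..\<eta> i})))"
          unfolding interpolate_def
          by (intro sum.cong refl arg_cong2[of _ _ _ _ smul] prod.cong set_dd_cong) (auto simp: cy)
        finally show "g y = (\<Sum>\<eta>\<in>?S. smul (\<Prod>i\<in>I. newton (c i (z i)) (\<eta> i) (y i))
            (set_dd smul I f (\<lambda>i. c i (z i) ` {..\<eta> i})))" .
      qed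
    next
      case False
      have "g y = 0" if "y \<in> V" "near I (absval p) z y" for y
        using VG[of y z, OF near_sym[OF that(2)] z] False by (auto simp: g_def)
      then show ?thesis by (intro polynomial_on_sum[where F = "{}"]) auto
    qed
    then show "\<exists>e>0. polynomial_on smul I ?S {y \<in> V. near I e z y} g"
      using p(1) by (intro exI[of _ "absval p"]) simp
  next
    fix X assume "good_nodes I l J \<beta> (\<lambda>i. {t \<in> factor V i. \<exists>z\<in>K i. absval (t - z) \<le> d}) X"
    then have X: "good_nodes I l J \<beta> G X" by (simp add: G_def[abs_def])
    have "set_dd smul I (\<lambda>x. f x - interpolate smul I I ?S c f x) X \<in> M"
    proof (rule block_interpolation_error[OF I(1,3) disj M(1) p(1,3) c _ X])
      fix Y Y' assume "good_nodes I l J \<beta> G Y" "good_nodes I l J \<beta> G Y'"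
        "\<And>i. i \<in> I \<Longrightarrow> Y i = Y' i \<or> card (Y i) = card (Y' i) \<and> clustered p (Y i) (Y' i)"
      then show "set_dd smul I f Y - set_dd smul I f Y' \<in> M"
        unfolding G_def[abs_def] using d(2)[rule_format, OF p(2)] by blast
    qed
    moreover have "set_dd smul I (\<lambda>x. f x - interpolate smul I I ?S c f x) X =
        set_dd smul I (\<lambda>x. f x - g x) X"
    proof (intro set_dd_cong refl)
      fix x assume "x \<in> PiE I X"
      then have "x \<in> PiE I G" using X PiE_mono[of I X G] by (auto simp: good_nodes_def)
      then show "f x - interpolate smul I I ?S c f x = f x - g x" by (simp add: g_def)
    qed
    ultimately show "set_dd smul I (\<lambda>x. f x - g x) X \<in> M" by simp
  qed
qed

end

section \<open>Differentiability of locally polynomial functions\<close>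

text \<open>For exponent k and order g: the complete homogeneous symmetric polynomial of degree k -
  g in x 0, ..., x g, and 0 for k < g. This form of the divided difference of t^k makes sense for
  coinciding nodes.\<close>

fun complete_homogeneous :: "nat \<Rightarrow> nat \<Rightarrow> (nat \<Rightarrow> 'k::comm_ring_1) \<Rightarrow> 'k" where
  "complete_homogeneous 0 g x = (if g = 0 then 1 else 0)"
| "complete_homogeneous (Suc k) 0 x = x 0 * complete_homogeneous k 0 x"
| "complete_homogeneous (Suc k) (Suc g) x =
     x (Suc g) * complete_homogeneous k (Suc g) x + complete_homogeneous k g x"

text \<open>The Leibniz rule for t times t^k, with the last node split off, is the recursion
  defining \<open>complete_homogeneous\<close>.\<close>

lemma scalar_dd_power:
  assumes "inj_on x {..g}"
  shows "scalar_dd (\<lambda>t. t ^ k) (x ` {..g}) = complete_homogeneous k g x"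
  using assms
proof (induction k arbitrary: g)
  case 0
  show ?case
  proof (cases g)
    case (Suc n)
    then have "card (x ` {..g}) \<ge> 2" using 0 by (subst card_image) auto
    then show ?thesis using Suc by (simp add: scalar_dd_const)
  qed simp
next
  case (Suc k)
  show ?case
  proof (cases g)
    case 0
    then show ?thesis using Suc.IH[of 0] by simp
  next
    case (Suc n)
    have inj: "inj_on x {..n}" using Suc.prems Suc by (auto intro: inj_on_subset)
    have "x (Suc n) \<noteq> x j" if "j \<le> n" for j
      using inj_onD[OF Suc.prems, of "Suc n" j] Suc that by auto
    then have "x (Suc n) \<notin> x ` {..n}" by auto
    then have img: "x ` {..g} - {x (Suc n)} = x ` {..n}"
      using Suc by (auto simp: atMost_Suc)
    moreover have "x ` {..n} \<noteq> {}" by simp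
    ultimately have img_ne: "x ` {..g} \<noteq> {x (Suc n)}" by (metis Diff_cancel)
    have "scalar_dd (\<lambda>t. (t - 0) * t ^ k) (x ` {..g}) =
      (x (Suc n) - 0) * scalar_dd (\<lambda>t. t ^ k) (x ` {..g}) + scalar_dd (\<lambda>t. t ^ k) (x ` {..g} - {x (Suc n)})"
      using Suc img_ne by (intro scalar_dd_mult_linear) auto
    then show ?thesis
      using Suc.IH[OF Suc.prems] Suc.IH[OF inj] Suc img by simp
  qed
qed

lemma continuous_on_complete_homogeneous:
  fixes h :: "'a::topological_space \<Rightarrow> nat \<Rightarrow> 'k::ultrametric_field"
  assumes "\<And>j. continuous_on S (\<lambda>x. h x j)"
  shows "continuous_on S (\<lambda>x. complete_homogeneous k g (h x))"
proof (induction k arbitrary: g)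
  case (Suc k)
  then show ?case
    using assms by (cases g) (auto intro!: continuous_on_mult' continuous_on_add)
qed simp

lemma continuous_on_tuple_component:
  "continuous_on S (\<lambda>x :: 'i \<Rightarrow> nat \<Rightarrow> 'a::topological_space. x i k)"
  by (rule continuous_on_product_then_coordinatewise[OF
        continuous_on_product_then_coordinatewise[OF continuous_on_id]])

text \<open>Drops entry a in coordinate i and closes the gap, so the result is again indexed by an
  initial segment. Tuples replace node sets here because extensions are evaluated at coinciding
  entries as well.\<close>

definition remove_node :: "'i \<Rightarrow> nat \<Rightarrow> nat \<Rightarrow> ('i \<Rightarrow> nat \<Rightarrow> 'k) \<Rightarrow> 'i \<Rightarrow> nat \<Rightarrow> 'k" where
  "remove_node i g a x = x(i := \<lambda>k\<in>{..g}. x i (if k < a then k else Suc k))"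

lemma image_skip:
  assumes "a \<le> Suc g"
  shows "(\<lambda>k. if k < a then k else Suc k) ` {..g} = {..Suc g} - {a}"
proof (intro equalityI subsetI)
  fix k assume "k \<in> {..Suc g} - {a}"
  then show "k \<in> (\<lambda>k. if k < a then k else Suc k) ` {..g}"
    using assms by (intro image_eqI[of _ _ "if k < a then k else k - 1"]) auto
qed (use assms in \<open>auto split: if_splits\<close>)

lemma remove_node:
  assumes i: "i \<in> I" and g: "\<gamma> i = Suc g" and a: "a \<le> Suc g"
  shows "x \<in> mult_dom I V \<gamma> \<Longrightarrow> remove_node i g a x \<in> mult_dom I V (\<gamma>(i := g))"
    and "x \<in> mult_dom_distinct I V \<gamma> \<Longrightarrow> remove_node i g a x \<in> mult_dom_distinct I V (\<gamma>(i := g))"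
    and "x \<in> mult_dom_distinct I V \<gamma> \<Longrightarrow>
      remove_node i g a x i ` {..g} = x i ` {..Suc g} - {x i a}"
proof -
  let ?s = "\<lambda>k. if k < a then k else Suc k"
  show dom: "remove_node i g a x \<in> mult_dom I V (\<gamma>(i := g))" if x: "x \<in> mult_dom I V \<gamma>" for x
    unfolding mult_dom_def
  proof (rule PiE_I)
    fix j assume j: "j \<in> I"
    show "remove_node i g a x j \<in> (\<Pi>\<^sub>E k\<in>{..(\<gamma>(i := g)) j}. factor V j)"
      using x i j g by (cases "j = i") (auto simp: remove_node_def mult_dom_def PiE_iff)
  next
    fix j assume "j \<notin> I"
    then show "remove_node i g a x j = undefined"
      using x i by (auto simp: remove_node_def mult_dom_def PiE_def extensional_def)
  qed
  show "remove_node i g a x \<in> mult_dom_distinct I V (\<gamma>(i := g))" if x: "x \<in> mult_dom_distinct I V \<gamma>"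
    unfolding mult_dom_distinct_def
  proof (intro CollectI conjI ballI allI impI dom)
    show "x \<in> mult_dom I V \<gamma>" using x by (simp add: mult_dom_distinct_def)
    fix j k k' assume "j \<in> I" "k < k' \<and> k' \<le> (\<gamma>(i := g)) j"
    then show "remove_node i g a x j k \<noteq> remove_node i g a x j k'"
      using x g a by (cases "j = i") (auto simp: remove_node_def mult_dom_distinct_def)
  qed
  show "remove_node i g a x i ` {..g} = x i ` {..Suc g} - {x i a}" if x: "x \<in> mult_dom_distinct I V \<gamma>"
  proof -
    have "remove_node i g a x i ` {..g} = x i ` ({..Suc g} - {a})"
      unfolding image_skip[OF a, symmetric] image_image
      by (intro image_cong) (auto simp: remove_node_def)
    also have "\<dots> = x i ` {..Suc g} - {x i a}"
    proof -
      have "x i k \<noteq> x i a" if "k \<le> Suc g" "k \<noteq> a" for k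
        using x i g a that unfolding mult_dom_distinct_def
        by (cases k a rule: linorder_cases) (auto, metis)
      then show ?thesis by auto
    qed
    finally show ?thesis .
  qed
qed

lemma continuous_on_remove_node:
  "continuous_on S (remove_node i g a :: ('i \<Rightarrow> nat \<Rightarrow> 'a::topological_space) \<Rightarrow> _)"
proof (intro continuous_on_coordinatewise_then_product)
  fix j k
  show "continuous_on S (\<lambda>x :: 'i \<Rightarrow> nat \<Rightarrow> 'a. remove_node i g a x j k)"
  proof (cases "j = i")
    case True
    then show ?thesis
      by (cases "k \<le> g") (auto simp: remove_node_def intro: continuous_on_tuple_component)
  next
    case False
    then show ?thesis by (simp add: remove_node_def continuous_on_tuple_component)
  qed
qed

context ultrametric_lcs
begin

lemma set_dd_product_functions:
  assumes "finite I" "\<And>i. i \<in> I \<Longrightarrow> finite (X i)"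
  shows "set_dd smul I (\<lambda>x. \<Sum>\<eta>\<in>F. smul (\<Prod>i\<in>I. p \<eta> i (x i)) (b \<eta>)) X =
    (\<Sum>\<eta>\<in>F. smul (\<Prod>i\<in>I. scalar_dd (p \<eta> i) (X i)) (b \<eta>))"
proof -
  have "set_dd smul I (\<lambda>x. smul (\<Prod>i\<in>I. p \<eta> i (x i)) (b \<eta>)) X =
      smul (\<Prod>i\<in>I. scalar_dd (p \<eta> i) (X i)) (b \<eta>)" for \<eta>
    unfolding set_dd_def scalar_dd_def using assms
    by (subst prod_sum_PiE) (auto simp: scale_sum_left prod.distrib)
  then show ?thesis by (simp add: set_dd_sum)
qed

lemma continuous_on_smul:
  assumes "continuous_on S a" "continuous_on S b"
  shows "continuous_on S (\<lambda>x. smul (a x) (b x))"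
  using continuous_on_compose2[OF continuous_smul continuous_on_Pair[OF assms]] by auto

section \<open>Uniqueness and gluing of continuous extensions\<close>

lemma ext_dense:
  fixes V :: "('i \<Rightarrow> 'k) set"
  assumes "finite I" "I \<noteq> {}" "cartesian I V" "x \<in> mult_dom I V \<gamma>" "open W" "x \<in> W"
  obtains y where "y \<in> W" "y \<in> mult_dom_distinct I V \<gamma>" "y \<in> mult_dom I V \<gamma>"
proof -
  obtain d where d: "0 < d" "\<And>y. y \<in> mult_dom I V \<gamma> \<Longrightarrow> near_tuples I \<gamma> d x y \<Longrightarrow> y \<in> W"
    using open_contains_near_tuples[OF assms(1,5,6,4)] by blast
  obtain y where "y \<in> mult_dom_distinct I V \<gamma>" "near_tuples I \<gamma> d x y"
    using mult_dom_distinct_dense[OF cartesian_eq_PiE_factor(2)[OF assms(2,3)] assms(4) d(1)] by blast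
  then show thesis using d(2)[of y] that[of y] by (auto simp: mult_dom_distinct_def)
qed

text \<open>The sets W and W' make the density argument local: it yields uniqueness of extensions
  and agreement of local extensions on overlaps.\<close>

lemma ext_eq_on_open:
  fixes V :: "('i \<Rightarrow> 'k) set" and g g' :: "('i \<Rightarrow> nat \<Rightarrow> 'k) \<Rightarrow> 'e"
  assumes "finite I" "I \<noteq> {}" "cartesian I V" and "open W" "open W'" "x \<in> W" "x \<in> W'" "x \<in> mult_dom I V \<gamma>"
    and "continuous_on (mult_dom I V \<gamma> \<inter> W) g" "continuous_on (mult_dom I V \<gamma> \<inter> W') g'"
    and eq: "\<And>y. y \<in> mult_dom_distinct I V \<gamma> \<Longrightarrow> y \<in> W \<Longrightarrow> y \<in> W' \<Longrightarrow> g y = g' y"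
  shows "g x = g' x"
proof -
  let ?S = "mult_dom I V \<gamma> \<inter> W \<inter> W'"
  have "continuous_on ?S (\<lambda>y. g y - g' y)"
    using assms(9,10) by (intro continuous_on_diff) (auto elim: continuous_on_subset)
  then have "g x - g' x \<in> {0}"
  proof (rule continuous_on_closed_limit)
    fix A assume A: "open A" "x \<in> A"
    obtain y where "y \<in> A \<inter> W \<inter> W'" "y \<in> mult_dom_distinct I V \<gamma>" "y \<in> mult_dom I V \<gamma>"
      using ext_dense[OF assms(1-3,8), of "A \<inter> W \<inter> W'"] A assms(4-7) by blast
    then show "\<exists>y\<in>A \<inter> ?S. g y - g' y \<in> {0}" using eq[of y] by (intro bexI[of _ y]) auto
  qed (use assms in auto)
  then show ?thesis by simp
qed

lemma is_div_diff_ext_unique: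
  fixes V :: "('i \<Rightarrow> 'k) set"
  assumes "finite I" "I \<noteq> {}" "cartesian I V"
    and "is_div_diff_ext smul I V f \<gamma> g" "is_div_diff_ext smul I V f \<gamma> g'"
  shows "g = g'"
proof
  fix x
  show "g x = g' x"
  proof (cases "x \<in> mult_dom I V \<gamma>")
    case True
    show ?thesis
      by (rule ext_eq_on_open[OF assms(1-3) open_UNIV open_UNIV _ _ True])
        (use assms(4,5) in \<open>auto simp: is_div_diff_ext_def cont_maps_def\<close>)
  next
    case False
    then show ?thesis using assms(4,5)
      by (auto simp: is_div_diff_ext_def cont_maps_def PiE_def extensional_def)
  qed
qed

lemma div_diff_ext_is:
  fixes V :: "('i \<Rightarrow> 'k) set"
  assumes "finite I" "I \<noteq> {}" "cartesian I V" "\<exists>g. is_div_diff_ext smul I V f \<gamma> g"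
  shows "is_div_diff_ext smul I V f \<gamma> (div_diff_ext smul I V f \<gamma>)"
  unfolding div_diff_ext_def using assms(4) is_div_diff_ext_unique[OF assms(1-3)] by (metis theI)

text \<open>As V is a product, it contains all grid points of tuples over its factors. This allows
  passing between f and \<open>restrict f V\<close>.\<close>

lemma is_div_diff_ext_cong:
  assumes "\<And>x. x \<in> V \<Longrightarrow> f x = f' x" "V = PiE I (factor V)" "is_div_diff_ext smul I V f \<gamma> g"
  shows "is_div_diff_ext smul I V f' \<gamma> g"
proof -
  have "div_diff smul I f \<gamma> x = div_diff smul I f' \<gamma> x" if "x \<in> mult_dom I V \<gamma>" for x
    unfolding div_diff_def
  proof (intro sum.cong refl arg_cong2[of _ _ _ _ smul] assms(1))
    fix j assume j: "j \<in> (\<Pi>\<^sub>E i\<in>I. {..\<gamma> i})"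
    have "(\<lambda>i\<in>I. x i (j i)) \<in> PiE I (factor V)"
      using that j by (auto simp: mult_dom_def PiE_iff)
    then show "(\<lambda>i\<in>I. x i (j i)) \<in> V" using assms(2) by simp
  qed
  then show ?thesis using assms(3) by (auto simp: is_div_diff_ext_def mult_dom_distinct_def)
qed

text \<open>Local extensions agree on overlaps by density, so evaluating at each x the one chosen
  for x gives a continuous function.\<close>

lemma is_div_diff_ext_glue:
  fixes V :: "('i \<Rightarrow> 'k) set"
  assumes "finite I" "I \<noteq> {}" "cartesian I V"
    and loc: "\<And>x. x \<in> mult_dom I V \<gamma> \<Longrightarrow> \<exists>W G. open W \<and> x \<in> W \<and> continuous_on (mult_dom I V \<gamma> \<inter> W) G \<and>
      (\<forall>y\<in>mult_dom_distinct I V \<gamma> \<inter> W. G y = div_diff smul I f \<gamma> y)"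
  shows "\<exists>g. is_div_diff_ext smul I V f \<gamma> g"
proof -
  let ?D = "mult_dom I V \<gamma>"
  have "\<forall>x\<in>?D. \<exists>p. open (fst p) \<and> x \<in> fst p \<and> continuous_on (?D \<inter> fst p) (snd p) \<and>
      (\<forall>y\<in>mult_dom_distinct I V \<gamma> \<inter> fst p. snd p y = div_diff smul I f \<gamma> y)"
    using loc by simp
  then obtain P where P: "\<forall>x\<in>?D. open (fst (P x)) \<and> x \<in> fst (P x) \<and>
      continuous_on (?D \<inter> fst (P x)) (snd (P x)) \<and>
      (\<forall>y\<in>mult_dom_distinct I V \<gamma> \<inter> fst (P x). snd (P x) y = div_diff smul I f \<gamma> y)"
    unfolding bchoice_iff by blast
  define W where "W x = fst (P x)" for x
  define G where "G x = snd (P x)" for x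
  have W: "open (W x)" "x \<in> W x" "continuous_on (?D \<inter> W x) (G x)"
      "\<And>y. y \<in> mult_dom_distinct I V \<gamma> \<Longrightarrow> y \<in> W x \<Longrightarrow> G x y = div_diff smul I f \<gamma> y"
    if "x \<in> ?D" for x
    using P that by (auto simp: W_def G_def)
  define g where "g = (\<lambda>x\<in>?D. G x x)"
  have g: "g y = G x y" if "x \<in> ?D" "y \<in> ?D" "y \<in> W x" for x y
  proof -
    have "G y y = G x y"
      using W(1)[OF that(2)] W(1)[OF that(1)] W(2)[OF that(2)] that(3,2) W(3)[OF that(2)] W(3)[OF that(1)]
      by (rule ext_eq_on_open[OF assms(1-3)]) (use W(4) that in auto)
    then show ?thesis using that by (simp add: g_def)
  qed
  have "continuous_on ?D g"
    unfolding continuous_on_topological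
  proof (intro ballI allI impI)
    fix x B assume x: "x \<in> ?D" and B: "open B" "g x \<in> B"
    have xW: "x \<in> ?D \<inter> W x" using x W(2)[OF x] by simp
    have "G x x \<in> B" using B(2) g[OF x x W(2)[OF x]] by simp
    from W(3)[OF x, unfolded continuous_on_topological, rule_format, OF xW B(1) this]
    obtain A where A: "open A" "x \<in> A" "\<forall>y\<in>?D \<inter> W x. y \<in> A \<longrightarrow> G x y \<in> B" by auto
    show "\<exists>A. open A \<and> x \<in> A \<and> (\<forall>y\<in>?D. y \<in> A \<longrightarrow> g y \<in> B)"
    proof (intro exI[of _ "A \<inter> W x"] conjI ballI impI)
      fix y assume "y \<in> ?D" "y \<in> A \<inter> W x"
      then show "g y \<in> B" using A(3) g[OF x] by simp
    qed (use A W(1,2)[OF x] in auto)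
  qed
  moreover have "g y = div_diff smul I f \<gamma> y" if "y \<in> mult_dom_distinct I V \<gamma>" for y
  proof -
    have "y \<in> ?D" using that by (simp add: mult_dom_distinct_def)
    then show ?thesis using W(2,4)[of y] g[of y y] that by simp
  qed
  ultimately have "is_div_diff_ext smul I V f \<gamma> g"
    by (auto simp: is_div_diff_ext_def cont_maps_def g_def)
  then show ?thesis by blast
qed

text \<open>Induction on the total order. Near a tuple with two different entries in a coordinate,
  the recursion gives the extension from lower orders. Otherwise all grid points of nearby tuples
  are close to a single point, where f is one polynomial and \<open>complete_homogeneous\<close>
  gives the extension.\<close>

lemma locally_polynomial_div_diff_ext:
  fixes V :: "('i \<Rightarrow> 'k) set"
  assumes I: "finite I" "I \<noteq> {}" and V: "cartesian I V"
    and f: "\<And>z. z \<in> V \<Longrightarrow> \<exists>d>0. polynomial_on smul I N {y \<in> V. near I d z y} f"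
  shows "\<exists>g. is_div_diff_ext smul I V f \<gamma> g"
proof (induction "sum \<gamma> I" arbitrary: \<gamma> rule: less_induct)
  case less
  note V_eq = cartesian_eq_PiE_factor(1)[OF I(2) V]
  show ?case
  proof (rule is_div_diff_ext_glue[OF I V])
    fix x assume x: "x \<in> mult_dom I V \<gamma>"
    show "\<exists>W G. open W \<and> x \<in> W \<and> continuous_on (mult_dom I V \<gamma> \<inter> W) G \<and>
      (\<forall>y\<in>mult_dom_distinct I V \<gamma> \<inter> W. G y = div_diff smul I f \<gamma> y)"
    proof (cases "\<exists>i\<in>I. \<exists>a\<le>\<gamma> i. \<exists>b\<le>\<gamma> i. x i a \<noteq> x i b")
      case True
      then obtain i a b where i: "i \<in> I" and ab: "a \<le> \<gamma> i" "b \<le> \<gamma> i" "x i a \<noteq> x i b" by blast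
      then have "\<gamma> i \<noteq> 0" by (metis le_zero_eq)
      then obtain n where n: "\<gamma> i = Suc n" using not0_implies_Suc by blast
      let ?\<gamma> = "\<gamma>(i := n)"
      have "sum ?\<gamma> I < sum \<gamma> I"
        using I(1) i n by (intro sum_strict_mono_ex1) auto
      from less[OF this] obtain g where g: "is_div_diff_ext smul I V f ?\<gamma> g" by blast
      define W where "W = {y :: 'i \<Rightarrow> nat \<Rightarrow> 'k. y i a \<noteq> y i b}"
      define G where "G y = smul (inverse (y i a - y i b))
        (g (remove_node i n b y) - g (remove_node i n a y))" for y
      have "open W"
        unfolding W_def by (intro open_Collect_neq continuous_on_tuple_component)
      moreover have "x \<in> W" using ab by (simp add: W_def)
      moreover have "continuous_on (mult_dom I V \<gamma> \<inter> W) G"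
      proof -
        have rem: "continuous_on (mult_dom I V \<gamma> \<inter> W) (\<lambda>y. g (remove_node i n c y))" if "c \<le> Suc n" for c
        proof (rule continuous_on_compose2[OF _ continuous_on_remove_node])
          show "continuous_on (mult_dom I V ?\<gamma>) g"
            using g by (simp add: is_div_diff_ext_def cont_maps_def)
          show "remove_node i n c ` (mult_dom I V \<gamma> \<inter> W) \<subseteq> mult_dom I V ?\<gamma>"
            using remove_node(1)[where \<gamma> = \<gamma>, OF i n that] by auto
        qed
        show ?thesis
          unfolding G_def using ab n
          by (intro continuous_on_smul continuous_on_inverse_ultrametric continuous_on_diff rem
              continuous_on_tuple_component) (auto simp: W_def)
      qed
      moreover have "G y = div_diff smul I f \<gamma> y" if y: "y \<in> mult_dom_distinct I V \<gamma> \<inter> W" for y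
      proof -
        have yD: "y \<in> mult_dom_distinct I V \<gamma>" and ne: "y i a \<noteq> y i b" using y by (auto simp: W_def)
        let ?X = "\<lambda>i. y i ` {..\<gamma> i}"
        have rem: "g (remove_node i n c y) = set_dd smul I f (?X(i := ?X i - {y i c}))" if c: "c \<le> Suc n" for c
        proof -
          have D: "remove_node i n c y \<in> mult_dom_distinct I V ?\<gamma>"
            by (rule remove_node(2)[where \<gamma> = \<gamma>, OF i n c yD])
          then have "g (remove_node i n c y) = set_dd smul I f (\<lambda>j. remove_node i n c y j ` {..?\<gamma> j})"
            using g div_diff_eq_set_dd[OF I(1) D] by (simp add: is_div_diff_ext_def)
          also have "\<dots> = set_dd smul I f (?X(i := ?X i - {y i c}))"
          proof (intro set_dd_cong refl)
            fix j
            show "remove_node i n c y j ` {..?\<gamma> j} = (?X(i := ?X i - {y i c})) j"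
              using remove_node(3)[where \<gamma> = \<gamma>, OF i n c yD] n
              by (cases "j = i") (simp_all add: remove_node_def)
          qed
          finally show ?thesis .
        qed
        have "smul (y i a - y i b) (set_dd smul I f ?X) =
          g (remove_node i n b y) - g (remove_node i n a y)"
          using rem[of a] rem[of b] ab n I(1) i ne
          by (subst set_dd_diff[where i = i]) auto
        then have "G y = smul (inverse (y i a - y i b)) (smul (y i a - y i b) (set_dd smul I f ?X))"
          by (simp add: G_def)
        then show ?thesis
          using ne div_diff_eq_set_dd[OF I(1) yD, of smul f] by simp
      qed
      ultimately show ?thesis by blast
    next
      case False
      then have x_eq: "x i k = x i 0" if "i \<in> I" "k \<le> \<gamma> i" for i k using that by blast
      \<comment> \<open>All entries agree within each coordinate, so z is the only grid point of
        x.\<close>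
      define z where "z = (\<lambda>i\<in>I. x i 0)"
      have "z \<in> PiE I (factor V)" using x by (auto simp: z_def mult_dom_def PiE_iff)
      then have "z \<in> V" using V_eq by simp
      then obtain d where d: "0 < d" "polynomial_on smul I N {y \<in> V. near I d z y} f" using f by blast
      then obtain a where a: "\<And>y. y \<in> V \<Longrightarrow> near I d z y \<Longrightarrow>
          f y = (\<Sum>\<eta> | \<eta> \<in> N \<and> a \<eta> \<noteq> 0. smul (\<Prod>i\<in>I. y i ^ \<eta> i) (a \<eta>))"
        unfolding polynomial_on_def by blast
      define W where "W = {y. near_tuples I \<gamma> d x y}"
      define G where "G y = (\<Sum>\<eta> | \<eta> \<in> N \<and> a \<eta> \<noteq> 0.
          smul (\<Prod>i\<in>I. complete_homogeneous (\<eta> i) (\<gamma> i) (y i)) (a \<eta>))" for y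
      have "open W" unfolding W_def by (rule open_near_tuples[OF I(1) d(1)])
      moreover have "x \<in> W" using d(1) by (simp add: W_def)
      moreover have "continuous_on (mult_dom I V \<gamma> \<inter> W) G"
        unfolding G_def
        by (intro continuous_on_sum continuous_on_smul continuous_on_prod'
            continuous_on_complete_homogeneous continuous_on_tuple_component continuous_on_const)
      moreover have "G y = div_diff smul I f \<gamma> y" if y: "y \<in> mult_dom_distinct I V \<gamma> \<inter> W" for y
      proof -
        have yD: "y \<in> mult_dom_distinct I V \<gamma>" using y by simp
        have inj: "inj_on (y i) {..\<gamma> i}" if "i \<in> I" for i
        proof (rule linorder_inj_onI)
          fix j k assume "j < k" "j \<in> {..\<gamma> i}" "k \<in> {..\<gamma> i}"
          then show "y i j \<noteq> y i k" using yD that by (simp add: mult_dom_distinct_def)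
        qed auto
        have "div_diff smul I f \<gamma> y = set_dd smul I f (\<lambda>i. y i ` {..\<gamma> i})"
          by (rule div_diff_eq_set_dd[OF I(1) yD])
        also have "\<dots> = set_dd smul I (\<lambda>y. \<Sum>\<eta> | \<eta> \<in> N \<and> a \<eta> \<noteq> 0. smul (\<Prod>i\<in>I. y i ^ \<eta> i) (a \<eta>))
            (\<lambda>i. y i ` {..\<gamma> i})"
        proof (intro set_dd_cong refl a)
          fix q assume q: "q \<in> (\<Pi>\<^sub>E i\<in>I. y i ` {..\<gamma> i})"
          have "q i \<in> factor V i" if i: "i \<in> I" for i
          proof -
            obtain k where "k \<le> \<gamma> i" "q i = y i k" using q i by (auto simp: PiE_iff)
            moreover have "y \<in> mult_dom I V \<gamma>" using yD by (simp add: mult_dom_distinct_def)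
            ultimately show ?thesis using i by (auto simp: mult_dom_def PiE_iff)
          qed
          then have "q \<in> PiE I (factor V)" using q by (auto simp: PiE_iff)
          then show "q \<in> V" using V_eq by simp
          show "near I d z q"
            unfolding near_def
          proof
            fix i assume i: "i \<in> I"
            then obtain k where k: "k \<le> \<gamma> i" "q i = y i k" using q by (auto simp: PiE_iff)
            then have "absval (y i k - x i k) \<le> d"
              using y i by (auto simp: W_def near_tuples_def near_def)
            then show "absval (q i - z i) \<le> d" using k i x_eq[OF i k(1)] by (simp add: z_def)
          qed
        qed
        also have "\<dots> = G y"
          unfolding G_def using I(1) inj
          by (subst set_dd_product_functions) (auto simp: scalar_dd_power intro!: sum.cong)
        finally show ?thesis ..
      qed
      ultimately show ?thesis by blast
    qed
  qed
qed

end

section \<open>Approximation on locally cartesian sets\<close>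

lemma closed_near:
  assumes "0 \<le> d"
  shows "closed {y. near I d x y}"
proof -
  have "{y. near I d x y} = (\<Inter>i\<in>I. (\<lambda>y. y i) -` cball (x i) d)"
    by (auto simp: near_def mem_cball dist_absval absval_minus_commute[of "x _"])
  moreover have "closed ((\<lambda>y. y i) -` cball (x i) d)" for i
    by (rule closed_vimage[OF closed_cball]) simp
  ultimately show ?thesis by (auto simp only: intro!: closed_INT)
qed

lemma polynomial_on_subset:
  assumes "polynomial_on smul I N V p" "W \<subseteq> V" "\<And>x. x \<in> W \<Longrightarrow> q x = p x"
  shows "polynomial_on smul I N W q"
proof -
  obtain a where a: "finite {\<eta> \<in> N. a \<eta> \<noteq> 0}"
      "\<And>x. x \<in> V \<Longrightarrow> p x = (\<Sum>\<eta> | \<eta> \<in> N \<and> a \<eta> \<noteq> 0. smul (\<Prod>i\<in>I. x i ^ \<eta> i) (a \<eta>))"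
    using assms(1) unfolding polynomial_on_def by blast
  have "q x = (\<Sum>\<eta> | \<eta> \<in> N \<and> a \<eta> \<noteq> 0. smul (\<Prod>i\<in>I. x i ^ \<eta> i) (a \<eta>))" if "x \<in> W" for x
    using a(2) assms(2,3) that by (simp add: subset_iff)
  then show ?thesis unfolding polynomial_on_def using a(1) by blast
qed

text \<open>The balls are open in the field, so a limit point of a factor lying in the ball is still
  a limit point of the intersection.\<close>

lemma cartesian_near_ball:
  fixes V :: "('i \<Rightarrow> 'k::ultrametric_field) set"
  assumes "I \<noteq> {}" "cartesian I V" "0 < d"
  shows "cartesian I {y \<in> V. near I d z y}"
  unfolding cartesian_def
proof (intro exI[of _ "\<lambda>i. {t \<in> factor V i. absval (t - z i) \<le> d}"] conjI ballI)
  have V: "V = PiE I (factor V)" by (rule cartesian_eq_PiE_factor(1)[OF assms(1,2)])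
  show "{y \<in> V. near I d z y} = (\<Pi>\<^sub>E i\<in>I. {t \<in> factor V i. absval (t - z i) \<le> d})"
    by (subst V) (auto simp: near_def PiE_iff extensional_def)
  fix i t assume i: "i \<in> I" and t: "t \<in> {t \<in> factor V i. absval (t - z i) \<le> d}"
  then have "t islimpt factor V i"
    using cartesian_eq_PiE_factor(2)[OF assms(1,2) i, of t] by (simp add: isolated_in_islimpt_iff)
  then have "t islimpt factor V i \<inter> {t. absval (t - z i) \<le> d}"
    using t open_absval_ball[OF assms(3), of "z i"]
    by (intro islimpt_Int_eventually) (auto simp: eventually_at_topological)
  moreover have "factor V i \<inter> {t. absval (t - z i) \<le> d} = {t \<in> factor V i. absval (t - z i) \<le> d}" by auto
  ultimately show "\<not> t isolated_in {t \<in> factor V i. absval (t - z i) \<le> d}"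
    by (simp add: isolated_in_islimpt_iff)
qed

lemma openin_near:
  assumes "finite I" "0 < d"
  shows "openin (top_of_set U) {y \<in> U. near I d z y}"
proof -
  have "{y \<in> U. near I d z y} = U \<inter> {y. near I d z y}" by auto
  then show ?thesis using openin_open_Int[OF open_near[OF assms]] by simp
qed

lemma openin_contains_near:
  fixes U :: "('i \<Rightarrow> 'k::ultrametric_field) set"
  assumes "finite I" "openin (top_of_set U) V" "z \<in> V" "U \<subseteq> coord_space I"
  shows "\<exists>d>0. \<forall>y\<in>U. near I d z y \<longrightarrow> y \<in> V"
proof -
  obtain W where W: "open W" "V = U \<inter> W" using assms(2) by (auto simp: openin_open)
  have ext: "U \<subseteq> extensional I" using assms(4) by (auto simp: coord_space_def PiE_def)
  obtain d where "0 < d" "\<And>y. y \<in> extensional I \<Longrightarrow> near I d z y \<Longrightarrow> y \<in> W"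
    by (rule open_contains_near[OF assms(1) W(1), of z]) (use assms(3) W(2) ext in auto)
  then show ?thesis using W(2) ext by blast
qed

context ultrametric_lcs
begin

lemma scaled_submodule:
  fixes M :: "'e set"
  assumes "O_submodule smul M" "open M"
  shows "O_submodule smul {v. smul c v \<in> M}" "open {v. smul c v \<in> M}"
proof -
  show "O_submodule smul {v. smul c v \<in> M}"
    unfolding O_submodule_def
  proof (intro conjI ballI allI impI)
    fix x y assume "x \<in> {v. smul c v \<in> M}" "y \<in> {v. smul c v \<in> M}"
    then show "x + y \<in> {v. smul c v \<in> M}"
      by (simp add: scale_right_distrib submodule_add[OF assms(1)])
  next
    fix a :: 'k and x assume "x \<in> {v. smul c v \<in> M}" "absval a \<le> 1"
    then have "smul a (smul c x) \<in> M" by (simp add: submodule_scale[OF assms(1)] del: scale_scale)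
    then show "smul a x \<in> {v. smul c v \<in> M}" by (simp add: mult.commute)
  qed (simp add: submodule_zero[OF assms(1)])
  have "open ((\<lambda>v. smul c v) -` M)"
    using assms(2) by (intro open_vimage continuous_on_smul continuous_on_const continuous_on_id)
  then show "open {v. smul c v \<in> M}" by (simp add: vimage_def)
qed

text \<open>D lists the orders, cartesian open sets and compact sets of tuples that describe one
  neighbourhood. A single g has to serve all of them although the sets V may overlap; hence the
  balls are chosen small compared with every V.\<close>

lemma global_approximation:
  fixes U :: "('i \<Rightarrow> 'k) set"
  assumes I: "finite I" "I \<noteq> {}" "I = (\<Union>j<l. J j)" and disj: "\<And>j k. j < k \<Longrightarrow> k < l \<Longrightarrow> J j \<inter> J k = {}"
    and U: "U \<subseteq> coord_space I" and M: "O_submodule smul M" "open M"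
    and D: "finite D" "\<And>\<gamma> V C. (\<gamma>, V, C) \<in> D \<Longrightarrow> \<gamma> \<in> block_le J \<beta> l \<and>
      V \<in> cartesian_open_subsets I U \<and> C \<subseteq> mult_dom I V \<gamma> \<and> compact C"
    and f: "\<And>\<gamma> V. \<gamma> \<in> block_le J \<beta> l \<Longrightarrow> V \<in> cartesian_open_subsets I U \<Longrightarrow>
      \<exists>g. is_div_diff_ext smul I V f \<gamma> g"
  shows "\<exists>g. (\<forall>z\<in>U. \<exists>e>0. polynomial_on smul I (block_le J \<beta> l) {y \<in> U. near I e z y} g) \<and>
    (\<forall>\<gamma> V C. (\<gamma>, V, C) \<in> D \<longrightarrow> (\<forall>x\<in>C. \<exists>e>0. \<forall>y\<in>mult_dom_distinct I V \<gamma>.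
      near_tuples I \<gamma> e x y \<longrightarrow> set_dd smul I (\<lambda>x. f x - g x) (\<lambda>i. y i ` {..\<gamma> i}) \<in> M))"
proof -
  let ?S = "block_le J \<beta> l"
  \<comment> \<open>Divided differences on C read f at mixed grid points. All of these lie in this
    compact box, which is still contained in V.\<close>
  define P where "P d = (\<Pi>\<^sub>E i\<in>I. \<Union>k\<le>fst d i. (\<lambda>x. x i k) ` snd (snd d))"
    for d :: "('i \<Rightarrow> nat) \<times> ('i \<Rightarrow> 'k) set \<times> ('i \<Rightarrow> nat \<Rightarrow> 'k) set"
  define K where "K = (\<Union>d\<in>D. P d)"
  have V_eq: "V = PiE I (factor V)" and VU: "V \<subseteq> U" if "(\<gamma>, V, C) \<in> D" for \<gamma> V C
  proof -
    have "openin (top_of_set U) V" "cartesian I V"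
      using D(2)[OF that] by (auto simp: cartesian_open_subsets_def)
    then show "V = PiE I (factor V)" "V \<subseteq> U"
      using cartesian_eq_PiE_factor(1)[OF I(2)] openin_imp_subset by blast+
  qed
  have P: "compact (P d)" "P d \<subseteq> fst (snd d)" if d: "d \<in> D" for d
  proof -
    obtain \<gamma> V C where [simp]: "d = (\<gamma>, V, C)" by (cases d) auto
    have C: "compact C" "C \<subseteq> mult_dom I V \<gamma>" using D(2) d by auto
    show "compact (P d)"
      unfolding P_def using C(1)
      by (intro compact_PiE_euclidean compact_UN compact_continuous_image continuous_on_tuple_component) auto
    have "(\<Union>k\<le>\<gamma> i. (\<lambda>x. x i k) ` C) \<subseteq> factor V i" if "i \<in> I" for i
      using C(2) that by (auto simp: mult_dom_def PiE_iff subset_iff)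
    then have "P d \<subseteq> PiE I (factor V)" unfolding P_def by (intro PiE_mono) auto
    then show "P d \<subseteq> fst (snd d)" using V_eq d by simp
  qed
  have K: "compact K" unfolding K_def using D(1) P(1) by (intro compact_UN)
  have KU: "K \<subseteq> U" unfolding K_def using P(2) VU by fastforce
  have "\<exists>r>0. \<forall>z\<in>P d. \<forall>y\<in>U. near I r z y \<longrightarrow> y \<in> fst (snd d)" if d: "d \<in> D" for d
  proof -
    have opn: "openin (top_of_set U) (fst (snd d))"
      using D(2)[of "fst d" "fst (snd d)" "snd (snd d)"] d by (auto simp: cartesian_open_subsets_def)
    let ?unif = "\<lambda>r. \<forall>z\<in>P d. \<exists>s\<in>P d. \<exists>e\<ge>r. (\<forall>y\<in>U. near I e s y \<longrightarrow> y \<in> fst (snd d)) \<and> near I e s z"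
    have "\<exists>r>0. ?unif r"
    proof (rule compact_uniform_radius[OF P(1)[OF d]])
      show "open {y. near I e z y} \<and> near I e z z" if "0 < e" for z :: "'i \<Rightarrow> 'k" and e
        using that open_near[OF I(1) that] by simp
      show "\<exists>e>0. \<forall>y\<in>U. near I e z y \<longrightarrow> y \<in> fst (snd d)" if "z \<in> P d" for z
        using openin_contains_near[OF I(1) opn _ U] P(2)[OF d] that by blast
    qed
    then obtain r where r: "0 < r" "?unif r" by blast
    have "y \<in> fst (snd d)" if "z \<in> P d" "y \<in> U" "near I r z y" for z y
    proof -
      obtain s e where "r \<le> e" "\<forall>y\<in>U. near I e s y \<longrightarrow> y \<in> fst (snd d)" "near I e s z"
        using r(2) \<open>z \<in> P d\<close> by blast
      then show ?thesis using that near_trans near_mono by blast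
    qed
    then show ?thesis using r(1) by blast
  qed
  \<comment> \<open>Within r0 of a box, points of U stay in the corresponding V; a smaller ball in U
    is thus a ball in V and hence cartesian.\<close>
  then obtain r0 where r0: "0 < r0"
      "\<And>d. d \<in> D \<Longrightarrow> \<exists>e\<ge>r0. \<forall>z\<in>P d. \<forall>y\<in>U. near I e z y \<longrightarrow> y \<in> fst (snd d)"
    using finite_min_radius[OF D(1),
        of "\<lambda>d e. \<forall>z\<in>P d. \<forall>y\<in>U. near I e z y \<longrightarrow> y \<in> fst (snd d)"] by blast
  obtain p :: 'k where p: "p \<noteq> 0" "absval p \<le> r0" "absval p \<le> 1" using absval_small[OF r0(1)] by blast
  define r where "r = absval p"
  have r: "0 < r" using p(1) by (simp add: r_def)
  have inV: "y \<in> fst (snd d)" if d: "d \<in> D" and z: "z \<in> P d" and y: "y \<in> U" "near I r z y" for d z y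
  proof -
    obtain e where e: "r0 \<le> e" "\<forall>z\<in>P d. \<forall>y\<in>U. near I e z y \<longrightarrow> y \<in> fst (snd d)"
      using r0(2)[OF d] by blast
    then have "near I e z y" using near_mono[OF y(2)] p(2) by (simp add: r_def)
    then show ?thesis using e(2) z y(1) by blast
  qed
  define Q where "Q z = {y \<in> U. near I r z y}" for z
  have Q: "Q z \<in> cartesian_open_subsets I U" if z: "z \<in> K" for z
  proof -
    obtain d where d: "d \<in> D" "z \<in> P d" using z by (auto simp: K_def)
    obtain \<gamma> V C where [simp]: "d = (\<gamma>, V, C)" by (cases d) auto
    have "Q z = {y \<in> V. near I r z y}"
      using inV[OF d] VU[of \<gamma> V C] d(1) by (auto simp: Q_def)
    moreover have "cartesian I V" using D(2) d(1) by (auto simp: cartesian_open_subsets_def)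
    ultimately have "cartesian I (Q z)" using cartesian_near_ball[OF I(2) _ r] by metis
    then show ?thesis
      unfolding cartesian_open_subsets_def Q_def using openin_near[OF I(1) r] by blast
  qed
  define m where "m = (\<Sum>j<l. \<beta> j)"
  \<comment> \<open>This is p^m M. It provides the weight \<open>inverse p ^ (m - order)\<close>
    demanded by \<open>cluster_reduction\<close>, whatever the order of the clustered
    family.\<close>
  let ?M = "{v. smul (inverse p ^ m) v \<in> M}"
  \<comment> \<open>A tolerance and an approximation of f on the ball \<open>Q z\<close>, valid for
    nodes near the part of K in that ball.\<close>
  define fits where "fits z q \<longleftrightarrow> 0 < fst q \<and>
      (\<forall>w\<in>Q z. \<exists>e>0. polynomial_on smul I ?S {y \<in> Q z. near I e w y} (snd q)) \<and>
      (\<forall>X. good_nodes I l J \<beta> (\<lambda>i. {t \<in> factor (Q z) i. \<exists>s\<in>(\<lambda>x. x i) ` (K \<inter> Q z). absval (t - s) \<le> fst q}) X \<longrightarrow>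
        set_dd smul I (\<lambda>x. f x - snd q x) X \<in> ?M)" for z and q :: "real \<times> (('i \<Rightarrow> 'k) \<Rightarrow> 'e)"
  have "\<exists>q. fits z q" if z: "z \<in> K" for z
  proof -
    have cart: "cartesian I (Q z)" using Q[OF z] by (simp add: cartesian_open_subsets_def)
    have "K \<inter> Q z = K \<inter> {y. near I r z y}" using KU by (auto simp: Q_def)
    then have "compact (K \<inter> Q z)" using K closed_near[of r I z] r by (simp add: compact_Int_closed)
    then have cpt: "compact ((\<lambda>x. x i) ` (K \<inter> Q z))" for i
      by (rule compact_continuous_image[OF continuous_on_product_then_coordinatewise[OF continuous_on_id]])
    have sub: "(\<lambda>x. x i) ` (K \<inter> Q z) \<subseteq> factor (Q z) i" for i by (auto simp: factor_def)
    show ?thesis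
      using cartesian_approximation[where V = "Q z" and K = "\<lambda>i. (\<lambda>x. x i) ` (K \<inter> Q z)" and l = l and J = J,
          OF I disj cart cpt sub f[OF _ Q[OF z]] scaled_submodule[OF M]]
      by (simp add: fits_def split_paired_Ex)
  qed
  then obtain q where fits: "\<And>z. z \<in> K \<Longrightarrow> fits z (q z)" by metis
  note q = fits[unfolded fits_def]
  \<comment> \<open>The condition on z is the same for all points x of a ball, so \<open>rep\<close>
    is constant on balls and g is one approximant on each of them.\<close>
  define rep where "rep x = (SOME z. z \<in> K \<and> near I r z x)" for x
  have rep: "rep x \<in> K" "near I r (rep x) x" if "z \<in> K" "near I r z x" for x z
    using someI[of "\<lambda>z. z \<in> K \<and> near I r z x" z] that by (auto simp: rep_def)
  have rep_cong: "rep x = rep y" if "near I r x y" for x y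
  proof -
    have "near I r z x \<longleftrightarrow> near I r z y" for z
      using that near_trans near_sym by blast
    then show ?thesis by (simp add: rep_def)
  qed
  define g where "g x = (if \<exists>z\<in>K. near I r z x then snd (q (rep x)) x else 0)" for x
  have g: "g y = snd (q (rep x)) y" if "z \<in> K" "near I r z x" "near I r x y" for x y z
  proof -
    have "near I r z y" using that near_trans by blast
    then show ?thesis using that(1) rep_cong[OF that(3)] by (auto simp: g_def)
  qed
  have "\<exists>e>0. polynomial_on smul I ?S {y \<in> U. near I e z y} g" if z: "z \<in> U" for z
  proof (cases "\<exists>w\<in>K. near I r w z")
    case True
    then obtain w where w: "w \<in> K" "near I r w z" by blast
    have "z \<in> Q (rep z)" using rep(2)[OF w] z by (simp add: Q_def)
    then obtain e where e: "0 < e" "polynomial_on smul I ?S {y \<in> Q (rep z). near I e z y} (snd (q (rep z)))"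
      using q rep(1)[OF w] by blast
    have "polynomial_on smul I ?S {y \<in> U. near I (min e r) z y} g"
    proof (rule polynomial_on_subset[OF e(2)])
      fix y assume y: "y \<in> {y \<in> U. near I (min e r) z y}"
      then have "near I r z y" using near_mono[of I "min e r" z y r] by simp
      then show "g y = snd (q (rep z)) y" by (rule g[OF w])
    next
      show "{y \<in> U. near I (min e r) z y} \<subseteq> {y \<in> Q (rep z). near I e z y}"
      proof
        fix y assume y: "y \<in> {y \<in> U. near I (min e r) z y}"
        then have "near I r z y" "near I e z y"
          using near_mono[of I "min e r" z y r] near_mono[of I "min e r" z y e] by simp_all
        then show "y \<in> {y \<in> Q (rep z). near I e z y}"
          using y near_trans[OF rep(2)[OF w]] by (simp add: Q_def)
      qed
    qed
    then show ?thesis using e(1) r by (intro exI[of _ "min e r"]) simp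
  next
    case False
    have "g y = 0" if "near I r z y" for y
      using False near_trans[OF _ near_sym[OF that]] by (auto simp: g_def)
    then have "polynomial_on smul I ?S {y \<in> U. near I r z y} g"
      by (intro polynomial_on_sum[where F = "{}"]) auto
    then show ?thesis using r by blast
  qed
  moreover have "\<exists>e>0. \<forall>y\<in>mult_dom_distinct I V \<gamma>. near_tuples I \<gamma> e x y \<longrightarrow>
      set_dd smul I (\<lambda>x. f x - g x) (\<lambda>i. y i ` {..\<gamma> i}) \<in> M"
    if d: "(\<gamma>, V, C) \<in> D" and x: "x \<in> C" for \<gamma> V C x
  proof -
    \<comment> \<open>The grid points of x are finite in number, so e can be taken below the
      tolerances of all balls they meet.\<close>
    define E where "E = (\<Pi>\<^sub>E i\<in>I. x i ` {..\<gamma> i})"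
    have finE: "finite E" unfolding E_def using I(1) by (intro finite_PiE) auto
    have "E \<subseteq> P (\<gamma>, V, C)" unfolding E_def P_def using x by (intro PiE_mono) auto
    then have EK: "E \<subseteq> K" using d by (auto simp: K_def)
    have "\<exists>e>0. e = fst (q (rep z))" if "z \<in> E" for z
      using q rep(1)[of z z] EK that r by auto
    then obtain e0 where e0: "0 < e0" "\<And>z. z \<in> E \<Longrightarrow> \<exists>e\<ge>e0. e = fst (q (rep z))"
      using finite_min_radius[OF finE, of "\<lambda>z e. e = fst (q (rep z))"] by blast
    define e where "e = min e0 r"
    have e: "0 < e" "e \<le> r" "\<And>z. z \<in> E \<Longrightarrow> e \<le> fst (q (rep z))"
      using e0 r by (auto simp: e_def min.coboundedI1)
    have \<gamma>: "sum \<gamma> (J j) \<le> \<beta> j" if "j < l" for j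
      using D(2)[OF d] that by (auto simp: block_le_def)
    have "set_dd smul I (\<lambda>x. f x - g x) (\<lambda>i. y i ` {..\<gamma> i}) \<in> M"
      if y: "y \<in> mult_dom_distinct I V \<gamma>" and xy: "near_tuples I \<gamma> e x y" for y
    proof -
      let ?h = "\<lambda>x. f x - g x" and ?X = "\<lambda>i. y i ` {..\<gamma> i}"
      have card_le: "card (?X i) - 1 \<le> \<gamma> i" for i
        using card_image_le[of "{..\<gamma> i}" "y i"] by simp
      have deg_le: "node_degree I ?X \<le> m"
      proof -
        have "node_degree I ?X \<le> sum \<gamma> I" unfolding node_degree_def by (intro sum_mono card_le)
        also have "\<dots> = (\<Sum>j<l. sum \<gamma> (J j))"
          unfolding I(3) using I(1,3) disj
          by (intro sum.UNION_disjoint) (auto intro: finite_subset[of _ I], metis disjoint_iff nat_neq_iff)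
        also have "\<dots> \<le> m" unfolding m_def by (intro sum_mono \<gamma>) simp
        finally show ?thesis .
      qed
      have yV: "y i k \<in> factor V i" if "i \<in> I" "k \<le> \<gamma> i" for i k
        using y that by (auto simp: mult_dom_distinct_def mult_dom_def PiE_iff)
      have xy': "absval (y i k - x i k) \<le> e" if "i \<in> I" "k \<le> \<gamma> i" for i k
        using xy that by (auto simp: near_tuples_def near_def)
      have "smul (inverse p ^ (m - node_degree I ?X)) (set_dd smul I ?h ?X) \<in> M"
      proof (rule cluster_reduction[OF I(1) subset_refl M(1) p(1)])
        fix Y assume Y: "\<And>i. i \<in> I \<Longrightarrow> Y i \<subseteq> ?X i" "\<And>i. i \<in> I \<Longrightarrow> Y i \<noteq> {}"
          "\<And>i. i \<in> I \<Longrightarrow> clustered p (Y i) (Y i)"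
        \<comment> \<open>One entry of y is picked in each \<open>Y i\<close>. The corresponding
          grid point z of x determines the ball that contains the whole clustered family.\<close>
        have "\<forall>i\<in>I. \<exists>k\<le>\<gamma> i. y i k \<in> Y i" using Y(1,2) by blast
        then obtain k where k: "\<And>i. i \<in> I \<Longrightarrow> k i \<le> \<gamma> i \<and> y i (k i) \<in> Y i"
          unfolding bchoice_iff by blast
        define z where "z = (\<lambda>i\<in>I. x i (k i))"
        have zE: "z \<in> E" using k by (auto simp: E_def z_def)
        have zK: "z \<in> K" using zE EK by auto
        have near_z: "absval (t - z i) \<le> r" if "i \<in> I" "t \<in> Y i" for i t
        proof -
          have "absval (t - y i (k i)) \<le> r"
            using Y(3)[OF that(1)] k[OF that(1)] that by (auto simp: clustered_def r_def)
          moreover have "absval (y i (k i) - z i) \<le> r"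
            using xy'[OF that(1), of "k i"] k[OF that(1)] e(2) that(1) by (simp add: z_def)
          ultimately show ?thesis by (rule absval_trans)
        qed
        have zz: "near I r z z" using r by simp
        have rz: "rep z \<in> K" "near I r (rep z) z" using rep[OF zK zz] by auto
        have in_Q: "u \<in> Q (rep z)" "near I r z u" if u: "u \<in> PiE I Y" for u
        proof -
          have "u i \<in> factor V i" if i: "i \<in> I" for i
          proof -
            have "u i \<in> ?X i" using u Y(1)[OF i] i by (auto simp: PiE_iff)
            then show ?thesis using yV[OF i] by auto
          qed
          then have "u \<in> PiE I (factor V)" using u by (auto simp: PiE_iff)
          then have "u \<in> U" using V_eq[OF d] VU[OF d] by auto
          moreover show "near I r z u" using near_z u by (auto simp: near_def PiE_iff)
          ultimately show "u \<in> Q (rep z)" using near_trans[OF rz(2)] by (auto simp: Q_def)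
        qed
        have "good_nodes I l J \<beta> (\<lambda>i. {t \<in> factor (Q (rep z)) i.
            \<exists>s\<in>(\<lambda>x. x i) ` (K \<inter> Q (rep z)). absval (t - s) \<le> fst (q (rep z))}) Y"
          unfolding good_nodes_def
        proof (intro conjI ballI allI impI subsetI)
          fix i assume i: "i \<in> I"
          show "finite (Y i)" "Y i \<noteq> {}" using finite_subset[OF Y(1)[OF i]] Y(2)[OF i] by auto
          fix t assume t: "t \<in> Y i"
          then obtain k' where k': "k' \<le> \<gamma> i" "t = y i k'" using Y(1)[OF i] by auto
          \<comment> \<open>To exhibit t as a coordinate of a point of the ball, the other
            coordinates are filled with the picked entries of y.\<close>
          let ?u = "\<lambda>j\<in>I. if j = i then t else y j (k j)"
          have "?u \<in> PiE I Y" using t k by auto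
          then have "?u \<in> Q (rep z)" by (rule in_Q)
          then have "t \<in> factor (Q (rep z)) i" unfolding factor_def by (rule image_eqI[rotated]) (use i in simp)
          moreover have "\<exists>s\<in>(\<lambda>x. x i) ` (K \<inter> Q (rep z)). absval (t - s) \<le> fst (q (rep z))"
          proof (rule bexI)
            \<comment> \<open>The same point with entries of x in place of those of y: it lies in K,
              and its coordinate i is within e of t.\<close>
            let ?v = "\<lambda>j\<in>I. if j = i then x i k' else x j (k j)"
            have "?v \<in> E" using k k' by (auto simp: E_def)
            then have vK: "?v \<in> K" using EK by auto
            have "near I r z ?v"
              unfolding near_def
            proof
              fix j assume j: "j \<in> I"
              have "absval (x i k' - t) \<le> r"
                using xy'[OF i k'(1)] k'(2) e(2) absval_minus_commute[of t "x i k'"] by simp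
              then have "absval (x i k' - z i) \<le> r" using near_z[OF i t] by (rule absval_trans)
              then show "absval (?v j - z j) \<le> r" using j r by (auto simp: z_def)
            qed
            then have "?v \<in> Q (rep z)" using near_trans[OF rz(2)] vK KU by (auto simp: Q_def)
            then show "x i k' \<in> (\<lambda>x. x i) ` (K \<inter> Q (rep z))"
              using vK i by (intro image_eqI[of _ _ ?v]) auto
            show "absval (t - x i k') \<le> fst (q (rep z))"
              using xy'[OF i k'(1)] k'(2) e(3)[OF zE] by simp
          qed
          ultimately show "t \<in> {t \<in> factor (Q (rep z)) i.
            \<exists>s\<in>(\<lambda>x. x i) ` (K \<inter> Q (rep z)). absval (t - s) \<le> fst (q (rep z))}" by simp
        next
          fix j assume j: "j < l"
          have "node_degree (J j) Y \<le> sum \<gamma> (J j)"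
            unfolding node_degree_def
          proof (rule sum_mono)
            fix i assume "i \<in> J j"
            then have "i \<in> I" using j I(3) by auto
            then have "card (Y i) \<le> card (?X i)" by (intro card_mono Y(1)) auto
            then show "card (Y i) - 1 \<le> \<gamma> i" using card_le[of i] by linarith
          qed
          then show "node_degree (J j) Y \<le> \<beta> j" using \<gamma>[OF j] by linarith
        qed
        then have "smul (inverse p ^ m) (set_dd smul I (\<lambda>x. f x - snd (q (rep z)) x) Y) \<in> M"
          using q rz(1) by blast
        moreover have "set_dd smul I ?h Y = set_dd smul I (\<lambda>x. f x - snd (q (rep z)) x) Y"
          using g[OF zK zz] in_Q(2) by (intro set_dd_cong) auto
        ultimately have "smul (inverse p ^ m) (set_dd smul I ?h Y) \<in> M" by simp
        then have "smul (p ^ node_degree I Y) (smul (inverse p ^ m) (set_dd smul I ?h Y)) \<in> M"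
          by (rule submodule_scale[OF M(1)]) (use p in \<open>simp add: absval_power power_le_one\<close>)
        moreover have "node_degree I Y \<le> m"
        proof -
          have "node_degree I Y \<le> node_degree I ?X"
            unfolding node_degree_def by (intro sum_mono diff_le_mono card_mono Y(1)) auto
          then show ?thesis using deg_le by linarith
        qed
        then have "p ^ node_degree I Y * inverse p ^ m = inverse p ^ (m - node_degree I Y)"
          using p(1) by (simp add: power_diff field_simps)
        ultimately show "smul (inverse p ^ (m - node_degree I Y)) (set_dd smul I ?h Y) \<in> M"
          by simp
      qed (use deg_le in auto)
      then have "smul (p ^ (m - node_degree I ?X))
          (smul (inverse p ^ (m - node_degree I ?X)) (set_dd smul I ?h ?X)) \<in> M"
        by (rule submodule_scale[OF M(1)]) (use p in \<open>simp add: absval_power power_le_one\<close>)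
      then show ?thesis using p(1) by (simp flip: power_mult_distrib)
    qed
    then show ?thesis using e(1) by blast
  qed
  ultimately show ?thesis by blast
qed

end

section \<open>Density\<close>

text \<open>Neighbourhoods of f form a filter, so a property stable under supersets and
  intersections need only be checked on subbasic sets containing f. No bases of the nested initial
  topologies have to be described.\<close>

lemma generated_topology_nhd:
  assumes "openin (topology_generated_by B) W" "f \<in> W"
    and mono: "\<And>A A'. Q A \<Longrightarrow> A \<subseteq> A' \<Longrightarrow> Q A'"
    and int: "\<And>A A'. Q A \<Longrightarrow> Q A' \<Longrightarrow> Q (A \<inter> A')"
    and base: "\<And>b. b \<in> B \<Longrightarrow> f \<in> b \<Longrightarrow> Q b"
  shows "Q W"
proof -
  have "generate_topology_on B W" using assms(1) by (simp add: openin_topology_generated_by_iff)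
  then show ?thesis using assms(2)
  proof (induction rule: generate_topology_on.induct)
    case (UN K)
    then obtain A where "A \<in> K" "f \<in> A" by blast
    then show ?case using UN.IH mono[of A "\<Union>K"] by blast
  qed (use int base in auto)
qed

lemma sum_singleton_times: "sum \<eta> ({j} \<times> A) = (\<Sum>i\<in>A. \<eta> (j, i))"
proof -
  have "{j} \<times> A = Pair j ` A" by auto
  then show ?thesis by (simp add: sum.reindex inj_on_def)
qed

lemma block_le_subset_multi_indices_le:
  assumes "\<And>j. j < l \<Longrightarrow> enat (\<beta> j) \<le> \<alpha> j"
  shows "block_le (\<lambda>j. {j} \<times> {..<n j}) \<beta> l \<subseteq> multi_indices_le l n \<alpha>"
proof
  fix \<eta> assume \<eta>: "\<eta> \<in> block_le (\<lambda>j. {j} \<times> {..<n j}) \<beta> l"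
  have "(\<Union>j<l. {j} \<times> {..<n j}) = block_indices l n" by (auto simp: block_indices_def)
  moreover have "enat (\<Sum>i<n j. \<eta> (j, i)) \<le> \<alpha> j" if "j < l" for j
  proof -
    have "(\<Sum>i<n j. \<eta> (j, i)) = sum \<eta> ({j} \<times> {..<n j})"
      by (simp add: sum_singleton_times)
    also have "\<dots> \<le> \<beta> j" using \<eta> that by (simp add: block_le_def)
    finally show ?thesis using assms[OF that] by (meson enat_ord_simps(1) order_trans)
  qed
  ultimately show "\<eta> \<in> multi_indices_le l n \<alpha>"
    using \<eta> by (simp add: multi_indices_le_def multi_indices_def block_le_def)
qed

text \<open>Ensures that the topologies of C^\<eta> for \<eta> in N involve orders in N
  only.\<close>

lemma multi_indices_le_downward:
  assumes "\<eta> \<in> multi_indices_le l n \<alpha>" "\<gamma> \<in> lower_multi_indices (block_indices l n) \<eta>"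
  shows "\<gamma> \<in> multi_indices_le l n \<alpha>"
proof -
  have "enat (\<Sum>i<n j. \<gamma> (j, i)) \<le> \<alpha> j" if "j < l" for j
  proof -
    have "(\<Sum>i<n j. \<gamma> (j, i)) \<le> (\<Sum>i<n j. \<eta> (j, i))"
      using assms(2) that by (intro sum_mono) (auto simp: lower_multi_indices_def block_indices_def)
    then show ?thesis using assms(1) that unfolding multi_indices_le_def
      by (metis (mono_tags, lifting) enat_ord_simps(1) mem_Collect_eq order_trans)
  qed
  then show ?thesis using assms(2) by (simp add: multi_indices_le_def lower_multi_indices_def)
qed

context ultrametric_lcs
begin

lemma polynomial_on_mono:
  assumes "polynomial_on smul I N V f" "N \<subseteq> N'"
  shows "polynomial_on smul I N' V f"
proof -
  obtain a where "finite {\<eta> \<in> N. a \<eta> \<noteq> 0}"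
      "\<forall>x\<in>V. f x = (\<Sum>\<eta> | \<eta> \<in> N \<and> a \<eta> \<noteq> 0. smul (\<Prod>i\<in>I. x i ^ \<eta> i) (a \<eta>))"
    using assms(1) unfolding polynomial_on_def by blast
  then show ?thesis
    using assms(2) by (intro polynomial_on_sum[of "{\<eta> \<in> N. a \<eta> \<noteq> 0}"]) auto
qed

lemma LocPol_is_div_diff_ext:
  fixes U :: "('i \<Rightarrow> 'k) set"
  assumes "finite I" "I \<noteq> {}" "U \<subseteq> coord_space I" "f \<in> LocPol smul I N U"
    and V: "V \<in> cartesian_open_subsets I U"
  shows "\<exists>g. is_div_diff_ext smul I V (restrict f V) \<gamma> g"
proof (rule locally_polynomial_div_diff_ext[OF assms(1,2)])
  have opn: "openin (top_of_set U) V" and VU: "V \<subseteq> U"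
    using V openin_imp_subset by (auto simp: cartesian_open_subsets_def)
  show "cartesian I V" using V by (simp add: cartesian_open_subsets_def)
  fix z assume z: "z \<in> V"
  then obtain W where W: "openin (top_of_set U) W" "z \<in> W" "polynomial_on smul I N W f"
    using assms(4) VU unfolding LocPol_def by blast
  then obtain d where d: "0 < d" "\<forall>y\<in>U. near I d z y \<longrightarrow> y \<in> W"
    using openin_contains_near[OF assms(1) W(1,2) assms(3)] by blast
  have "polynomial_on smul I N {y \<in> V. near I d z y} (restrict f V)"
    by (rule polynomial_on_subset[OF W(3)]) (use d(2) VU in auto)
  then show "\<exists>d>0. polynomial_on smul I N {y \<in> V. near I d z y} (restrict f V)" using d(1) by blast
qed

lemma LocPol_subset_C_alpha:
  fixes U :: "('i \<Rightarrow> 'k) set"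
  assumes "finite I" "I \<noteq> {}" "U \<subseteq> coord_space I"
  shows "LocPol smul I N U \<subseteq> C_alpha smul I N' U"
  using LocPol_is_div_diff_ext[OF assms]
  by (auto simp: C_alpha_def C_eta_def C_eta_cartesian_def LocPol_def)

section \<open>Basic neighbourhoods in the topology of C^\<alpha>\<close>

definition nhd_data ::
    "'i set \<Rightarrow> ('i \<Rightarrow> nat) set \<Rightarrow> ('i \<Rightarrow> 'k) set \<Rightarrow>
     (('i \<Rightarrow> nat) \<times> ('i \<Rightarrow> 'k) set \<times> ('i \<Rightarrow> nat \<Rightarrow> 'k) set) set \<Rightarrow> bool" where
  "nhd_data I N U D \<longleftrightarrow> finite D \<and> (\<forall>\<gamma> V C. (\<gamma>, V, C) \<in> D \<longrightarrow> \<gamma> \<in> N \<and>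
     V \<in> cartesian_open_subsets I U \<and> C \<subseteq> mult_dom I V \<gamma> \<and> compact C)"

definition ext_close ::
    "'i set \<Rightarrow> (('i \<Rightarrow> nat) \<times> ('i \<Rightarrow> 'k) set \<times> ('i \<Rightarrow> nat \<Rightarrow> 'k) set) set \<Rightarrow> 'e set \<Rightarrow>
     (('i \<Rightarrow> 'k) \<Rightarrow> 'e) \<Rightarrow> (('i \<Rightarrow> 'k) \<Rightarrow> 'e) \<Rightarrow> bool" where
  "ext_close I D M f g \<longleftrightarrow> (\<forall>\<gamma> V C. (\<gamma>, V, C) \<in> D \<longrightarrow> (\<forall>x\<in>C.
     div_diff_ext smul I V (restrict g V) \<gamma> x - div_diff_ext smul I V (restrict f V) \<gamma> x \<in> M))"

text \<open>Finitely many compact-open conditions with one common M. That W contains the set they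
  define is all that density asks for.\<close>

definition basic_nhd ::
    "'i set \<Rightarrow> ('i \<Rightarrow> nat) set \<Rightarrow> ('i \<Rightarrow> 'k) set \<Rightarrow> (('i \<Rightarrow> 'k) \<Rightarrow> 'e) \<Rightarrow> (('i \<Rightarrow> 'k) \<Rightarrow> 'e) set \<Rightarrow> bool" where
  "basic_nhd I N U f W \<longleftrightarrow>
     (\<exists>D M. nhd_data I N U D \<and> O_submodule smul M \<and> open M \<and>
       (\<forall>g\<in>C_alpha smul I N U. ext_close I D M f g \<longrightarrow> g \<in> W))"

lemma basic_nhd_mono: "basic_nhd I N U f W \<Longrightarrow> W \<subseteq> W' \<Longrightarrow> basic_nhd I N U f W'"
  unfolding basic_nhd_def by blast

lemma basic_nhd_Int:
  assumes "basic_nhd I N U f W" "basic_nhd I N U f W'"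
  shows "basic_nhd I N U f (W \<inter> W')"
proof -
  obtain D M where D: "nhd_data I N U D" "O_submodule smul M" "open M"
     "\<forall>g\<in>C_alpha smul I N U. ext_close I D M f g \<longrightarrow> g \<in> W"
    using assms(1) unfolding basic_nhd_def by blast
  obtain D' M' where D': "nhd_data I N U D'" "O_submodule smul M'" "open M'"
     "\<forall>g\<in>C_alpha smul I N U. ext_close I D' M' f g \<longrightarrow> g \<in> W'"
    using assms(2) unfolding basic_nhd_def by blast
  have "nhd_data I N U (D \<union> D')" using D(1) D'(1) by (auto simp: nhd_data_def)
  moreover have "O_submodule smul (M \<inter> M')" using D(2) D'(2) by (simp add: O_submodule_def)
  moreover have "open (M \<inter> M')" using D(3) D'(3) by (rule open_Int)
  moreover have "ext_close I D M f g" "ext_close I D' M' f g"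
    if "ext_close I (D \<union> D') (M \<inter> M') f g" for g
    using that by (simp_all add: ext_close_def)
  ultimately show ?thesis unfolding basic_nhd_def using D(4) D'(4) by blast
qed

text \<open>C is covered by finitely many sets on which h differs from \<open>h z\<close> by
  elements of \<open>R z\<close>, and the \<open>R z\<close> are intersected. Closed under addition,
  \<open>R z\<close> absorbs both v - h x and h x - h z, so no halving of neighbourhoods is
  involved.\<close>

lemma compact_translate_submodule:
  fixes h :: "'a::topological_space \<Rightarrow> 'e"
  assumes "compact C" "continuous_on C h" "open A" "h ` C \<subseteq> A"
  obtains M where "O_submodule smul M" "open M" "\<And>x v. x \<in> C \<Longrightarrow> v - h x \<in> M \<Longrightarrow> v \<in> A"
proof -
  have "\<exists>M. open M \<and> O_submodule smul M \<and> (\<forall>v. v - h x \<in> M \<longrightarrow> v \<in> A)" if x: "x \<in> C" for x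
  proof -
    have "open ((\<lambda>v. v + h x) -` A)"
      using assms(3) by (intro open_vimage continuous_on_add continuous_on_id continuous_on_const)
    moreover have "0 \<in> (\<lambda>v. v + h x) -` A" using assms(4) x by auto
    ultimately obtain M where M: "open M" "O_submodule smul M" "M \<subseteq> (\<lambda>v. v + h x) -` A"
      using O_submodule_basis by blast
    have "v \<in> A" if "v - h x \<in> M" for v using subsetD[OF M(3) that] by simp
    then show ?thesis using M by blast
  qed
  then obtain R where R: "\<And>x. x \<in> C \<Longrightarrow> open (R x)" "\<And>x. x \<in> C \<Longrightarrow> O_submodule smul (R x)"
      "\<And>x v. x \<in> C \<Longrightarrow> v - h x \<in> R x \<Longrightarrow> v \<in> A"
    by metis
  have "\<exists>T. open T \<and> T \<inter> C = (h -` {v. v - h x \<in> R x}) \<inter> C" if "x \<in> C" for x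
    using assms(2)[unfolded continuous_on_open_invariant, rule_format,
        OF open_translated_submodule[OF R(1)[OF that]]] .
  then obtain T where T: "\<And>x. x \<in> C \<Longrightarrow> open (T x)"
      "\<And>x. x \<in> C \<Longrightarrow> T x \<inter> C = (h -` {v. v - h x \<in> R x}) \<inter> C" by metis
  have "x \<in> T x" if x: "x \<in> C" for x
  proof -
    have "x \<in> (h -` {v. v - h x \<in> R x}) \<inter> C" using x submodule_zero[OF R(2)[OF x]] by simp
    then show ?thesis using T(2)[OF x] by blast
  qed
  then have "C \<subseteq> (\<Union>x\<in>C. T x)" by blast
  then obtain Z where Z: "Z \<subseteq> C" "finite Z" "C \<subseteq> (\<Union>x\<in>Z. T x)"
    using compactE_image[OF assms(1), of C T] T(1) by metis
  define M where "M = (\<Inter>x\<in>Z. R x)"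
  show thesis
  proof (rule that[of M])
    show "O_submodule smul M"
      unfolding O_submodule_def M_def
    proof (intro conjI ballI allI impI INT_I)
      fix z assume "z \<in> Z"
      then show "0 \<in> R z" using R(2) Z(1) submodule_zero by blast
    next
      fix x y z assume "z \<in> Z" "x \<in> (\<Inter>x\<in>Z. R x)" "y \<in> (\<Inter>x\<in>Z. R x)"
      then show "x + y \<in> R z" using R(2)[of z] Z(1) by (intro submodule_add) auto
    next
      fix c :: 'k and x z assume "z \<in> Z" "x \<in> (\<Inter>x\<in>Z. R x)" "absval c \<le> 1"
      then show "smul c x \<in> R z" using R(2)[of z] Z(1) by (intro submodule_scale) auto
    qed
    show "open M" unfolding M_def using Z(1,2) R(1) by (intro open_INT) auto
    fix x v assume x: "x \<in> C" and v: "v - h x \<in> M"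
    then obtain z where z: "z \<in> Z" "x \<in> T z" using Z(3) by auto
    then have zC: "z \<in> C" using Z(1) by auto
    have "x \<in> (h -` {v. v - h z \<in> R z}) \<inter> C" using T(2)[OF zC] z(2) x by blast
    then have "h x - h z \<in> R z" by simp
    moreover have "v - h x \<in> R z" using v z(1) by (auto simp: M_def)
    ultimately have "(v - h x) + (h x - h z) \<in> R z" using submodule_add[OF R(2)[OF zC]] by blast
    then show "v \<in> A" using R(3)[OF zC] by simp
  qed
qed

lemma C_alpha_div_diff_ext:
  fixes U :: "('i \<Rightarrow> 'k) set"
  assumes "finite I" "I \<noteq> {}" "f \<in> C_alpha smul I N U" "\<gamma> \<in> N" "N \<subseteq> multi_indices I"
    and "V \<in> cartesian_open_subsets I U"
  shows "is_div_diff_ext smul I V (restrict f V) \<gamma> (div_diff_ext smul I V (restrict f V) \<gamma>)"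
proof (rule div_diff_ext_is[OF assms(1,2)])
  show "cartesian I V" using assms(6) by (simp add: cartesian_open_subsets_def)
  have "\<gamma> \<in> lower_multi_indices I \<gamma>" using assms(4,5) by (auto simp: lower_multi_indices_def)
  then show "\<exists>g. is_div_diff_ext smul I V (restrict f V) \<gamma> g"
    using assms(3,4,6) by (auto simp: C_alpha_def C_eta_def C_eta_cartesian_def)
qed

text \<open>\<open>generated_topology_nhd\<close> peels off three layers: the compact-open topology,
  C^\<eta>, C^\<alpha>. Intersections are absorbed by uniting the data and intersecting the
  submodules.\<close>

lemma openin_C_alpha_topology_basic_nhd:
  fixes U :: "('i \<Rightarrow> 'k) set"
  assumes I: "finite I" "I \<noteq> {}" and N: "N \<subseteq> multi_indices I"
    and down: "\<And>\<eta>. \<eta> \<in> N \<Longrightarrow> lower_multi_indices I \<eta> \<subseteq> N"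
    and f: "f \<in> C_alpha smul I N U"
    and W: "openin (C_alpha_topology smul I N U) W" "f \<in> W"
  shows "basic_nhd I N U f W"
proof -
  let ?e = "\<lambda>g V \<gamma>. div_diff_ext smul I V (restrict g V) \<gamma>"
  \<comment> \<open>Empty data cover the carrier set, which belongs to the subbasis of every initial
    topology.\<close>
  have whole: "basic_nhd I N U f B" if "C_alpha smul I N U \<subseteq> B" for B
    unfolding basic_nhd_def using that
    by (intro exI[of _ "{}"] exI[of _ UNIV]) (auto simp: O_submodule_def nhd_data_def)
  have co: "basic_nhd I N U f {g. ?e g V \<gamma> \<in> B}"
    if \<gamma>: "\<gamma> \<in> N" and V: "V \<in> cartesian_open_subsets I U"
      and B: "openin (compact_open_topology (mult_dom I V \<gamma>)) B" "?e f V \<gamma> \<in> B" for \<gamma> V B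
    using B(1)[unfolded compact_open_topology_def] B(2)
  proof (rule generated_topology_nhd[where Q = "\<lambda>B. basic_nhd I N U f {g. ?e g V \<gamma> \<in> B}"])
    show "basic_nhd I N U f {g. ?e g V \<gamma> \<in> A'}" if "basic_nhd I N U f {g. ?e g V \<gamma> \<in> A}" "A \<subseteq> A'" for A A'
      by (rule basic_nhd_mono[OF that(1)]) (use that(2) in auto)
    show "basic_nhd I N U f {g. ?e g V \<gamma> \<in> A \<inter> A'}"
      if "basic_nhd I N U f {g. ?e g V \<gamma> \<in> A}" "basic_nhd I N U f {g. ?e g V \<gamma> \<in> A'}" for A A'
      by (rule basic_nhd_mono[OF basic_nhd_Int[OF that]]) auto
    fix b assume "b \<in> {{g \<in> cont_maps (mult_dom I V \<gamma>). g ` C \<subseteq> A} |C A. C \<subseteq> mult_dom I V \<gamma> \<and> compact C \<and> open A}"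
      and fb: "?e f V \<gamma> \<in> b"
    then obtain C A where b: "b = {g \<in> cont_maps (mult_dom I V \<gamma>). g ` C \<subseteq> A}"
      and C: "C \<subseteq> mult_dom I V \<gamma>" "compact C" and A: "open A" by blast
    have "continuous_on C (?e f V \<gamma>)" "?e f V \<gamma> ` C \<subseteq> A"
      using fb C(1) by (auto simp: b cont_maps_def elim: continuous_on_subset)
    from compact_translate_submodule[OF C(2) this(1) A this(2)]
    obtain M where M: "O_submodule smul M" "open M"
      "\<And>x v. x \<in> C \<Longrightarrow> v - ?e f V \<gamma> x \<in> M \<Longrightarrow> v \<in> A" by blast
    show "basic_nhd I N U f {g. ?e g V \<gamma> \<in> b}"
      unfolding basic_nhd_def
    proof (intro exI[of _ "{(\<gamma>, V, C)}"] exI[of _ M] conjI ballI impI)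
      fix g assume g: "g \<in> C_alpha smul I N U" "ext_close I {(\<gamma>, V, C)} M f g"
      have "?e g V \<gamma> \<in> cont_maps (mult_dom I V \<gamma>)"
        using C_alpha_div_diff_ext[OF I g(1) \<gamma> N V] by (simp add: is_div_diff_ext_def)
      moreover have "?e g V \<gamma> ` C \<subseteq> A" using g(2) M(3) by (auto simp: ext_close_def)
      ultimately show "g \<in> {g. ?e g V \<gamma> \<in> b}" by (simp add: b)
    qed (use \<gamma> V C M in \<open>auto simp: nhd_data_def\<close>)
  qed
  have eta: "basic_nhd I N U f B" if \<eta>: "\<eta> \<in> N" and B: "openin (C_eta_topology smul I \<eta> U) B" "f \<in> B" for \<eta> B
    using B(1)[unfolded C_eta_topology_def initial_topology_def] B(2)
  proof (rule generated_topology_nhd[where Q = "basic_nhd I N U f", OF _ _ basic_nhd_mono basic_nhd_Int])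
    have sub: "C_alpha smul I N U \<subseteq> C_eta smul I \<eta> U" using \<eta> by (auto simp: C_alpha_def)
    fix b assume "b \<in> insert (C_eta smul I \<eta> U) {C_eta smul I \<eta> U \<inter>
        (case j of (\<gamma>, V) \<Rightarrow> \<lambda>f. ?e f V \<gamma>) -` W |j W.
        j \<in> lower_multi_indices I \<eta> \<times> cartesian_open_subsets I U \<and>
        openin (case j of (\<gamma>, V) \<Rightarrow> compact_open_topology (mult_dom I V \<gamma>)) W}" and fb: "f \<in> b"
    then consider "b = C_eta smul I \<eta> U" | \<gamma> V B where "b = C_eta smul I \<eta> U \<inter> {g. ?e g V \<gamma> \<in> B}"
      "\<gamma> \<in> lower_multi_indices I \<eta>" "V \<in> cartesian_open_subsets I U"
      "openin (compact_open_topology (mult_dom I V \<gamma>)) B"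
      by (auto simp: vimage_def)
    then show "basic_nhd I N U f b"
    proof cases
      case 1
      then show ?thesis using whole sub by simp
    next
      case 2
      then have "basic_nhd I N U f {g. ?e g V \<gamma> \<in> B}"
        using down[OF \<eta>] fb by (intro co) auto
      from basic_nhd_Int[OF whole[OF sub] this] show ?thesis using 2(1) by simp
    qed
  qed
  show ?thesis
    using W(1)[unfolded C_alpha_topology_def initial_topology_def] W(2)
  proof (rule generated_topology_nhd[where Q = "basic_nhd I N U f", OF _ _ basic_nhd_mono basic_nhd_Int])
    fix b assume "b \<in> insert (C_alpha smul I N U) {C_alpha smul I N U \<inter> (\<lambda>f. f) -` W |j W.
        j \<in> N \<and> openin (C_eta_topology smul I j U) W}" and fb: "f \<in> b"
    then consider "b = C_alpha smul I N U" | \<eta> B where "b = C_alpha smul I N U \<inter> B" "\<eta> \<in> N"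
      "openin (C_eta_topology smul I \<eta> U) B"
      by (auto simp: vimage_def)
    then show "basic_nhd I N U f b"
    proof cases
      case 1
      then show ?thesis using whole by simp
    next
      case 2
      then have "basic_nhd I N U f B" using fb by (intro eta) auto
      from basic_nhd_Int[OF whole[OF subset_refl] this] show ?thesis using 2(1) by simp
    qed
  qed
qed

text \<open>Entries of x may coincide, where the estimate for distinct nodes says nothing directly.
  The difference of the extensions is continuous and M is closed, so the estimate passes to the
  limit.\<close>

lemma div_diff_ext_diff_in_submodule:
  fixes V :: "('i \<Rightarrow> 'k) set"
  assumes I: "finite I" "I \<noteq> {}" "cartesian I V"
    and M: "O_submodule smul M" "open M"
    and F: "is_div_diff_ext smul I V f \<gamma> F" and G: "is_div_diff_ext smul I V g \<gamma> G"
    and x: "x \<in> mult_dom I V \<gamma>" and e: "0 < e"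
    and near: "\<And>y. y \<in> mult_dom_distinct I V \<gamma> \<Longrightarrow> near_tuples I \<gamma> e x y \<Longrightarrow>
      set_dd smul I (\<lambda>x. f x - g x) (\<lambda>i. y i ` {..\<gamma> i}) \<in> M"
  shows "F x - G x \<in> M"
proof (rule continuous_on_closed_limit[where S = "mult_dom I V \<gamma>"])
  show "continuous_on (mult_dom I V \<gamma>) (\<lambda>x. F x - G x)"
    using F G by (intro continuous_on_diff) (auto simp: is_div_diff_ext_def cont_maps_def)
  show "closed M" by (rule closed_open_submodule[OF M])
  show "x \<in> mult_dom I V \<gamma>" by (fact x)
  fix W assume W: "open W" "x \<in> W"
  have "open (W \<inter> {y. near_tuples I \<gamma> e x y})" "x \<in> W \<inter> {y. near_tuples I \<gamma> e x y}"
    using W open_near_tuples[OF I(1) e] e by auto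
  from ext_dense[OF I x this] obtain y where y: "y \<in> W \<inter> {y. near_tuples I \<gamma> e x y}"
      "y \<in> mult_dom_distinct I V \<gamma>" "y \<in> mult_dom I V \<gamma>" by blast
  have "F y - G y = set_dd smul I (\<lambda>x. f x - g x) (\<lambda>i. y i ` {..\<gamma> i})"
    using F G y(2) div_diff_eq_set_dd[OF I(1) y(2), of smul] by (simp add: is_div_diff_ext_def set_dd_minus)
  then show "\<exists>y\<in>W \<inter> mult_dom I V \<gamma>. F y - G y \<in> M" using near[of y] y by (intro bexI[of _ y]) auto
qed

end

theorem proposition9p11:
  fixes smul :: "'k::{ultrametric_field, complete_space} \<Rightarrow> 'e::{topological_ab_group_add, t2_space} \<Rightarrow> 'e"
    and l :: nat and n :: "nat \<Rightarrow> nat" and \<alpha> :: "nat \<Rightarrow> enat"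
    and I :: "(nat \<times> nat) set" and N :: "(nat \<times> nat \<Rightarrow> nat) set"
    and U :: "(nat \<times> nat \<Rightarrow> 'k) set"
  defines "I \<equiv> block_indices l n"
    and "N \<equiv> multi_indices_le l n \<alpha>"
  assumes "ultrametric_lcs smul"
    and "l \<ge> 1" and "\<And>j. j < l \<Longrightarrow> n j \<ge> 1"
    and "locally_closed_in (coord_space I) U"
    and "locally_cartesian I U"
  shows "LocPol smul I N U \<subseteq> C_alpha smul I N U
    \<and> C_alpha_topology smul I N U closure_of LocPol smul I N U = C_alpha smul I N U"
proof -
  interpret ultrametric_lcs smul by fact
  define J where "J j = {j} \<times> {..<n j}" for j
  have I: "finite I" "I \<noteq> {}" "I = (\<Union>j<l. J j)"
    using assms(4) assms(5)[of 0] by (auto simp: I_def block_indices_def J_def lessThan_empty_iff Suc_le_eq)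
  have disj: "J j \<inter> J k = {}" if "j < k" for j k using that by (auto simp: J_def)
  have U: "U \<subseteq> coord_space I" using assms(7) by (simp add: locally_cartesian_def)
  have N: "N \<subseteq> multi_indices I" by (auto simp: N_def I_def multi_indices_le_def)
  have down: "lower_multi_indices I \<eta> \<subseteq> N" if "\<eta> \<in> N" for \<eta>
    using multi_indices_le_downward that unfolding N_def I_def by blast
  have sub: "LocPol smul I N U \<subseteq> C_alpha smul I N U" by (rule LocPol_subset_C_alpha[OF I(1,2) U])
  have "\<exists>g\<in>LocPol smul I N U. g \<in> W"
    if f: "f \<in> C_alpha smul I N U" and W: "f \<in> W" "openin (C_alpha_topology smul I N U) W" for f W
  proof -
    let ?e = "\<lambda>g V \<gamma>. div_diff_ext smul I V (restrict g V) \<gamma>"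
    have "basic_nhd I N U f W"
      by (rule openin_C_alpha_topology_basic_nhd[OF I(1,2) N down f W(2,1)])
    then obtain D M where data: "nhd_data I N U D" and M: "O_submodule smul M" "open M"
      and DW: "\<forall>g\<in>C_alpha smul I N U. ext_close I D M f g \<longrightarrow> g \<in> W"
      unfolding basic_nhd_def by blast
    have D: "finite D" and DN: "\<And>\<gamma> V C. (\<gamma>, V, C) \<in> D \<Longrightarrow>
        \<gamma> \<in> N \<and> V \<in> cartesian_open_subsets I U \<and> C \<subseteq> mult_dom I V \<gamma> \<and> compact C"
      using data by (auto simp: nhd_data_def)
    \<comment> \<open>The largest order in block j that occurs in D: a finite bound in place of a
      possibly infinite \<open>\<alpha> j\<close>. The element 0 covers empty D.\<close>
    define \<beta> where "\<beta> j = Max (insert 0 ((\<lambda>d. sum (fst d) (J j)) ` D))" for j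
    have sum_le: "sum \<gamma> (J j) \<le> \<beta> j" if "(\<gamma>, V, C) \<in> D" for \<gamma> V C j
      unfolding \<beta>_def using D that by (intro Max_ge) force+
    have sum_J: "sum \<gamma> (J j) = (\<Sum>i<n j. \<gamma> (j, i))" for \<gamma> :: "nat \<times> nat \<Rightarrow> nat" and j
      unfolding J_def by (rule sum_singleton_times)
    have \<beta>: "enat (\<beta> j) \<le> \<alpha> j" if j: "j < l" for j
    proof -
      have "\<beta> j \<in> insert 0 ((\<lambda>d. sum (fst d) (J j)) ` D)" unfolding \<beta>_def using D by (intro Max_in) auto
      then consider "\<beta> j = 0" | \<gamma> V C where "(\<gamma>, V, C) \<in> D" "\<beta> j = sum \<gamma> (J j)" by force
      then show ?thesis
      proof cases
        case 2
        then have "\<gamma> \<in> N" using DN by blast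
        then show ?thesis using 2(2) j by (simp add: N_def multi_indices_le_def sum_J)
      qed (simp add: zero_enat_def[symmetric])
    qed
    have SN: "block_le J \<beta> l \<subseteq> N"
      unfolding N_def J_def[abs_def] by (rule block_le_subset_multi_indices_le) (rule \<beta>)
    have D_block: "\<gamma> \<in> block_le J \<beta> l" if "(\<gamma>, V, C) \<in> D" for \<gamma> V C
      using DN[OF that] sum_le[OF that] N I(3) by (auto simp: block_le_def multi_indices_def)
    \<comment> \<open>Interpolation uses all orders bounded by \<beta>, not only those in D; they
      belong to N, so f has these extensions.\<close>
    have f_ext: "\<exists>g. is_div_diff_ext smul I V f \<gamma> g"
      if "\<gamma> \<in> block_le J \<beta> l" "V \<in> cartesian_open_subsets I U" for \<gamma> V
    proof -
      have "V = PiE I (factor V)"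
        using that(2) by (intro cartesian_eq_PiE_factor(1)[OF I(2)]) (simp add: cartesian_open_subsets_def)
      from is_div_diff_ext_cong[OF _ this C_alpha_div_diff_ext[OF I(1,2) f subsetD[OF SN that(1)] N that(2)]]
      have "is_div_diff_ext smul I V f \<gamma> (?e f V \<gamma>)" by simp
      then show ?thesis by blast
    qed
    let ?pol = "\<lambda>g. \<forall>z\<in>U. \<exists>e>0. polynomial_on smul I (block_le J \<beta> l) {y \<in> U. near I e z y} g"
    let ?approx = "\<lambda>g. \<forall>\<gamma> V C. (\<gamma>, V, C) \<in> D \<longrightarrow> (\<forall>x\<in>C. \<exists>e>0. \<forall>y\<in>mult_dom_distinct I V \<gamma>.
        near_tuples I \<gamma> e x y \<longrightarrow> set_dd smul I (\<lambda>x. f x - g x) (\<lambda>i. y i ` {..\<gamma> i}) \<in> M)"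
    have "\<exists>g. ?pol g \<and> ?approx g"
      by (rule global_approximation[OF I disj U M D _ f_ext]) (use D_block DN in blast)+
    then obtain g where g: "?pol g" "?approx g" by blast
    have "\<exists>V. openin (top_of_set U) V \<and> z \<in> V \<and> polynomial_on smul I N V (restrict g U)" if z: "z \<in> U" for z
    proof -
      obtain e where e: "0 < e" "polynomial_on smul I (block_le J \<beta> l) {y \<in> U. near I e z y} g"
        using g(1) z by blast
      have "polynomial_on smul I N {y \<in> U. near I e z y} (restrict g U)"
        by (rule polynomial_on_subset[OF polynomial_on_mono[OF e(2) SN] subset_refl]) simp
      then show ?thesis using openin_near[OF I(1) e(1)] z e(1)
        by (intro exI[of _ "{y \<in> U. near I e z y}"]) simp
    qed
    then have gL: "restrict g U \<in> LocPol smul I N U" by (simp add: LocPol_def)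
    have gC: "restrict g U \<in> C_alpha smul I N U" using gL sub by blast
    have "ext_close I D M f (restrict g U)"
      unfolding ext_close_def
    proof (intro allI impI ballI)
      fix \<gamma> V C x assume d: "(\<gamma>, V, C) \<in> D" and x: "x \<in> C"
      have \<gamma>: "\<gamma> \<in> N" and V: "V \<in> cartesian_open_subsets I U" and xD: "x \<in> mult_dom I V \<gamma>"
        using DN[OF d] x by auto
      have cart: "cartesian I V" and VU: "V \<subseteq> U"
        using V openin_imp_subset by (auto simp: cartesian_open_subsets_def)
      note V_eq = cartesian_eq_PiE_factor(1)[OF I(2) cart]
      have F: "is_div_diff_ext smul I V f \<gamma> (?e f V \<gamma>)"
        by (rule is_div_diff_ext_cong[OF _ V_eq C_alpha_div_diff_ext[OF I(1,2) f \<gamma> N V]]) simp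
      have G: "is_div_diff_ext smul I V g \<gamma> (?e (restrict g U) V \<gamma>)"
        by (rule is_div_diff_ext_cong[OF _ V_eq C_alpha_div_diff_ext[OF I(1,2) gC \<gamma> N V]])
          (use VU in auto)
      obtain e where e: "0 < e" "\<forall>y\<in>mult_dom_distinct I V \<gamma>. near_tuples I \<gamma> e x y \<longrightarrow>
          set_dd smul I (\<lambda>x. f x - g x) (\<lambda>i. y i ` {..\<gamma> i}) \<in> M"
        using g(2) d x by blast
      have "?e f V \<gamma> x - ?e (restrict g U) V \<gamma> x \<in> M"
        by (rule div_diff_ext_diff_in_submodule[OF I(1,2) cart M F G xD e(1)]) (use e(2) in blast)
      from submodule_uminus[OF M(1) this]
      show "?e (restrict g U) V \<gamma> x - ?e f V \<gamma> x \<in> M" by simp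
    qed
    then show ?thesis using gL gC DW by blast
  qed
  moreover have "topspace (C_alpha_topology smul I N U) = C_alpha smul I N U"
    by (simp add: C_alpha_topology_def)
  ultimately have "C_alpha_topology smul I N U closure_of LocPol smul I N U = C_alpha smul I N U"
    unfolding closure_of_def by blast
  with sub show ?thesis by blast
qed

end
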